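(* Let $m\ge 1$ and let $n$ be a positive integer. Let $\mathbf{T}=(T_1,\dots,T_m)$ and $\mathbf{S}=(S_1,\dots,S_m)$ be tuples in the Cowen--Douglas class $\mathcal{B}_1^m(\mathbb{B}^m)$ which are the commuting $m$-tuples of backward weighted shifts (i.e. the adjoints of the tuples of multiplication operators by the coordinate functions) on the Hilbert spaces of holomorphic functions on $\mathbb{B}^m$ with reproducing kernels $$\widetilde{K}(z,w)=(1-\langle z,w\rangle)^{-n}\quad\text{and}\quad K(z,w)=\sum_{i=0}^{\infty}a(i)\,(z_1\overline{w}_1+\cdots+z_m\overline{w}_m)^i,\quad a(i)>0,$$ respectively. Suppose that $\mathbf{S}$ is an $n$-hypercontraction. Then $\mathbf{T}$ is similar to $\mathbf{S}$ if and only if there exists a bounded plurisubharmonic function $\psi$ on $\mathbb{B}^m$ such that $$\mathcal{K}_{\mathbf{T}}(w)-\mathcal{K}_{\mathbf{S}}(w)=\sum_{i,j=1}^{m}\frac{\partial^2\psi(w)}{\partial w_i\,\partial\overline{w}_j}\,dw_i\wedge d\overline{w}_j,\qquad w\in\mathbb{B}^m.$$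
   Context: $\mathbb{B}^m=\{w\in\mathbb{C}^m:|w|<1\}$ is the open unit ball and $\langle z,w\rangle=z_1\overline{w}_1+\cdots+z_m\overline{w}_m$. $\mathbf{Z}_+^m$ is the set of $m$-tuples of nonnegative integers; for $\alpha\in\mathbf{Z}_+^m$, $|\alpha|=\alpha_1+\cdots+\alpha_m$, $\alpha!=\alpha_1!\cdots\alpha_m!$, and $e_i\in\mathbf{Z}_+^m$ has $1$ in the $i$th position and $0$ elsewhere. All Hilbert spaces are complex and separable. Backward weighted shifts: if a Hilbert space of holomorphic functions has reproducing kernel $\sum_{\alpha\in\mathbf{Z}_+^m}\rho(\alpha)z^\alpha\overline{w}^\alpha$ with $\rho(\alpha)>0$, then $\mathbf{e}_\alpha(z)=\sqrt{\rho(\alpha)}z^\alpha$ is an orthonormal basis, and the associated tuple of backward weighted shifts is $(M_{z_1}^*,\dots,M_{z_m}^* )$, where $M_{z_i}^*\mathbf{e}_\alpha=\sqrt{\rho(\alpha-e_i)/\rho(\alpha)}\,\mathbf{e}_{\alpha-e_i}$ if $\alpha_i\ge1$ and $M_{z_i}^*\mathbf{e}_\alpha=0$ if $\alpha_i=0$. Cowen--Douglas class: for $\Omega\subset\mathbb{C}^m$ open and connected, $\mathcal{B}_1^m(\Omega)$ is the class of commuting $m$-tuples $\mathbf{T}=(T_1,\dots,T_m)$ of bounded operators on a Hilbert space $\mathcal{H}$ such that, writing $\ker(\mathbf{T}-w)=\bigcap_{i=1}^m\ker(T_i-w_i)$ and $\mathbf{T}-w: x\mapsto((T_1-w_1)x,\dots,(T_m-w_m)x)$: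 (1) $\operatorname{ran}(\mathbf{T}-w)$ is closed for all $w\in\Omega$; (2) the closed linear span of $\bigcup_{w\in\Omega}\ker(\mathbf{T}-w)$ is $\mathcal{H}$; (3) $\dim\ker(\mathbf{T}-w)=1$ for all $w\in\Omega$. Curvature: for $\mathbf{T}\in\mathcal{B}_1^m(\Omega)$, the curvature of the Hermitian holomorphic line bundle $E_{\mathbf{T}}=\{(w,x)\in\Omega\times\mathcal{H}:x\in\ker(\mathbf{T}-w)\}$ is $$\mathcal{K}_{\mathbf{T}}(w)=-\sum_{i,j=1}^m\frac{\partial^2\log\|\gamma(w)\|^2}{\partial w_i\,\partial\overline{w}_j}\,dw_i\wedge d\overline{w}_j,$$ where $\gamma$ is a non-vanishing holomorphic section of $E_{\mathbf{T}}$. (For the adjoint multiplication tuple on a space with kernel $K$ one may take $\gamma(w)=K(\cdot,\overline{w})$.) Similarity: $\mathbf{T}$ and $\mathbf{S}$ are similar if there is a bounded invertible operator $X$ with $XT_i=S_iX$ for all $1\le i\le m$. $n$-hypercontraction: for a commuting tuple $\mathbf{T}$ of bounded operators on $\mathcal{H}$ let $\mathbf{M}_{\mathbf{T}}(X)=\sum_{i=1}^mT_i^*XT_i$ for bounded $X$ on $\mathcal{H}$. $\mathbf{T}$ is an $n$-hypercontraction if $(I-\mathbf{M}_{\mathbf{T}})^k(I)=\sum_{j=0}^k(-1)^j\binom{k}{j}\mathbf{M}_{\mathbf{T}}^j(I)\ge0$ for all $1\le k\le n$. *)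

theory Defs
  imports "HOL-Analysis.Analysis"
begin

section \<open>Complex Hilbert spaces\<close>

text \<open>The inner product is linear in the first argument; its positive definiteness is contained in
  the compatibility with the norm.\<close>

class complex_inner = real_normed_vector +
  fixes scaleC :: "complex \<Rightarrow> 'a \<Rightarrow> 'a"
    and cinner :: "'a \<Rightarrow> 'a \<Rightarrow> complex"
  assumes scaleC_add_right: "scaleC c (x + y) = scaleC c x + scaleC c y"
    and scaleC_add_left: "scaleC (c + d) x = scaleC c x + scaleC d x"
    and scaleC_scaleC: "scaleC c (scaleC d x) = scaleC (c * d) x"
    and scaleC_of_real: "scaleC (complex_of_real r) x = scaleR r x"
    and cinner_commute: "cinner x y = cnj (cinner y x)"
    and cinner_add_left: "cinner (x + y) z = cinner x z + cinner y z"
    and cinner_scaleC_left: "cinner (scaleC c x) y = c * cinner x y"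
    and cinner_self: "cinner x x = complex_of_real ((norm x)\<^sup>2)"

text \<open>All Hilbert spaces are separable, hence \<open>polish_space\<close>.\<close>

class complex_hilbert = complex_inner + polish_space

instantiation complex :: complex_hilbert
begin

definition scaleC_complex :: "complex \<Rightarrow> complex \<Rightarrow> complex"
  where "scaleC_complex c x = c * x"

definition cinner_complex :: "complex \<Rightarrow> complex \<Rightarrow> complex"
  where "cinner_complex x y = x * cnj y"

instance
  by standard
    (auto simp: scaleC_complex_def cinner_complex_def algebra_simps scaleR_conv_of_real
      complex_norm_square simp flip: of_real_power)

end

global_interpretation complex_vector:
  vector_space "scaleC :: complex \<Rightarrow> 'a \<Rightarrow> 'a::complex_inner"
proof
  show "scaleC 1 x = x" for x :: 'a
    using scaleC_of_real[of 1 x] by simp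
qed (simp_all add: scaleC_add_right scaleC_add_left scaleC_scaleC)


section \<open>Operators and commuting tuples\<close>

definition bounded_clinear :: "('a::complex_inner \<Rightarrow> 'b::complex_inner) \<Rightarrow> bool"
  where "bounded_clinear A \<longleftrightarrow> bounded_linear A \<and> (\<forall>c x. A (scaleC c x) = scaleC c (A x))"

text \<open>The adjoint; existence and uniqueness hold for bounded operators on a Hilbert space.\<close>

definition cadjoint :: "('a::complex_hilbert \<Rightarrow> 'b::complex_hilbert) \<Rightarrow> 'b \<Rightarrow> 'a"
  where "cadjoint A = (THE B. \<forall>x y. cinner (A x) y = cinner x (B y))"

definition positive_op :: "('a::complex_inner \<Rightarrow> 'a) \<Rightarrow> bool"
  where "positive_op A \<longleftrightarrow> (\<forall>x. cinner (A x) x \<in> \<real> \<and> 0 \<le> Re (cinner (A x) x))"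

text \<open>An \<open>m\<close>-tuple of operators is a function on a finite index type \<open>'m\<close> with \<open>CARD('m) = m\<close>.\<close>

definition commuting_tuple :: "('m::finite \<Rightarrow> 'a::complex_inner \<Rightarrow> 'a) \<Rightarrow> bool"
  where "commuting_tuple T \<longleftrightarrow>
    (\<forall>i. bounded_clinear (T i)) \<and> (\<forall>i j. T i \<circ> T j = T j \<circ> T i)"

definition similar_tuples ::
  "('m::finite \<Rightarrow> 'a::complex_inner \<Rightarrow> 'a) \<Rightarrow> ('m \<Rightarrow> 'b::complex_inner \<Rightarrow> 'b) \<Rightarrow> bool"
  where "similar_tuples T S \<longleftrightarrow>
    (\<exists>X :: 'a \<Rightarrow> 'b. bounded_clinear X \<and> bij X \<and> bounded_clinear (inv X) \<and>
       (\<forall>i. X \<circ> T i = S i \<circ> X))"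

definition M_map ::
  "('m::finite \<Rightarrow> 'a::complex_hilbert \<Rightarrow> 'a) \<Rightarrow> ('a \<Rightarrow> 'a) \<Rightarrow> 'a \<Rightarrow> 'a"
  where "M_map T X = (\<lambda>x. \<Sum>i\<in>UNIV. cadjoint (T i) (X (T i x)))"

definition hypercontraction :: "nat \<Rightarrow> ('m::finite \<Rightarrow> 'a::complex_hilbert \<Rightarrow> 'a) \<Rightarrow> bool"
  where "hypercontraction n T \<longleftrightarrow> commuting_tuple T \<and>
    (\<forall>k\<in>{1..n}. positive_op
       (\<lambda>x. \<Sum>j\<le>k. ((-1) ^ j * real (k choose j)) *\<^sub>R (M_map T ^^ j) id x))"


section \<open>The Cowen--Douglas class\<close>

definition joint_kernel ::
  "('m::finite \<Rightarrow> 'a::complex_inner \<Rightarrow> 'a) \<Rightarrow> complex ^ 'm \<Rightarrow> 'a set"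
  where "joint_kernel T w = (\<Inter>i. {x. T i x - scaleC (w $ i) x = 0})"

definition cowen_douglas_1 ::
  "(complex ^ 'm::finite) set \<Rightarrow> ('m \<Rightarrow> 'a::complex_hilbert \<Rightarrow> 'a) \<Rightarrow> bool"
  where "cowen_douglas_1 \<Omega> T \<longleftrightarrow>
    open \<Omega> \<and> connected \<Omega> \<and> commuting_tuple T \<and>
    (\<forall>w\<in>\<Omega>. closed (range (\<lambda>x. (\<chi> i. T i x - scaleC (w $ i) x) :: 'a ^ 'm))) \<and>
    closure (complex_vector.span (\<Union>w\<in>\<Omega>. joint_kernel T w)) = UNIV \<and>
    (\<forall>w\<in>\<Omega>. complex_vector.dim (joint_kernel T w) = 1)"


section \<open>Several complex variables\<close>

definition hprod :: "complex ^ 'm::finite \<Rightarrow> complex ^ 'm \<Rightarrow> complex"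
  where "hprod z w = (\<Sum>i\<in>UNIV. z $ i * cnj (w $ i))"

definition holomorphic_vec_on ::
  "(complex ^ 'm::finite \<Rightarrow> 'b::complex_inner) \<Rightarrow> (complex ^ 'm) set \<Rightarrow> bool"
  where "holomorphic_vec_on f U \<longleftrightarrow>
    (\<forall>w\<in>U. \<exists>D. (f has_derivative D) (at w) \<and> (\<forall>c v. D (c *s v) = scaleC c (D v)))"

text \<open>The Wirtinger operators \<open>\<partial>/\<partial>w\<^sub>i = (\<partial>/\<partial>x\<^sub>i - \<i> \<partial>/\<partial>y\<^sub>i) / 2\<close> and
  \<open>\<partial>/\<partial>cnj w\<^sub>i = (\<partial>/\<partial>x\<^sub>i + \<i> \<partial>/\<partial>y\<^sub>i) / 2\<close>, where \<open>w\<^sub>i = x\<^sub>i + \<i> y\<^sub>i\<close>.\<close>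

definition wirtinger_d ::
  "'m::finite \<Rightarrow> (complex ^ 'm \<Rightarrow> complex) \<Rightarrow> complex ^ 'm \<Rightarrow> complex"
  where "wirtinger_d i f w =
    (frechet_derivative f (at w) (axis i 1) - \<i> * frechet_derivative f (at w) (axis i \<i>)) / 2"

definition wirtinger_dbar ::
  "'m::finite \<Rightarrow> (complex ^ 'm \<Rightarrow> complex) \<Rightarrow> complex ^ 'm \<Rightarrow> complex"
  where "wirtinger_dbar i f w =
    (frechet_derivative f (at w) (axis i 1) + \<i> * frechet_derivative f (at w) (axis i \<i>)) / 2"

definition mixed_d :: "'m::finite \<Rightarrow> 'm \<Rightarrow> (complex ^ 'm \<Rightarrow> real) \<Rightarrow> complex ^ 'm \<Rightarrow> complex"
  where "mixed_d i j u = wirtinger_d i (wirtinger_dbar j (\<lambda>w. complex_of_real (u w)))"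

text \<open>For real-valued \<open>u\<close> the functions \<open>\<partial>u/\<partial>cnj w\<^sub>j\<close> carry all first-order real partial
  derivatives of \<open>u\<close>, so this says that \<open>u\<close> is twice real differentiable.\<close>

definition twice_differentiable_on ::
  "(complex ^ 'm::finite \<Rightarrow> real) \<Rightarrow> (complex ^ 'm) set \<Rightarrow> bool"
  where "twice_differentiable_on u \<Omega> \<longleftrightarrow> u differentiable_on \<Omega> \<and>
    (\<forall>j. wirtinger_dbar j (\<lambda>w. complex_of_real (u w)) differentiable_on \<Omega>)"

text \<open>The value at the tangent vectors \<open>u\<close>, \<open>v\<close> of the form
  \<open>\<Sum>\<^sub>i\<^sub>,\<^sub>j c i j dw\<^sub>i \<and> d(cnj w\<^sub>j)\<close> at a point.\<close>

definition form11 ::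
  "('m::finite \<Rightarrow> 'm \<Rightarrow> complex) \<Rightarrow> complex ^ 'm \<Rightarrow> complex ^ 'm \<Rightarrow> complex"
  where "form11 c u v =
    (\<Sum>i\<in>UNIV. \<Sum>j\<in>UNIV. c i j * (u $ i * cnj (v $ j) - v $ i * cnj (u $ j)))"

text \<open>Real-valued plurisubharmonic functions on an open set: upper semicontinuity and the
  sub-mean value inequality on every closed disc of a complex line contained in the set. Since the
  value at the centre is not \<open>-\<infinity>\<close>, the circle means of a real-valued plurisubharmonic function
  are finite.\<close>

definition plurisubharmonic_on ::
  "(complex ^ 'm::finite \<Rightarrow> real) \<Rightarrow> (complex ^ 'm) set \<Rightarrow> bool"
  where "plurisubharmonic_on \<psi> \<Omega> \<longleftrightarrow>
    (\<forall>w\<in>\<Omega>. \<forall>e>0. \<forall>\<^sub>F z in at w within \<Omega>. \<psi> z < \<psi> w + e) \<and>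
    (\<forall>w v. (\<forall>c. cmod c \<le> 1 \<longrightarrow> w + c *s v \<in> \<Omega>) \<longrightarrow>
       (\<lambda>t. \<psi> (w + cis t *s v)) integrable_on {0..2 * pi} \<and>
       \<psi> w \<le> integral {0..2 * pi} (\<lambda>t. \<psi> (w + cis t *s v)) / (2 * pi))"


section \<open>Curvature\<close>

definition nonvanishing_section ::
  "('m::finite \<Rightarrow> 'a::complex_inner \<Rightarrow> 'a) \<Rightarrow> (complex ^ 'm) set \<Rightarrow> (complex ^ 'm \<Rightarrow> 'a) \<Rightarrow> bool"
  where "nonvanishing_section T U \<gamma> \<longleftrightarrow> holomorphic_vec_on \<gamma> U \<and>
    (\<forall>w\<in>U. \<gamma> w \<in> joint_kernel T w \<and> \<gamma> w \<noteq> 0)"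

text \<open>Two sections near \<open>w\<close> differ by a non-vanishing holomorphic factor, so the choice of
  \<open>\<gamma>\<close> does not matter.\<close>

definition curvature ::
  "(complex ^ 'm::finite) set \<Rightarrow> ('m \<Rightarrow> 'a::complex_hilbert \<Rightarrow> 'a) \<Rightarrow>
     complex ^ 'm \<Rightarrow> complex ^ 'm \<Rightarrow> complex ^ 'm \<Rightarrow> complex"
  where "curvature \<Omega> T w =
    (let \<gamma> = (SOME \<gamma>. \<exists>U. open U \<and> w \<in> U \<and> U \<subseteq> \<Omega> \<and> nonvanishing_section T U \<gamma>)
     in form11 (\<lambda>i j. - mixed_d i j (\<lambda>w'. ln ((norm (\<gamma> w'))\<^sup>2)) w))"


section \<open>Hilbert spaces of holomorphic functions\<close>

text \<open>A Hilbert space of functions on \<open>\<Omega>\<close> is a Hilbert space \<open>'a\<close> together with a map \<open>ev\<close>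
  sending each element to the function it stands for; \<open>ev\<close> is linear, and an element is determined
  by the values of its function on \<open>\<Omega>\<close> (values outside \<open>\<Omega>\<close> are irrelevant).\<close>

definition holomorphic_rkhs ::
  "(complex ^ 'm::finite) set \<Rightarrow> ('a::complex_hilbert \<Rightarrow> complex ^ 'm \<Rightarrow> complex) \<Rightarrow>
     (complex ^ 'm \<Rightarrow> complex ^ 'm \<Rightarrow> complex) \<Rightarrow> bool"
  where "holomorphic_rkhs \<Omega> ev K \<longleftrightarrow>
    (\<forall>f g. \<forall>z\<in>\<Omega>. ev (f + g) z = ev f z + ev g z) \<and>
    (\<forall>c f. \<forall>z\<in>\<Omega>. ev (scaleC c f) z = c * ev f z) \<and>
    (\<forall>f g. (\<forall>z\<in>\<Omega>. ev f z = ev g z) \<longrightarrow> f = g) \<and>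
    (\<forall>f. holomorphic_vec_on (ev f) \<Omega>) \<and>
    (\<forall>w\<in>\<Omega>. \<exists>k. (\<forall>z\<in>\<Omega>. ev k z = K z w) \<and> (\<forall>f. ev f w = cinner f k))"

text \<open>\<open>T\<close> is the tuple of adjoints of the (bounded) multiplication operators by the coordinate
  functions. When the kernel is \<open>\<Sum>\<^sub>\<alpha> \<rho>(\<alpha>) z\<^sup>\<alpha> (cnj w)\<^sup>\<alpha>\<close>, these are the backward weighted shifts
  with respect to the orthonormal basis \<open>sqrt (\<rho>(\<alpha>)) z\<^sup>\<alpha>\<close>.\<close>

definition adjoint_multiplication_tuple ::
  "(complex ^ 'm::finite) set \<Rightarrow> ('a::complex_hilbert \<Rightarrow> complex ^ 'm \<Rightarrow> complex) \<Rightarrow>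
     ('m \<Rightarrow> 'a \<Rightarrow> 'a) \<Rightarrow> bool"
  where "adjoint_multiplication_tuple \<Omega> ev T \<longleftrightarrow>
    (\<exists>M :: 'm \<Rightarrow> 'a \<Rightarrow> 'a. \<forall>i. bounded_clinear (M i) \<and>
       (\<forall>f. \<forall>z\<in>\<Omega>. ev (M i f) z = z $ i * ev f z) \<and> T i = cadjoint (M i))"

end

theory Submission
  imports Defs "HOL-Complex_Analysis.Complex_Analysis"
begin

text \<open>
  Write \<open>A(x) = \<Sum>\<^sub>i a(i) x\<^sup>i\<close> and \<open>B(x) = (1 - x)\<^sup>-\<^sup>n = \<Sum>\<^sub>i b(i) x\<^sup>i\<close>, so that the two kernels are \<open>A(\<langle>z, w\<rangle>)\<close>
  and \<open>B(\<langle>z, w\<rangle>)\<close>. The vectors \<open>\<gamma>(w) = K(\<cdot>, cnj w)\<close> form a holomorphic section of the eigenbundle of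
  the adjoint shifts with \<open>\<parallel>\<gamma>(w)\<parallel>\<^sup>2 = A(\<parallel>w\<parallel>\<^sup>2)\<close> (\<open>eigensection_holomorphic\<close>), and every other section
  is a holomorphic multiple of it. Since \<open>log \<bar>\<phi>\<bar>\<^sup>2\<close> is pluriharmonic for holomorphic \<open>\<phi>\<close>, the
  difference of the curvatures is the form \<open>\<partial>\<^sup>2 log C(\<parallel>w\<parallel>\<^sup>2) / \<partial>w\<^sub>i \<partial>cnj w\<^sub>j\<close> with
  \<open>C = A / B = (1 - x)\<^sup>n A\<close> (\<open>curvature_difference\<close>).

  Tested on combinations of the eigenvectors \<open>\<gamma>(w)\<close>, the hypercontraction condition says that the kernel
  \<open>C(\<langle>z, w\<rangle>)\<close> is positive definite, hence that \<open>C\<close> has nonnegative coefficients \<open>c(i)\<close>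
  (\<open>hypercontraction_coefficients\<close>). Therefore \<open>log C(\<parallel>w\<parallel>\<^sup>2)\<close> is plurisubharmonic
  (\<open>ln_real_series_plurisubharmonic\<close>), and it is bounded below by \<open>log c(0)\<close>. Everything now depends on
  whether \<open>C\<close> is bounded on \<open>[0, 1)\<close>.

  If \<open>X\<close> is a similarity, then \<open>X \<gamma>\<^sub>T = \<phi> \<gamma>\<^sub>S\<close> with \<open>\<phi>\<close> holomorphic, so \<open>\<bar>\<phi>\<bar>\<^sup>2 C\<close> is bounded by
  \<open>\<parallel>X\<parallel>\<^sup>2\<close>; as \<open>C(\<parallel>w\<parallel>\<^sup>2)\<close> is radial, the maximum principle for \<open>\<phi>\<close> bounds \<open>C\<close>
  (\<open>similar_imp_quotient_bounded\<close>), and \<open>log C(\<parallel>w\<parallel>\<^sup>2)\<close> is the required function \<open>\<psi>\<close>.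

  Given \<open>\<psi>\<close>, the difference \<open>\<psi> - log C(\<parallel>w\<parallel>\<^sup>2)\<close> is harmonic on a coordinate disc, hence the real part of a
  holomorphic function there, and the maximum principle again bounds \<open>C\<close>
  (\<open>potential_imp_quotient_bounded\<close>). Then \<open>\<Sum>\<^sub>i c(i)\<close> converges, and \<open>A = C B\<close> gives
  \<open>c(0) b(i) \<le> a(i) \<le> (\<Sum>\<^sub>j c(j)) b(i)\<close> because \<open>b\<close> is nondecreasing (\<open>coefficient_comparison\<close>). Since
  the kernels \<open>\<langle>z, w\<rangle>\<^sup>i\<close> are positive definite, the assignment \<open>\<gamma>\<^sub>T(w) \<mapsto> \<gamma>\<^sub>S(w)\<close> extends to a
  bounded invertible operator, which intertwines the two tuples
  (\<open>similar_of_comparable_coefficients\<close>).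
\<close>

section \<open>Complex Hilbert spaces: Riesz representation and adjoints\<close>

lemma cinner_add_right: "cinner x (y + z) = cinner x y + cinner x z"
  by (metis cinner_add_left cinner_commute complex_cnj_add)

lemma cinner_scaleC_right: "cinner x (scaleC c y) = cnj c * cinner x y"
  by (metis cinner_commute cinner_scaleC_left complex_cnj_mult)

lemma cinner_0_left [simp]: "cinner 0 (x::'a::complex_inner) = 0"
  using cinner_add_left[of 0 0 x] by simp

lemma cinner_0_right [simp]: "cinner (x::'a::complex_inner) 0 = 0"
  using cinner_add_right[of x 0 0] by simp

lemma cinner_minus_right: "cinner x (- y) = - cinner (x::'a::complex_inner) y"
  using cinner_add_right[of x y "- y"] by (simp add: eq_neg_iff_add_eq_0 add.commute)

lemma cinner_diff_right: "cinner x (y - z) = cinner x y - cinner (x::'a::complex_inner) z"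
  using cinner_add_right[of x y "- z"] by (simp add: cinner_minus_right)

lemma cinner_sum_left: "cinner (\<Sum>i\<in>I. f i) y = (\<Sum>i\<in>I. cinner (f i) (y::'a::complex_inner))"
  by (induction I rule: infinite_finite_induct) (auto simp: cinner_add_left)

lemma cinner_sum_right: "cinner y (\<Sum>i\<in>I. f i) = (\<Sum>i\<in>I. cinner (y::'a::complex_inner) (f i))"
  by (induction I rule: infinite_finite_induct) (auto simp: cinner_add_right)

lemma cinner_scaleR_left: "cinner (r *\<^sub>R x) y = of_real r * cinner (x::'a::complex_inner) y"
  by (simp add: cinner_scaleC_left flip: scaleC_of_real)

lemma norm_sq_cinner: "(norm (x::'a::complex_inner))\<^sup>2 = Re (cinner x x)"
  by (simp add: cinner_self)

lemma norm_scaleC: "norm (scaleC c x) = cmod c * norm (x::'a::complex_inner)"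
proof -
  have "(norm (scaleC c x))\<^sup>2 = Re (c * cnj c * cinner x x)"
    by (simp add: norm_sq_cinner cinner_scaleC_left cinner_scaleC_right mult_ac)
  also have "\<dots> = (cmod c * norm x)\<^sup>2"
    by (simp add: cinner_self power_mult_distrib flip: complex_norm_square of_real_power of_real_mult)
  finally show ?thesis by (simp add: power2_eq_iff_nonneg)
qed

lemma norm_add_sq:
  "(norm (x + y))\<^sup>2 = (norm x)\<^sup>2 + 2 * Re (cinner x y) + (norm (y::'a::complex_inner))\<^sup>2"
proof -
  have "Re (cinner y x) = Re (cinner x y)"
    by (subst cinner_commute) simp
  then show ?thesis by (simp add: norm_sq_cinner cinner_add_left cinner_add_right)
qed

lemma norm_diff_sq:
  "(norm (x - y))\<^sup>2 = (norm x)\<^sup>2 - 2 * Re (cinner x y) + (norm (y::'a::complex_inner))\<^sup>2"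
  using norm_add_sq[of x "- y"] by (simp add: cinner_minus_right)

lemma complex_cauchy_schwarz: "cmod (cinner x y) \<le> norm x * norm (y::'a::complex_inner)"
proof (cases "y = 0")
  case False
  define t where "t = cinner x y / of_real ((norm y)\<^sup>2)"
  have ny: "(norm y)\<^sup>2 > 0" using False by simp
  have nz: "complex_of_real (norm y) \<noteq> 0" using False by simp
  have "0 \<le> (norm (x - scaleC t y))\<^sup>2" by simp
  also have "\<dots> = (norm x)\<^sup>2 - 2 * Re (cnj t * cinner x y) + (cmod t)\<^sup>2 * (norm y)\<^sup>2"
    by (simp add: norm_diff_sq cinner_scaleC_right norm_scaleC power_mult_distrib)
  also have "cnj t * cinner x y = of_real ((cmod (cinner x y))\<^sup>2 / (norm y)\<^sup>2)"
    by (simp add: t_def complex_norm_square mult.commute del: of_real_power)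
  also have "(cmod t)\<^sup>2 * (norm y)\<^sup>2 = (cmod (cinner x y))\<^sup>2 / (norm y)\<^sup>2"
    using False by (simp add: t_def norm_divide norm_mult power2_eq_square)
  finally have "(cmod (cinner x y))\<^sup>2 / (norm y)\<^sup>2 \<le> (norm x)\<^sup>2" by simp
  then have "(cmod (cinner x y))\<^sup>2 \<le> (norm x * norm y)\<^sup>2"
    using ny by (simp add: divide_le_eq power_mult_distrib)
  then show ?thesis by (simp add: power2_le_iff_abs_le)
qed simp

lemma cinner_eq_imp_eq:
  assumes "\<And>x. cinner x y = cinner x (z::'a::complex_inner)"
  shows "y = z"
  using assms[of "y - z"] cinner_self[of "y - z"] by (simp add: cinner_diff_right)

lemma cinner_eq_imp_eq_left:
  assumes "\<And>x. cinner y x = cinner (z::'a::complex_inner) x"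
  shows "y = z"
  by (metis assms cinner_commute cinner_eq_imp_eq)

lemma bounded_linear_cinner_left: "bounded_linear (\<lambda>x. cinner x (y::'a::complex_inner))"
  by (rule bounded_linear_intro[of _ "norm y"])
    (auto simp: cinner_add_left cinner_scaleR_left scaleR_conv_of_real complex_cauchy_schwarz)

lemma bounded_clinear_bounded: "bounded_clinear A \<Longrightarrow> bounded_linear A"
  by (simp add: bounded_clinear_def)

lemma bounded_clinear_scaleC: "bounded_clinear A \<Longrightarrow> A (scaleC c x) = scaleC c (A x)"
  by (simp add: bounded_clinear_def)

lemma bounded_clinear_add: "bounded_clinear A \<Longrightarrow> A (x + y) = A x + A y"
  by (simp add: bounded_clinear_def linear_simps)

lemma bounded_clinear_sum: "bounded_clinear A \<Longrightarrow> A (\<Sum>i\<in>I. f i) = (\<Sum>i\<in>I. A (f i))"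
  using bounded_clinear_bounded bounded_linear.linear linear_sum by blast

lemma parallelogram:
  "(norm (x + y))\<^sup>2 + (norm (x - y))\<^sup>2 = 2 * (norm x)\<^sup>2 + 2 * (norm (y::'a::complex_inner))\<^sup>2"
  using norm_add_sq[of x y] norm_diff_sq[of x y] by simp

text \<open>A minimising sequence of the quadratic functional \<open>\<parallel>x\<parallel>\<^sup>2 - 2 Re (f x)\<close> is Cauchy by the
  parallelogram law, and stationarity of its limit says that the limit represents \<open>f\<close>.\<close>

lemma riesz_representation:
  fixes f :: "'a::complex_hilbert \<Rightarrow> complex"
  assumes add: "\<And>x y. f (x + y) = f x + f y"
    and scale: "\<And>c x. f (scaleC c x) = c * f x"
    and bound: "\<And>x. cmod (f x) \<le> C * norm x"
  shows "\<exists>y. \<forall>x. f x = cinner x y"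
proof -
  define Q where "Q x = (norm x)\<^sup>2 - 2 * Re (f x)" for x
  have scaleR: "f (r *\<^sub>R x) = of_real r * f x" for r x
    by (simp add: scale flip: scaleC_of_real)
  have blf: "bounded_linear f"
    by (rule bounded_linear_intro[of _ C])
      (auto simp: add scaleR scaleR_conv_of_real bound mult.commute)
  have lower: "Q x \<ge> - C\<^sup>2" for x
  proof -
    have "Re (f x) \<le> C * norm x"
      using complex_Re_le_cmod bound order.trans by blast
    moreover have "(norm x - C)\<^sup>2 \<ge> 0" by simp
    ultimately show ?thesis by (simp add: Q_def power2_diff mult.commute[of C] mult.assoc)
  qed
  define L where "L = (INF x. Q x)"
  have bdd: "bdd_below (range Q)" using lower by (auto intro!: bdd_belowI)
  have Lle: "L \<le> Q x" for x unfolding L_def by (rule cINF_lower[OF bdd]) simp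
  have "\<exists>x. Q x < L + 1 / real (Suc k)" for k
  proof -
    have "\<exists>x\<in>UNIV. Q x < L + 1 / real (Suc k)"
      using cINF_less_iff[of UNIV Q "L + 1 / real (Suc k)"] bdd unfolding L_def[symmetric] by simp
    then show ?thesis by auto
  qed
  then obtain X where X: "\<And>k. Q (X k) < L + 1 / real (Suc k)" by metis
  have mid: "(norm (x - y))\<^sup>2 \<le> 2 * (Q x - L) + 2 * (Q y - L)" for x y
  proof -
    have "Q ((1/2) *\<^sub>R (x + y)) = (norm (x + y))\<^sup>2 / 4 - Re (f x) - Re (f y)"
      unfolding Q_def by (simp only: scaleR add) (simp add: power_divide add_divide_distrib)
    then have "4 * Q ((1/2) *\<^sub>R (x + y)) = (norm (x + y))\<^sup>2 - 4 * Re (f x) - 4 * Re (f y)" by simp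
    moreover have "4 * L \<le> 4 * Q ((1/2) *\<^sub>R (x + y))" using Lle by simp
    ultimately have "4 * L \<le> (norm (x + y))\<^sup>2 - 4 * Re (f x) - 4 * Re (f y)" by simp
    moreover have "2 * (Q x - L) + 2 * (Q y - L)
        = 2 * (norm x)\<^sup>2 + 2 * (norm y)\<^sup>2 - 4 * Re (f x) - 4 * Re (f y) - 4 * L"
      by (simp add: Q_def)
    ultimately show ?thesis using parallelogram[of x y] by simp
  qed
  have cauchy: "Cauchy X"
  proof (rule metric_CauchyI)
    fix e :: real assume e: "e > 0"
    obtain N where N: "1 / real (Suc N) < e\<^sup>2 / 4"
      using nat_approx_posE[of "e\<^sup>2 / 4"] e by auto
    have "dist (X p) (X q) < e" if "N \<le> p" "N \<le> q" for p q
    proof -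
      have "1 / real (Suc p) \<le> 1 / real (Suc N)" "1 / real (Suc q) \<le> 1 / real (Suc N)"
        using that by (auto intro!: divide_left_mono)
      then have "Q (X p) - L < e\<^sup>2 / 4" "Q (X q) - L < e\<^sup>2 / 4"
        using X[of p] X[of q] N by simp_all
      then have "(norm (X p - X q))\<^sup>2 < e\<^sup>2" using mid[of "X p" "X q"] by simp
      then show ?thesis using e by (simp add: dist_norm power2_less_imp_less)
    qed
    then show "\<exists>M. \<forall>m\<ge>M. \<forall>n\<ge>M. dist (X m) (X n) < e" by blast
  qed
  then obtain y where y: "X \<longlonglongrightarrow> y" using Cauchy_convergent convergent_def by blast
  have "(\<lambda>k. Q (X k)) \<longlonglongrightarrow> Q y"
    unfolding Q_def by (intro tendsto_intros bounded_linear.tendsto[OF blf] y)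
  moreover have "(\<lambda>k. Q (X k)) \<longlonglongrightarrow> L"
  proof (rule tendsto_sandwich[of "\<lambda>_. L" _ _ "\<lambda>k. L + 1 / real (Suc k)"])
    show "(\<lambda>k. L + 1 / real (Suc k)) \<longlonglongrightarrow> L"
      using tendsto_add[OF tendsto_const[of L] LIMSEQ_Suc[OF lim_1_over_n]] by simp
  qed (use Lle X in \<open>auto intro!: always_eventually less_imp_le\<close>)
  ultimately have Qy: "Q y = L" using LIMSEQ_unique by blast
  have re: "Re (f x) = Re (cinner x y)" for x
  proof -
    define d where "d = Re (cinner y x) - Re (f x)"
    have quad: "0 \<le> t\<^sup>2 * (norm x)\<^sup>2 + 2 * t * d" for t :: real
    proof -
      have "Q (y + t *\<^sub>R x) = Q y + t\<^sup>2 * (norm x)\<^sup>2 + 2 * t * d"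
        using cinner_scaleC_right[of y "of_real t" x]
        by (simp add: Q_def norm_add_sq add scaleR d_def scaleC_of_real algebra_simps)
      then show ?thesis using Lle[of "y + t *\<^sub>R x"] Qy by simp
    qed
    have "d = 0"
    proof (rule ccontr)
      assume d: "d \<noteq> 0"
      define s where "s = 1 + (norm x)\<^sup>2"
      have s: "s > 0" by (simp add: s_def add_pos_nonneg)
      have "0 \<le> (- d / s)\<^sup>2 * (norm x)\<^sup>2 + 2 * (- d / s) * d" by (rule quad)
      also have "\<dots> = (d / s)\<^sup>2 * ((norm x)\<^sup>2 - 2 * s)"
        using s by (simp add: field_simps power2_eq_square)
      also have "\<dots> < 0"
      proof (rule mult_pos_neg)
        show "0 < (d / s)\<^sup>2" using d s by simp
        have "(norm x)\<^sup>2 - 2 * s = - (norm x)\<^sup>2 - 2" by (simp add: s_def)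
        then show "(norm x)\<^sup>2 - 2 * s < 0" using zero_le_power2[of "norm x"] by linarith
      qed
      finally show False by simp
    qed
    then show ?thesis using cinner_commute[of x y] by (simp add: d_def)
  qed
  have "f x = cinner x y" for x
  proof (rule complex_eqI)
    show "Re (f x) = Re (cinner x y)" by (rule re)
    show "Im (f x) = Im (cinner x y)"
      using re[of "scaleC \<i> x"] by (simp add: scale cinner_scaleC_left)
  qed
  then show ?thesis by blast
qed

lemma cadjoint_works:
  fixes A :: "'a::complex_hilbert \<Rightarrow> 'b::complex_hilbert"
  assumes A: "bounded_clinear A"
  shows "cinner (A x) y = cinner x (cadjoint A y)"
proof -
  obtain K where K: "\<And>u. norm (A u) \<le> norm u * K"
    using bounded_linear.bounded[OF bounded_clinear_bounded[OF A]] by blast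
  have "\<exists>z. \<forall>x. cinner (A x) y = cinner x z" for y
  proof (rule riesz_representation)
    show "cinner (A (u + v)) y = cinner (A u) y + cinner (A v) y" for u v
      by (simp add: bounded_clinear_add[OF A] cinner_add_left)
    show "cinner (A (scaleC c u)) y = c * cinner (A u) y" for c u
      by (simp add: bounded_clinear_scaleC[OF A] cinner_scaleC_left)
    show "cmod (cinner (A u) y) \<le> (K * norm y) * norm u" for u
      using order.trans[OF complex_cauchy_schwarz mult_right_mono[OF K norm_ge_zero]]
      by (simp add: mult_ac)
  qed
  then obtain B where B: "\<forall>x y. cinner (A x) y = cinner x (B y)" by metis
  have "(\<forall>x y. cinner (A x) y = cinner x (cadjoint A y))"
    unfolding cadjoint_def
  proof (rule theI[where a = B])
    fix B' assume "\<forall>x y. cinner (A x) y = cinner x (B' y)"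
    then have "B' y = B y" for y by - (rule cinner_eq_imp_eq, metis B)
    then show "B' = B" by (rule ext)
  qed (rule B)
  then show ?thesis by blast
qed

section \<open>Holomorphic functions of several variables\<close>

lemma norm_vector_smult: "norm (c *s (v::complex^'m)) = cmod c * norm v"
  by (simp add: norm_vec_def norm_mult L2_set_right_distrib)

lemma bounded_linear_smult_left: "bounded_linear (\<lambda>c. c *s (v::complex^'m))"
  by (rule bounded_linear_intro[of _ "norm v"])
    (auto simp: norm_vector_smult vec_eq_iff algebra_simps)

lemma smult_of_real: "complex_of_real r *s (v::complex^'m) = r *\<^sub>R v"
  unfolding vec_eq_iff vector_smult_component vector_scaleR_component
    scaleR_conv_of_real[where 'a = complex] by simp

lemma holomorphic_vec_derivative:
  assumes "holomorphic_vec_on f U" "z \<in> U"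
  shows "(f has_derivative frechet_derivative f (at z)) (at z)"
    and "frechet_derivative f (at z) (c *s v) = scaleC c (frechet_derivative f (at z) v)"
proof -
  obtain D where D: "(f has_derivative D) (at z)" "\<forall>c v. D (c *s v) = scaleC c (D v)"
    using assms unfolding holomorphic_vec_on_def by blast
  then have "frechet_derivative f (at z) = D" by (simp add: frechet_derivative_at[symmetric])
  with D show "(f has_derivative frechet_derivative f (at z)) (at z)"
    "frechet_derivative f (at z) (c *s v) = scaleC c (frechet_derivative f (at z) v)" by auto
qed

lemma holomorphic_vec_on_subset: "holomorphic_vec_on f U \<Longrightarrow> V \<subseteq> U \<Longrightarrow> holomorphic_vec_on f V"
  by (auto simp: holomorphic_vec_on_def)

lemma holomorphic_vec_on_clinear:
  assumes \<gamma>: "holomorphic_vec_on \<gamma> U" and A: "bounded_clinear A"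
  shows "holomorphic_vec_on (\<lambda>z. A (\<gamma> z)) U"
  unfolding holomorphic_vec_on_def
proof
  fix z assume z: "z \<in> U"
  show "\<exists>D. ((\<lambda>z. A (\<gamma> z)) has_derivative D) (at z) \<and> (\<forall>c v. D (c *s v) = scaleC c (D v))"
    using bounded_linear.has_derivative[OF bounded_clinear_bounded[OF A]
        holomorphic_vec_derivative(1)[OF \<gamma> z]]
    by (intro exI[of _ "\<lambda>h. A (frechet_derivative \<gamma> (at z) h)"])
      (simp add: holomorphic_vec_derivative(2)[OF \<gamma> z] bounded_clinear_scaleC[OF A])
qed

lemma holomorphic_vec_slice:
  fixes f :: "complex^'m \<Rightarrow> complex"
  assumes "holomorphic_vec_on f U" "z + t *s v \<in> U"
  shows "((\<lambda>t. f (z + t *s v)) has_field_derivative frechet_derivative f (at (z + t *s v)) v) (at t)"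
proof -
  let ?D = "frechet_derivative f (at (z + t *s v))"
  have "((\<lambda>t. z + t *s v) has_derivative (\<lambda>t. t *s v)) (at t)"
    by (auto intro!: derivative_eq_intros bounded_linear_imp_has_derivative
        bounded_linear_smult_left)
  from has_derivative_compose[OF this holomorphic_vec_derivative(1)[OF assms]]
  show ?thesis
    by (simp add: has_field_derivative_def holomorphic_vec_derivative(2)[OF assms]
        scaleC_complex_def mult_commute_abs)
qed

lemma holomorphic_vec_slice_on:
  fixes f :: "complex^'m \<Rightarrow> complex"
  assumes "holomorphic_vec_on f U" "\<And>t. t \<in> A \<Longrightarrow> z + t *s v \<in> U"
  shows "(\<lambda>t. f (z + t *s v)) holomorphic_on A"
  unfolding holomorphic_on_def field_differentiable_def
  using holomorphic_vec_slice[OF assms(1) assms(2)] has_field_derivative_at_within by blast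

text \<open>On the complex line through \<open>z\<close> in the direction of \<open>h\<close> these are the one-variable Cauchy
  inequalities for the first and second derivative, the latter inserted into Taylor's formula. What
  matters below is that the bounds depend on \<open>f\<close> only through \<open>M\<close>.\<close>

lemma holomorphic_vec_cauchy_estimate:
  fixes f :: "complex^'m \<Rightarrow> complex"
  assumes f: "holomorphic_vec_on f (ball z r)" and r: "r > 0"
    and M: "\<And>x. x \<in> ball z r \<Longrightarrow> cmod (f x) \<le> M"
  shows "cmod (frechet_derivative f (at z) h) \<le> 2 * M / r * norm h"
    and "norm h < r / 2 \<Longrightarrow>
      cmod (f (z + h) - f z - frechet_derivative f (at z) h) \<le> 8 * M / r\<^sup>2 * (norm h)\<^sup>2"
proof -
  let ?D = "frechet_derivative f (at z)"
  have lin: "linear ?D"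
    using has_derivative_linear[OF holomorphic_vec_derivative(1)[OF f]] r by simp
  define v where "v = sgn h"
  define g where "g t = f (z + t *s v)" for t
  have hv: "h = norm h *\<^sub>R v" by (cases "h = 0") (simp_all add: v_def sgn_div_norm)
  have nv: "norm v \<le> 1" by (simp add: v_def norm_sgn)
  have mem: "z + t *s v \<in> ball z r" if "t \<in> ball 0 r" for t
  proof -
    have "norm (t *s v) \<le> cmod t * 1" unfolding norm_vector_smult
      by (rule mult_left_mono[OF nv]) simp
    with that show ?thesis by (simp add: dist_norm)
  qed
  have hol: "g holomorphic_on ball 0 r"
    unfolding g_def by (rule holomorphic_vec_slice_on[OF f mem])
  have gM: "cmod (g t) \<le> M" if "t \<in> ball 0 r" for t
    unfolding g_def by (rule M[OF mem[OF that]])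
  have est: "norm ((deriv ^^ k) g t) \<le> fact k * M / (r / 2) ^ k" if t: "t \<in> ball 0 (r / 2)" for t k
  proof (rule Cauchy_inequality)
    have sub: "cball t (r / 2) \<subseteq> ball 0 r"
    proof
      fix s assume "s \<in> cball t (r / 2)"
      then show "s \<in> ball 0 r" using t norm_triangle_ineq2[of s t]
        by (simp add: dist_norm norm_minus_commute)
    qed
    show "g holomorphic_on ball t (r / 2)"
      using holomorphic_on_subset[OF hol] sub ball_subset_cball by blast
    show "continuous_on (cball t (r / 2)) g"
      using holomorphic_on_imp_continuous_on[OF hol] continuous_on_subset sub by blast
    show "cmod (g x) \<le> M" if "cmod (t - x) = r / 2" for x
      using that sub by (intro gM) (auto simp: dist_norm)
  qed (use r in auto)
  have g0: "deriv g 0 = ?D v"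
    unfolding g_def
    by (rule DERIV_imp_deriv) (use holomorphic_vec_slice[OF f, of z 0 v] r in auto)
  have Dh: "?D h = of_real (norm h) * ?D v"
    by (subst hv, subst smult_of_real[symmetric])
      (use holomorphic_vec_derivative(2)[OF f] r in \<open>simp add: scaleC_complex_def\<close>)
  show "cmod (?D h) \<le> 2 * M / r * norm h"
    using mult_left_mono[OF est[of 0 1], of "norm h"] r
    by (simp add: Dh g0[symmetric] norm_mult mult_ac)
  assume h: "norm h < r / 2"
  have "cmod ((deriv ^^ 0) g (of_real (norm h)) -
      (\<Sum>i\<le>1. (deriv ^^ i) g 0 * (of_real (norm h) - 0) ^ i / fact i))
    \<le> (8 * M / r\<^sup>2) * cmod (of_real (norm h) - 0) ^ Suc 1 / fact 1"
  proof (rule complex_Taylor[of "ball 0 (r / 2)"])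
    show "((deriv ^^ i) g has_field_derivative (deriv ^^ Suc i) g x) (at x within ball 0 (r / 2))"
      if x: "x \<in> ball 0 (r / 2)" for i x
    proof -
      have "(deriv ^^ i) g holomorphic_on ball 0 r"
        by (rule holomorphic_higher_deriv[OF hol]) simp
      then have "((deriv ^^ i) g has_field_derivative deriv ((deriv ^^ i) g) x) (at x)"
        using x r by (intro holomorphic_derivI[of _ "ball 0 r"]) auto
      then show ?thesis by (simp add: has_field_derivative_at_within)
    qed
    show "cmod ((deriv ^^ Suc 1) g x) \<le> 8 * M / r\<^sup>2" if "x \<in> ball 0 (r / 2)" for x
      using est[OF that, of 2] by (simp add: numeral_2_eq_2 power2_eq_square mult_ac)
  qed (use h r in auto)
  moreover have "f (z + h) = g (of_real (norm h))"
    by (simp add: g_def smult_of_real flip: hv)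
  moreover have "f z = g 0" by (simp add: g_def)
  ultimately show "cmod (f (z + h) - f z - ?D h) \<le> 8 * M / r\<^sup>2 * (norm h)\<^sup>2"
    by (simp add: Dh g0 power2_eq_square algebra_simps)
qed

lemma has_derivative_of_quadratic_bound:
  fixes F :: "'a::real_normed_vector \<Rightarrow> 'b::real_normed_vector"
  assumes L: "bounded_linear L" and d: "d > 0"
    and est: "\<And>h. norm h < d \<Longrightarrow> norm (F (w + h) - F w - L h) \<le> C * (norm h)\<^sup>2"
  shows "(F has_derivative L) (at w)"
  unfolding has_derivative_at
proof (intro conjI L, rule Lim_null_comparison[where g = "\<lambda>h. C * norm h"])
  show "\<forall>\<^sub>F h in at 0. norm (norm (F (w + h) - F w - L h) / norm h) \<le> C * norm h"
    unfolding eventually_at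
  proof (intro exI[of _ d] conjI d ballI impI)
    fix h :: 'a assume "h \<noteq> 0 \<and> dist h 0 < d"
    then show "norm (norm (F (w + h) - F w - L h) / norm h) \<le> C * norm h"
      using est[of h] by (simp add: divide_le_eq power2_eq_square mult_ac)
  qed
  show "((\<lambda>h. C * norm h) \<longlongrightarrow> 0) (at 0)"
    by (auto intro!: tendsto_eq_intros)
qed

text \<open>Osgood regularity. The derivative in the direction \<open>v\<close> is differentiated by interchanging
  limits: \<open>t \<mapsto> f' (w + t v) h\<close> is holomorphic as a uniform limit of difference quotients, and its
  derivative at \<open>0\<close> is the candidate \<open>L h\<close>. The quadratic remainder estimate, applied at all points
  \<open>w + t v\<close> at once, passes to the derivative in \<open>t\<close> by Cauchy's inequality.\<close>

lemma holomorphic_vec_directional_derivative: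
  fixes f :: "complex^'m \<Rightarrow> complex"
  assumes f: "holomorphic_vec_on f U" and U: "open U"
  shows "holomorphic_vec_on (\<lambda>z. frechet_derivative f (at z) v) U"
  unfolding holomorphic_vec_on_def
proof
  fix w assume w: "w \<in> U"
  let ?f' = "\<lambda>z. frechet_derivative f (at z)"
  have "isCont f w"
    using holomorphic_vec_derivative(1)[OF f w] has_derivative_continuous by blast
  then obtain d where d: "d > 0" "\<And>x. dist x w < d \<Longrightarrow> dist (f x) (f w) < 1"
    unfolding continuous_at_eps_delta by (metis zero_less_one)
  obtain e where e: "e > 0" "ball w e \<subseteq> U" using U w open_contains_ball by blast
  define R where "R = min d e"
  define M where "M = cmod (f w) + 1"
  have R: "R > 0" using d e by (simp add: R_def)
  have fR: "holomorphic_vec_on f (ball w R)"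
    by (rule holomorphic_vec_on_subset[OF f]) (use e in \<open>auto simp: R_def\<close>)
  have MR: "cmod (f x) \<le> M" if "x \<in> ball w R" for x
  proof -
    have "dist (f x) (f w) < 1" using that d(2)[of x] by (simp add: R_def dist_commute)
    then show ?thesis using norm_triangle_ineq2[of "f x" "f w"] by (simp add: dist_norm M_def)
  qed
  define C where "C = 8 * M / (R / 2)\<^sup>2"
  have C0: "C \<ge> 0" by (simp add: C_def M_def)
  have quad: "cmod (f (x + h) - f x - ?f' x h) \<le> C * (norm h)\<^sup>2"
    if x: "x \<in> ball w (R / 2)" and h: "norm h < R / 4" for x h
  proof -
    have sub: "ball x (R / 2) \<subseteq> ball w R"
    proof
      fix y assume "y \<in> ball x (R / 2)"
      then show "y \<in> ball w R" using x dist_triangle[of w y x] by simp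
    qed
    show ?thesis unfolding C_def
      by (rule holomorphic_vec_cauchy_estimate(2))
        (use R h sub MR holomorphic_vec_on_subset[OF fR sub] in auto)
  qed
  \<comment> \<open>for \<open>\<bar>t\<bar> \<le> \<rho>\<close> the point \<open>w + t v\<close> moves by less than \<open>R / 4\<close>, which leaves room for \<open>h\<close>\<close>
  define \<rho> where "\<rho> = R / (4 * (1 + norm v))"
  have \<rho>: "\<rho> > 0" using R by (simp add: \<rho>_def add_pos_nonneg)
  have small: "norm (t *s v) < R / 4" if "t \<in> cball 0 \<rho>" for t
  proof -
    have "cmod t * norm v \<le> \<rho> * norm v" using that by (intro mult_right_mono) auto
    also have "\<dots> < \<rho> * (1 + norm v)" using \<rho> by simp
    also have "\<dots> = R / 4" by (simp add: \<rho>_def add_nonneg_eq_0_iff field_simps)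
    finally show ?thesis by (simp add: norm_vector_smult)
  qed
  have mem: "w + h + t *s v \<in> ball w (R / 2)" if "t \<in> cball 0 \<rho>" "norm h < R / 4" for t h
  proof -
    have "norm (h + t *s v) < R / 2"
      using small[OF that(1)] that(2) norm_triangle_ineq[of h "t *s v"] by linarith
    moreover have "dist w (w + h + t *s v) = norm (h + t *s v)"
      by (simp add: dist_norm add.assoc flip: norm_minus_cancel[of "h + t *s v"])
    ultimately show ?thesis by simp
  qed
  have inU: "w + h + t *s v \<in> U" if "t \<in> cball 0 \<rho>" "norm h < R / 4" for t h
    using mem[OF that] e by (auto simp: R_def)
  have inU0: "w + t *s v \<in> U" if "t \<in> cball 0 \<rho>" for t
    using inU[OF that, of 0] R by simp
  have mem0: "w + t *s v \<in> ball w (R / 2)" if "t \<in> cball 0 \<rho>" for t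
    using mem[OF that, of 0] R by simp
  have lin: "linear (?f' x)" if "x \<in> U" for x
    using holomorphic_vec_derivative(1)[OF f that] has_derivative_linear by blast
  have hol0: "(\<lambda>t. f (w + h + t *s v)) holomorphic_on cball 0 \<rho>" if "norm h < R / 4" for h
    by (rule holomorphic_vec_slice_on[OF f inU]) (use that in auto)
  have hol: "(\<lambda>t. ?f' (w + t *s v) h) holomorphic_on ball 0 \<rho>" for h
  proof -
    define q where
      "q k t = (f (w + (1 / real (Suc k)) *\<^sub>R h + t *s v) - f (w + t *s v)) * of_real (real (Suc k))"
      for k t
    have "(\<lambda>k. norm h / real (Suc k)) \<longlonglongrightarrow> 0"
      using tendsto_mult[OF tendsto_const[of "norm h"] LIMSEQ_Suc[OF lim_1_over_n]] by simp
    then have ev: "\<forall>\<^sub>F k in sequentially. norm h / real (Suc k) < R / 4"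
      by (rule order_tendstoD) (use R in simp)
    show ?thesis
    proof (rule holomorphic_uniform_limit[where f = q and F = sequentially and z = 0 and r = \<rho>
          and g = "\<lambda>t. ?f' (w + t *s v) h"])
      show "\<forall>\<^sub>F k in sequentially. continuous_on (cball 0 \<rho>) (q k) \<and> q k holomorphic_on ball 0 \<rho>"
        using ev
      proof eventually_elim
        case (elim k)
        have "q k holomorphic_on cball 0 \<rho>"
          unfolding q_def using hol0[of 0] R elim by (intro holomorphic_intros hol0) auto
        then show ?case
          using holomorphic_on_imp_continuous_on holomorphic_on_subset[OF _ ball_subset_cball] by blast
      qed
      show "uniform_limit (cball 0 \<rho>) q (\<lambda>t. ?f' (w + t *s v) h) sequentially"
      proof (rule uniform_limitI)
        fix \<epsilon> :: real assume \<epsilon>: "\<epsilon> > 0"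
        have "(\<lambda>k. (C * (norm h)\<^sup>2) * (1 / real (Suc k))) \<longlonglongrightarrow> (C * (norm h)\<^sup>2) * 0"
          by (intro tendsto_intros LIMSEQ_Suc[OF lim_1_over_n])
        then have "\<forall>\<^sub>F k in sequentially. (C * (norm h)\<^sup>2) * (1 / real (Suc k)) < \<epsilon>"
          by (rule order_tendstoD) (use \<epsilon> in simp)
        with ev show "\<forall>\<^sub>F k in sequentially. \<forall>t\<in>cball 0 \<rho>. dist (q k t) (?f' (w + t *s v) h) < \<epsilon>"
        proof eventually_elim
          case (elim k)
          show ?case
          proof
            fix t :: complex assume t: "t \<in> cball 0 \<rho>"
            let ?x = "w + t *s v" and ?h = "(1 / real (Suc k)) *\<^sub>R h"
            have "cmod (f (?x + ?h) - f ?x - ?f' ?x ?h) \<le> C * (norm ?h)\<^sup>2"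
              by (rule quad[OF mem0[OF t]]) (use elim in simp)
            then have "cmod (f (?x + ?h) - f ?x - ?f' ?x ?h) * real (Suc k)
                \<le> C * (norm ?h)\<^sup>2 * real (Suc k)"
              by (rule mult_right_mono) simp
            also have "\<dots> = (C * (norm h)\<^sup>2) * (1 / real (Suc k))"
              by (simp add: power2_eq_square)
            also have "\<dots> < \<epsilon>" by (rule elim)
            also have "cmod (f (?x + ?h) - f ?x - ?f' ?x ?h) * real (Suc k)
                = cmod ((f (?x + ?h) - f ?x - ?f' ?x ?h) * of_real (real (Suc k)))"
              by (simp add: norm_mult del: of_nat_Suc)
            also have "(f (?x + ?h) - f ?x - ?f' ?x ?h) * of_real (real (Suc k)) = q k t - ?f' ?x h"
              using linear_scale[OF lin[OF inU0[OF t]], of "1 / real (Suc k)" h]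
              by (simp add: q_def left_diff_distrib scaleR_conv_of_real[where 'a = complex] add_ac
                  del: of_nat_Suc)
            finally show "dist (q k t) (?f' ?x h) < \<epsilon>" by (simp add: dist_norm)
          qed
        qed
      qed
    qed auto
  qed
  define L where "L h = deriv (\<lambda>t. ?f' (w + t *s v) h) 0" for h
  have fd: "(\<lambda>t. ?f' (w + t *s v) h) field_differentiable at 0" for h
    using hol[of h] \<rho> by (intro holomorphic_on_imp_differentiable_at[of _ "ball 0 \<rho>"]) auto
  have near: "\<forall>\<^sub>F t in nhds 0. t \<in> ball 0 \<rho>"
    using \<rho> by (intro eventually_nhds_in_open) auto
  have Ladd: "L (h + k) = L h + L k" for h k
  proof -
    have "L (h + k) = deriv (\<lambda>t. ?f' (w + t *s v) h + ?f' (w + t *s v) k) 0"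
      unfolding L_def
      by (rule deriv_cong_ev[OF eventually_mono[OF near] refl]) (auto intro!: linear_add lin inU0)
    then show ?thesis unfolding L_def using fd by simp
  qed
  have Lscale: "L (c *s h) = c * L h" for c h
  proof -
    have "L (c *s h) = deriv (\<lambda>t. c * ?f' (w + t *s v) h) 0"
      unfolding L_def
      by (rule deriv_cong_ev[OF eventually_mono[OF near] refl])
        (simp add: holomorphic_vec_derivative(2)[OF f] inU0 scaleC_complex_def)
    then show ?thesis unfolding L_def using fd by simp
  qed
  have Lbl: "bounded_linear L"
  proof -
    have "linear L"
      using Ladd Lscale[of "of_real _"]
      by (intro linearI) (auto simp: smult_of_real scaleR_conv_of_real)
    then show ?thesis by (simp add: linear_conv_bounded_linear)
  qed
  have "((\<lambda>z. ?f' z v) has_derivative L) (at w)"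
  proof (rule has_derivative_of_quadratic_bound[OF Lbl, of "R / 4" _ _ "C / (\<rho> / 2)"])
    fix h :: "complex^'m" assume h: "norm h < R / 4"
    define g where "g t = f (w + h + t *s v) - f (w + t *s v) - ?f' (w + t *s v) h" for t
    have holg: "g holomorphic_on ball 0 \<rho>"
      unfolding g_def
      using hol0[OF h] hol0[of 0] hol[of h] R holomorphic_on_subset[OF _ ball_subset_cball]
      by (intro holomorphic_intros) auto
    have sub: "cball 0 (\<rho> / 2) \<subseteq> ball (0::complex) \<rho>" using \<rho> by auto
    have "cmod ((deriv ^^ 1) g 0) \<le> fact 1 * (C * (norm h)\<^sup>2) / (\<rho> / 2) ^ 1"
    proof (rule Cauchy_inequality)
      show "g holomorphic_on ball 0 (\<rho> / 2)"
        using holomorphic_on_subset[OF holg] sub ball_subset_cball by blast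
      show "continuous_on (cball 0 (\<rho> / 2)) g"
        using holomorphic_on_imp_continuous_on[OF holg] continuous_on_subset sub by blast
      fix t :: complex assume "cmod (0 - t) = \<rho> / 2"
      then have t: "t \<in> cball 0 \<rho>" using \<rho> by simp
      show "cmod (g t) \<le> C * (norm h)\<^sup>2"
        using quad[OF mem0[OF t] h] by (simp add: g_def add_ac)
    qed (use \<rho> in simp)
    moreover have "deriv g 0 = ?f' (w + h) v - ?f' w v - L h"
    proof -
      have d1: "((\<lambda>t. f (w + h + t *s v)) has_field_derivative ?f' (w + h) v) (at 0)"
        using holomorphic_vec_slice[OF f inU[OF _ h], of 0] \<rho> by simp
      have d2: "((\<lambda>t. f (w + t *s v)) has_field_derivative ?f' w v) (at 0)"
        using holomorphic_vec_slice[OF f inU0, of 0] \<rho> by simp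
      have d3: "((\<lambda>t. ?f' (w + t *s v) h) has_field_derivative L h) (at 0)"
        unfolding L_def using fd field_differentiable_derivI by blast
      show ?thesis unfolding g_def by (intro DERIV_imp_deriv DERIV_diff d1 d2 d3)
    qed
    ultimately show "norm (?f' (w + h) v - ?f' w v - L h) \<le> C / (\<rho> / 2) * (norm h)\<^sup>2"
      by (simp add: mult_ac)
  qed (use R in simp)
  then show "\<exists>D. ((\<lambda>z. ?f' z v) has_derivative D) (at w) \<and> (\<forall>c v. D (c *s v) = scaleC c (D v))"
    using Lscale by (auto simp: scaleC_complex_def)
qed

section \<open>Second-order Wirtinger derivatives\<close>

lemma axis_complex: "axis k (t::complex) = t *s axis k 1"
  by (simp add: vec_eq_iff axis_def)

lemma wirtinger_d_eq:
  assumes "(f has_derivative D) (at w)"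
  shows "wirtinger_d j f w = (D (axis j 1) - \<i> * D (axis j \<i>)) / 2"
  using frechet_derivative_at[OF assms] by (simp add: wirtinger_d_def)

lemma wirtinger_dbar_real:
  fixes u :: "complex^'m \<Rightarrow> real"
  assumes "(u has_derivative D) (at w)"
  shows "wirtinger_dbar j (\<lambda>w. of_real (u w)) w
    = (of_real (D (axis j 1)) + \<i> * of_real (D (axis j \<i>))) / 2"
proof -
  have "((\<lambda>w. complex_of_real (u w)) has_derivative (\<lambda>h. of_real (D h))) (at w)"
    using assms by (auto intro!: derivative_eq_intros)
  from frechet_derivative_at[OF this, symmetric] show ?thesis by (simp add: wirtinger_dbar_def)
qed

lemma frechet_derivative_cong:
  assumes "open U" "w \<in> U" "\<And>z. z \<in> U \<Longrightarrow> f z = g z"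
  shows "frechet_derivative f (at w) = frechet_derivative g (at w)"
proof -
  have "(f has_derivative D) (at w) \<longleftrightarrow> (g has_derivative D) (at w)" for D
    using assms has_derivative_transform_within_open[of f D w UNIV U g]
      has_derivative_transform_within_open[of g D w UNIV U f] by auto
  then show ?thesis by (simp add: frechet_derivative_def)
qed

lemma wirtinger_d_cong:
  assumes "open U" "w \<in> U" "\<And>z. z \<in> U \<Longrightarrow> f z = g z"
  shows "wirtinger_d i f w = wirtinger_d i g w"
  using frechet_derivative_cong[OF assms] by (simp add: wirtinger_d_def)

lemma wirtinger_dbar_cong:
  assumes "open U" "w \<in> U" "\<And>z. z \<in> U \<Longrightarrow> f z = g z"
  shows "wirtinger_dbar i f w = wirtinger_dbar i g w"
  using frechet_derivative_cong[OF assms] by (simp add: wirtinger_dbar_def)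

lemma mixed_d_cong:
  fixes u v :: "complex^'m \<Rightarrow> real"
  assumes U: "open U" and w: "w \<in> U" and eq: "\<And>z. z \<in> U \<Longrightarrow> u z = v z"
  shows "mixed_d i j u w = mixed_d i j v w"
  unfolding mixed_d_def
  by (intro wirtinger_d_cong[OF U w] wirtinger_dbar_cong[OF U]) (auto simp: eq)

lemma twice_differentiable_onD:
  assumes "twice_differentiable_on u U" "open U" "z \<in> U"
  shows "u differentiable (at z)"
    and "wirtinger_dbar j (\<lambda>w. complex_of_real (u w)) differentiable (at z)"
  using assms by (auto simp: twice_differentiable_on_def differentiable_on_eq_differentiable_at)

lemma twice_differentiable_on_subset:
  "twice_differentiable_on u U \<Longrightarrow> V \<subseteq> U \<Longrightarrow> twice_differentiable_on u V"
  unfolding twice_differentiable_on_def by (meson differentiable_on_subset)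

lemma twice_differentiable_onI:
  fixes u :: "complex^'m \<Rightarrow> real" and p :: "'m \<Rightarrow> complex^'m \<Rightarrow> complex"
  assumes U: "open U"
    and d: "\<And>z. z \<in> U \<Longrightarrow> u differentiable (at z)"
    and p: "\<And>j z. z \<in> U \<Longrightarrow> wirtinger_dbar j (\<lambda>w. complex_of_real (u w)) z = p j z"
    and dp: "\<And>j z. z \<in> U \<Longrightarrow> p j differentiable (at z)"
  shows "twice_differentiable_on u U"
proof -
  have "wirtinger_dbar j (\<lambda>w. complex_of_real (u w)) differentiable (at z)" if "z \<in> U" for j z
    using dp[OF that, of j] has_derivative_transform_within_open[OF _ U that, of "p j"] p
    unfolding differentiable_def by metis
  then show ?thesis
    using d U by (auto simp: twice_differentiable_on_def differentiable_on_eq_differentiable_at)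
qed

lemma twice_differentiable_linear_combination:
  fixes u v :: "complex^'m \<Rightarrow> real"
  assumes u: "twice_differentiable_on u U" and v: "twice_differentiable_on v U" and U: "open U"
  shows "twice_differentiable_on (\<lambda>z. a * u z + b * v z) U"
    and "w \<in> U \<Longrightarrow>
      mixed_d i j (\<lambda>z. a * u z + b * v z) w = of_real a * mixed_d i j u w + of_real b * mixed_d i j v w"
proof -
  let ?db = "\<lambda>u j. wirtinger_dbar j (\<lambda>w. complex_of_real (u w))"
  have eq: "?db (\<lambda>z. a * u z + b * v z) j z = of_real a * ?db u j z + of_real b * ?db v j z"
    if z: "z \<in> U" for z j
  proof -
    obtain D where D: "(u has_derivative D) (at z)"
      using twice_differentiable_onD(1)[OF u U z] by (auto simp: differentiable_def)
    obtain E where E: "(v has_derivative E) (at z)"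
      using twice_differentiable_onD(1)[OF v U z] by (auto simp: differentiable_def)
    have DE: "((\<lambda>z. a * u z + b * v z) has_derivative (\<lambda>h. a * D h + b * E h)) (at z)"
      by (intro derivative_intros D E)
    show ?thesis
      unfolding wirtinger_dbar_real[OF DE] wirtinger_dbar_real[OF D] wirtinger_dbar_real[OF E]
      by (simp add: field_simps)
  qed
  have diff: "(\<lambda>z. of_real a * ?db u j z + of_real b * ?db v j z) differentiable (at z)"
    if "z \<in> U" for z j
    using twice_differentiable_onD(2)[OF u U that] twice_differentiable_onD(2)[OF v U that]
    by (intro differentiable_add differentiable_mult differentiable_const)
  show "twice_differentiable_on (\<lambda>z. a * u z + b * v z) U"
    using twice_differentiable_onD(1)[OF u U] twice_differentiable_onD(1)[OF v U]
    by (intro twice_differentiable_onI[OF U _ eq diff] differentiable_add differentiable_mult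
        differentiable_const) auto
  assume w: "w \<in> U"
  obtain D where D: "(?db u j has_derivative D) (at w)"
    using twice_differentiable_onD(2)[OF u U w] by (auto simp: differentiable_def)
  obtain E where E: "(?db v j has_derivative E) (at w)"
    using twice_differentiable_onD(2)[OF v U w] by (auto simp: differentiable_def)
  have DE: "((\<lambda>z. of_real a * ?db u j z + of_real b * ?db v j z)
      has_derivative (\<lambda>h. of_real a * D h + of_real b * E h)) (at w)"
    by (intro derivative_intros D E)
  have eq': "mixed_d i j (\<lambda>z. a * u z + b * v z) w
      = wirtinger_d i (\<lambda>z. of_real a * ?db u j z + of_real b * ?db v j z) w"
    unfolding mixed_d_def by (rule wirtinger_d_cong[OF U w eq])
  show "mixed_d i j (\<lambda>z. a * u z + b * v z) w
      = of_real a * mixed_d i j u w + of_real b * mixed_d i j v w"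
    unfolding eq' unfolding mixed_d_def wirtinger_d_eq[OF DE] wirtinger_d_eq[OF D] wirtinger_d_eq[OF E]
    by (simp add: field_simps)
qed

text \<open>Here \<open>\<partial>u/\<partial>cnj w\<^sub>j = f' (\<parallel>w\<parallel>\<^sup>2) w\<^sub>j\<close>, which is differentiable as soon as \<open>f'\<close> is.\<close>

lemma twice_differentiable_radial:
  fixes U :: "(complex^'m) set" and f :: "real \<Rightarrow> real"
  assumes U: "open U" and I: "\<And>w. w \<in> U \<Longrightarrow> (norm w)\<^sup>2 \<in> I"
    and f: "\<And>x. x \<in> I \<Longrightarrow> (f has_real_derivative f' x) (at x)"
    and f': "\<And>x. x \<in> I \<Longrightarrow> f' differentiable (at x)"
  shows "twice_differentiable_on (\<lambda>w. f ((norm w)\<^sup>2)) U"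
proof -
  have sq: "((\<lambda>w::complex^'m. (norm w)\<^sup>2) has_derivative (\<lambda>h. 2 * (z \<bullet> h))) (at z)" for z
  proof -
    have "((\<lambda>w. w \<bullet> w) has_derivative (\<lambda>h. z \<bullet> h + h \<bullet> z)) (at z)"
      by (intro derivative_intros)
    then show ?thesis by (simp add: power2_norm_eq_inner inner_commute)
  qed
  have D: "((\<lambda>w. f ((norm w)\<^sup>2)) has_derivative (\<lambda>h. f' ((norm z)\<^sup>2) * (2 * (z \<bullet> h)))) (at z)"
    if "z \<in> U" for z
    using has_derivative_compose[OF sq f[OF I[OF that], unfolded has_field_derivative_def]] .
  show ?thesis
  proof (rule twice_differentiable_onI[OF U, where p = "\<lambda>j z. of_real (f' ((norm z)\<^sup>2)) * z $ j"])
    fix z :: "complex^'m" and j assume z: "z \<in> U"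
    show "(\<lambda>w. f ((norm w)\<^sup>2)) differentiable (at z)" using D[OF z] by (auto simp: differentiable_def)
    show "wirtinger_dbar j (\<lambda>w. complex_of_real (f ((norm w)\<^sup>2))) z
        = of_real (f' ((norm z)\<^sup>2)) * z $ j"
      unfolding wirtinger_dbar_real[OF D[OF z]]
      by (simp add: inner_axis inner_complex_def complex_eq_iff)
    obtain E where E: "(f' has_derivative E) (at ((norm z)\<^sup>2))"
      using f'[OF I[OF z]] by (auto simp: differentiable_def)
    have "(\<lambda>z. complex_of_real (f' ((norm z)\<^sup>2))) differentiable (at z)"
      using bounded_linear.has_derivative[OF bounded_linear_of_real has_derivative_compose[OF sq E]]
      by (auto simp: differentiable_def)
    moreover have "(\<lambda>z. z $ j) differentiable (at z)"
      by (simp add: bounded_linear_imp_differentiable bounded_linear_vec_nth)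
    ultimately show "(\<lambda>z. of_real (f' ((norm z)\<^sup>2)) * z $ j) differentiable (at z)"
      by (rule differentiable_mult)
  qed
qed

text \<open>For \<open>u = log \<bar>\<phi>\<bar>\<^sup>2\<close> the derivative \<open>\<partial>u/\<partial>cnj w\<^sub>j\<close> is the conjugate of \<open>(\<partial>\<^sub>j \<phi>) / \<phi>\<close>. By the regularity
  of directional derivatives this quotient is holomorphic, so \<open>\<partial>/\<partial>w\<^sub>i\<close> annihilates its conjugate.\<close>

lemma mixed_d_ln_cmod_holomorphic:
  fixes \<phi> :: "complex^'m \<Rightarrow> complex"
  assumes \<phi>: "holomorphic_vec_on \<phi> U" and U: "open U" and nz: "\<And>z. z \<in> U \<Longrightarrow> \<phi> z \<noteq> 0"
  shows "twice_differentiable_on (\<lambda>z. ln ((cmod (\<phi> z))\<^sup>2)) U"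
    and "w \<in> U \<Longrightarrow> mixed_d i j (\<lambda>z. ln ((cmod (\<phi> z))\<^sup>2)) w = 0"
proof -
  let ?\<phi>' = "\<lambda>z. frechet_derivative \<phi> (at z)"
  let ?p = "\<lambda>j z. cnj (?\<phi>' z (axis j 1) / \<phi> z)"
  have D: "((\<lambda>z. ln ((cmod (\<phi> z))\<^sup>2)) has_derivative (\<lambda>h. 2 * Re (?\<phi>' z h / \<phi> z))) (at z)"
    if z: "z \<in> U" for z
  proof -
    have d: "(\<phi> has_derivative ?\<phi>' z) (at z)" by (rule holomorphic_vec_derivative(1)[OF \<phi> z])
    have "((\<lambda>z. \<phi> z \<bullet> \<phi> z) has_derivative (\<lambda>h. \<phi> z \<bullet> ?\<phi>' z h + ?\<phi>' z h \<bullet> \<phi> z)) (at z)"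
      by (intro derivative_intros d)
    moreover have "0 < \<phi> z \<bullet> \<phi> z" using nz[OF z] by simp
    ultimately have "((\<lambda>z. ln (\<phi> z \<bullet> \<phi> z)) has_derivative
        (\<lambda>h. (\<phi> z \<bullet> ?\<phi>' z h + ?\<phi>' z h \<bullet> \<phi> z) * inverse (\<phi> z \<bullet> \<phi> z))) (at z)"
      by - (rule has_derivative_ln; assumption)
    moreover have "(\<phi> z \<bullet> h + h \<bullet> \<phi> z) * inverse (\<phi> z \<bullet> \<phi> z) = 2 * Re (h / \<phi> z)" for h
      by (simp add: inner_complex_def Re_divide power2_eq_square divide_inverse algebra_simps)
    ultimately show ?thesis by (simp add: power2_norm_eq_inner)
  qed
  have p: "wirtinger_dbar j (\<lambda>z. complex_of_real (ln ((cmod (\<phi> z))\<^sup>2))) z = ?p j z"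
    if z: "z \<in> U" for z j
  proof -
    have "?\<phi>' z (axis j \<i>) = \<i> * ?\<phi>' z (axis j 1)"
      using holomorphic_vec_derivative(2)[OF \<phi> z, of \<i> "axis j 1"]
      by (simp add: scaleC_complex_def flip: axis_complex)
    then have "?\<phi>' z (axis j \<i>) / \<phi> z = \<i> * (?\<phi>' z (axis j 1) / \<phi> z)" by simp
    moreover have "(of_real (2 * Re b) + \<i> * of_real (2 * Re (\<i> * b))) / 2 = cnj b" for b
      by (simp add: complex_eq_iff)
    ultimately show ?thesis
      unfolding wirtinger_dbar_real[OF D[OF z]] by metis
  qed
  have q: "\<exists>E. (?p j has_derivative E) (at z) \<and> (\<forall>c v. E (c *s v) = cnj c * E v)"
    if z: "z \<in> U" for z j
  proof -
    have "\<exists>F. ((\<lambda>z. ?\<phi>' z (axis j 1)) has_derivative F) (at z) \<and>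
        (\<forall>c v. F (c *s v) = scaleC c (F v))"
      by (rule bspec[OF holomorphic_vec_directional_derivative[OF \<phi> U, of "axis j 1",
              unfolded holomorphic_vec_on_def] z])
    then obtain F where F: "((\<lambda>z. ?\<phi>' z (axis j 1)) has_derivative F) (at z)"
      and Fc: "\<And>c v. F (c *s v) = c * F v"
      unfolding scaleC_complex_def by auto
    have d: "(\<phi> has_derivative ?\<phi>' z) (at z)" by (rule holomorphic_vec_derivative(1)[OF \<phi> z])
    have "((\<lambda>z. ?\<phi>' z (axis j 1) / \<phi> z) has_derivative
        (\<lambda>h. - ?\<phi>' z (axis j 1) * (inverse (\<phi> z) * ?\<phi>' z h * inverse (\<phi> z)) + F h / \<phi> z)) (at z)"
      using nz[OF z] by (intro has_derivative_divide[OF F d])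
    from bounded_linear.has_derivative[OF bounded_linear_cnj this]
    show ?thesis
    proof (intro exI conjI allI)
      fix c v
      show "cnj (- ?\<phi>' z (axis j 1) * (inverse (\<phi> z) * ?\<phi>' z (c *s v) * inverse (\<phi> z))
            + F (c *s v) / \<phi> z)
        = cnj c * cnj (- ?\<phi>' z (axis j 1) * (inverse (\<phi> z) * ?\<phi>' z v * inverse (\<phi> z))
            + F v / \<phi> z)"
        unfolding Fc holomorphic_vec_derivative(2)[OF \<phi> z] scaleC_complex_def
          complex_cnj_mult[symmetric]
        by (intro arg_cong[where f = cnj]) (simp add: right_diff_distrib mult_ac)
    qed
  qed
  show "twice_differentiable_on (\<lambda>z. ln ((cmod (\<phi> z))\<^sup>2)) U"
  proof (rule twice_differentiable_onI[OF U _ p])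
    fix z j assume z: "z \<in> U"
    show "(\<lambda>z. ln ((cmod (\<phi> z))\<^sup>2)) differentiable (at z)"
      using D[OF z] unfolding differentiable_def by blast
    show "?p j differentiable (at z)"
      using q[OF z, of j] unfolding differentiable_def by blast
  qed
  assume w: "w \<in> U"
  obtain E where E: "(?p j has_derivative E) (at w)" "\<And>c v. E (c *s v) = cnj c * E v"
    using q[OF w] by blast
  have "mixed_d i j (\<lambda>z. ln ((cmod (\<phi> z))\<^sup>2)) w = wirtinger_d i (?p j) w"
    unfolding mixed_d_def by (rule wirtinger_d_cong[OF U w p])
  also have "\<dots> = (E (axis i 1) - \<i> * E (axis i \<i>)) / 2" by (rule wirtinger_d_eq[OF E(1)])
  also have "E (axis i \<i>) = - \<i> * E (axis i 1)"
    using E(2)[of \<i> "axis i 1"] by (simp flip: axis_complex)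
  finally show "mixed_d i j (\<lambda>z. ln ((cmod (\<phi> z))\<^sup>2)) w = 0" by simp
qed

text \<open>On the slice in the \<open>k\<close>-th direction the conjugate of \<open>\<partial>h/\<partial>cnj w\<^sub>k\<close> is holomorphic and, \<open>h\<close> being
  real, carries the whole derivative of \<open>h\<close>. Hence twice the real part of a primitive differs from \<open>h\<close>
  by a constant.\<close>

lemma slice_harmonic_is_real_part:
  fixes h :: "complex^'m \<Rightarrow> real"
  assumes h: "twice_differentiable_on h (ball 0 1)"
    and m: "\<And>w. w \<in> ball 0 1 \<Longrightarrow> mixed_d k k h w = 0"
  obtains G where "G holomorphic_on ball 0 1"
    and "\<And>t. t \<in> ball 0 1 \<Longrightarrow> h (t *s axis k 1) = Re (G t)"
proof -
  let ?e = "axis k 1 :: complex^'m"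
  let ?Q = "wirtinger_dbar k (\<lambda>w. complex_of_real (h w))"
  have in_ball: "t *s ?e \<in> ball 0 1" if "t \<in> ball 0 1" for t
    using that by (simp add: norm_vector_smult norm_axis_1)
  have line: "((\<lambda>t. t *s ?e) has_derivative (\<lambda>t. t *s ?e)) (at t)" for t
    by (rule bounded_linear_imp_has_derivative[OF bounded_linear_smult_left])
  have split: "t *s ?e = Re t *\<^sub>R axis k 1 + Im t *\<^sub>R axis k \<i>" for t
    by (simp add: vec_eq_iff axis_def complex_eq_iff)
  define q where "q t = cnj (?Q (t *s ?e))" for t
  have dq: "\<exists>D. (q has_field_derivative D) (at t)" if t: "t \<in> ball 0 1" for t
  proof -
    obtain E where E: "(?Q has_derivative E) (at (t *s ?e))"
      using twice_differentiable_onD(2)[OF h open_ball in_ball[OF t]]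
      by (auto simp: differentiable_def)
    have "(E (axis k 1) - \<i> * E (axis k \<i>)) / 2 = 0"
      using m[OF in_ball[OF t]] wirtinger_d_eq[OF E] by (simp add: mixed_d_def)
    then have Ei: "E (axis k \<i>) = - \<i> * E (axis k 1)"
      by (simp add: complex_eq_iff)
    interpret E: linear E using has_derivative_linear[OF E] .
    have Et: "cnj (E (s *s ?e)) = cnj (E (axis k 1)) * s" for s
      unfolding split E.add E.scaleR Ei by (simp add: complex_eq_iff scaleR_conv_of_real)
    have "(q has_derivative (\<lambda>s. cnj (E (s *s ?e)))) (at t)"
      unfolding q_def
      by (rule bounded_linear.has_derivative[OF bounded_linear_cnj has_derivative_compose[OF line E]])
    then show ?thesis unfolding Et has_field_derivative_def by blast
  qed
  have "q holomorphic_on ball 0 1"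
    using dq by (simp add: holomorphic_on_open)
  then obtain F where F: "\<And>t. t \<in> ball 0 1 \<Longrightarrow> (F has_field_derivative q t) (at t within ball 0 1)"
    using holomorphic_convex_primitive'[of "ball 0 1" q] by auto
  have F': "(F has_field_derivative q t) (at t)" if "t \<in> ball 0 1" for t
    using F[OF that] that by (simp add: at_within_open[of _ "ball 0 1"])
  have "((\<lambda>t. h (t *s ?e) - 2 * Re (F t)) has_derivative (\<lambda>_. 0)) (at t within ball 0 1)"
    if t: "t \<in> ball 0 1" for t
  proof -
    obtain D where D: "(h has_derivative D) (at (t *s ?e))"
      using twice_differentiable_onD(1)[OF h open_ball in_ball[OF t]]
      by (auto simp: differentiable_def)
    interpret D: linear D using has_derivative_linear[OF D] .
    have qt: "q t = (of_real (D (axis k 1)) - \<i> * of_real (D (axis k \<i>))) / 2"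
      unfolding q_def wirtinger_dbar_real[OF D] by simp
    have "((\<lambda>t. h (t *s ?e) - 2 * Re (F t)) has_derivative
        (\<lambda>s. D (s *s ?e) - 2 * Re (q t * s))) (at t)"
      using has_derivative_compose[OF line D] F'[OF t, unfolded has_field_derivative_def]
      by (intro derivative_intros bounded_linear.has_derivative[OF bounded_linear_Re]) auto
    moreover have "D (s *s ?e) - 2 * Re (q t * s) = 0" for s
      unfolding split D.add D.scaleR qt by (simp add: field_simps)
    ultimately show ?thesis by (simp add: has_derivative_at_withinI)
  qed
  then have "\<exists>c. \<forall>t\<in>ball 0 1. h (t *s ?e) - 2 * Re (F t) = c"
    by (intro has_derivative_zero_constant[OF convex_ball]) auto
  then obtain c where c: "\<And>t. t \<in> ball 0 1 \<Longrightarrow> h (t *s ?e) - 2 * Re (F t) = c"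
    by auto
  have "F holomorphic_on ball 0 1"
    using F unfolding holomorphic_on_def field_differentiable_def by blast
  show ?thesis
  proof
    show "(\<lambda>t. 2 * F t + of_real c) holomorphic_on ball 0 1"
      by (intro holomorphic_intros \<open>F holomorphic_on ball 0 1\<close>)
    show "h (t *s ?e) = Re (2 * F t + of_real c)" if "t \<in> ball 0 1" for t
      using c[OF that] by simp
  qed
qed

lemma form11_diff: "form11 c u v - form11 d u v = form11 (\<lambda>i j. c i j - d i j) u v"
  by (simp add: form11_def left_diff_distrib sum_subtractf)

text \<open>The tangent vectors \<open>\<i> e\<^sub>k\<close> and \<open>e\<^sub>k\<close> isolate the \<open>k\<close>-th diagonal coefficient.\<close>

lemma form11_diagonal:
  assumes "\<And>u v. form11 c u v = form11 d u v"
  shows "c k k = d k k"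
proof -
  have "form11 c (axis k \<i>) (axis k 1) = c k k * (2 * \<i>)" for c
  proof -
    have "form11 c (axis k \<i>) (axis k 1)
        = (\<Sum>i\<in>UNIV. \<Sum>j\<in>UNIV. if i = k then (if j = k then c i j * (2 * \<i>) else 0) else 0)"
      unfolding form11_def by (intro sum.cong refl) (auto simp: axis_def)
    then show ?thesis by (simp add: sum.If_cases)
  qed
  then show ?thesis using assms[of "axis k \<i>" "axis k 1"] by simp
qed

section \<open>Power series with nonnegative coefficients\<close>

text \<open>On generating functions \<open>\<Sum>\<^sub>i c\<^sub>i x\<^sup>i\<close> the next two operations are multiplication and division by
  \<open>1 - x\<close>.\<close>

definition backward_difference :: "(nat \<Rightarrow> real) \<Rightarrow> nat \<Rightarrow> real"
  where "backward_difference c i = c i - (if i = 0 then 0 else c (i - 1))"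

definition partial_sum :: "(nat \<Rightarrow> real) \<Rightarrow> nat \<Rightarrow> real"
  where "partial_sum c i = (\<Sum>j\<le>i. c j)"

definition unit_sequence :: "nat \<Rightarrow> real"
  where "unit_sequence i = (if i = 0 then 1 else 0)"

lemma partial_sum_backward_difference: "partial_sum (backward_difference c) = c"
proof
  show "partial_sum (backward_difference c) i = c i" for i
    by (induction i) (auto simp: partial_sum_def backward_difference_def)
qed

lemma partial_sum_power_backward_difference:
  "(partial_sum ^^ n) ((backward_difference ^^ n) c) = c"
proof (induction n arbitrary: c)
  case (Suc n)
  have "(partial_sum ^^ Suc n) ((backward_difference ^^ Suc n) c)
      = partial_sum ((partial_sum ^^ n) ((backward_difference ^^ n) (backward_difference c)))"
    by (simp add: funpow_swap1)
  then show ?case by (simp only: Suc.IH partial_sum_backward_difference)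
qed simp

lemma partial_sum_power_mono:
  "(\<And>i. c i \<le> d i) \<Longrightarrow> (partial_sum ^^ n) c i \<le> (partial_sum ^^ n) d i"
  by (induction n arbitrary: i) (auto simp: partial_sum_def intro: sum_mono)

lemma partial_sum_power_scale:
  "(partial_sum ^^ n) (\<lambda>i. r * c i) = (\<lambda>i. r * (partial_sum ^^ n) c i)"
  by (induction n) (auto simp: partial_sum_def sum_distrib_left)

lemma partial_sum_power_unit_pos:
  assumes "n \<ge> 1"
  shows "(partial_sum ^^ n) unit_sequence i > 0"
proof -
  have "0 < (partial_sum ^^ Suc k) unit_sequence i" for k i
  proof (induction k arbitrary: i)
    case 0
    have "partial_sum unit_sequence i = 1"
      by (induction i) (auto simp: partial_sum_def unit_sequence_def)
    then show ?case by simp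
  next
    case (Suc k)
    have "0 < partial_sum ((partial_sum ^^ Suc k) unit_sequence) i"
      unfolding partial_sum_def[of "(partial_sum ^^ Suc k) unit_sequence"]
      by (rule sum_pos) (use Suc.IH in auto)
    then show ?case by simp
  qed
  then show ?thesis using assms by (cases n) auto
qed

text \<open>Write \<open>\<Sigma>\<close> for \<open>partial_sum\<close> and \<open>\<delta>\<close> for \<open>unit_sequence\<close>, so that \<open>a = \<Sigma>\<^sup>n c\<close>. Since \<open>\<Sigma>\<close> is monotone, the
  two bounds follow from \<open>c\<^sub>0 \<delta> \<le> c\<close>, to which \<open>\<Sigma>\<^sup>n\<close> is applied, and from \<open>\<Sigma> c \<le> L = L \<Sigma> \<delta>\<close>, to which
  the remaining \<open>\<Sigma>\<^sup>n\<^sup>-\<^sup>1\<close> is applied.\<close>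

lemma coefficient_comparison:
  assumes n: "n \<ge> 1" and c: "c = (backward_difference ^^ n) a"
    and nonneg: "\<And>i. c i \<ge> 0" and L: "\<And>i. partial_sum c i \<le> L"
  shows "c 0 * (partial_sum ^^ n) unit_sequence i \<le> a i"
    and "a i \<le> L * (partial_sum ^^ n) unit_sequence i"
proof -
  have a: "a = (partial_sum ^^ n) c" by (simp add: c partial_sum_power_backward_difference)
  have "c 0 * (partial_sum ^^ n) unit_sequence i = (partial_sum ^^ n) (\<lambda>i. c 0 * unit_sequence i) i"
    by (simp add: partial_sum_power_scale)
  also have "\<dots> \<le> (partial_sum ^^ n) c i"
    by (rule partial_sum_power_mono) (auto simp: unit_sequence_def nonneg)
  finally show "c 0 * (partial_sum ^^ n) unit_sequence i \<le> a i" by (simp add: a)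
  obtain k where k: "n = Suc k" using n by (cases n) auto
  have one: "partial_sum unit_sequence i = 1" for i
    by (induction i) (auto simp: partial_sum_def unit_sequence_def)
  have "a i = (partial_sum ^^ k) (partial_sum c) i" by (simp add: a k funpow_swap1)
  also have "\<dots> \<le> (partial_sum ^^ k) (\<lambda>i. L * partial_sum unit_sequence i) i"
    by (rule partial_sum_power_mono) (simp add: L one)
  also have "\<dots> = L * (partial_sum ^^ n) unit_sequence i"
    by (simp add: partial_sum_power_scale k funpow_swap1)
  finally show "a i \<le> L * (partial_sum ^^ n) unit_sequence i" .
qed

lemma backward_difference_sums:
  fixes x :: complex
  assumes "(\<lambda>i. of_real (c i) * x ^ i) sums s"
  shows "(\<lambda>i. of_real (backward_difference c i) * x ^ i) sums ((1 - x) * s)"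
proof -
  let ?d = "\<lambda>i. of_real (if i = 0 then 0 else c (i - 1)) * x ^ i"
  have "(\<lambda>i. x * (of_real (c i) * x ^ i)) sums (x * s)" by (rule sums_mult[OF assms])
  then have "(\<lambda>i. ?d (Suc i)) sums (x * s)" by (simp add: mult_ac)
  then have "?d sums (x * s + ?d 0)" by (subst sums_Suc_iff[symmetric])
  then have "?d sums (x * s)" by simp
  moreover have "of_real (backward_difference c i) * x ^ i = of_real (c i) * x ^ i - ?d i" for i
    by (simp add: backward_difference_def left_diff_distrib)
  ultimately show ?thesis
    using sums_diff[OF assms] by (simp only: left_diff_distrib mult_1_left)
qed

lemma backward_difference_power_sums:
  fixes x :: complex
  assumes "(\<lambda>i. of_real (c i) * x ^ i) sums s"
  shows "(\<lambda>i. of_real ((backward_difference ^^ n) c i) * x ^ i) sums ((1 - x) ^ n * s)"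
  by (induction n) (auto simp: assms mult.assoc dest: backward_difference_sums)

lemma abs_summable_of_disc_summable:
  fixes c :: "nat \<Rightarrow> real" and x :: "'a::{real_normed_div_algebra,banach}"
  assumes s: "\<And>r. 0 \<le> r \<Longrightarrow> r < 1 \<Longrightarrow> summable (\<lambda>i. c i * r ^ i)" and x: "norm x < 1"
  shows "summable (\<lambda>i. norm (of_real (c i) * x ^ i))"
proof -
  obtain r where r: "norm x < r" "r < 1" using x dense by blast
  have "0 \<le> r" using r norm_ge_zero[of x] by linarith
  have "summable (\<lambda>i. norm (c i * (norm x) ^ i))"
    by (rule powser_insidea[OF s[of r]]) (use r \<open>0 \<le> r\<close> in auto)
  then show ?thesis by (simp add: norm_mult norm_power abs_mult)
qed

text \<open>Each Cauchy product with the geometric series contributes one more factor \<open>1 / (1 - x)\<close>.\<close>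

lemma partial_sum_power_unit_sums:
  fixes x :: complex
  assumes "cmod x < 1"
  shows "summable (\<lambda>i. cmod (of_real ((partial_sum ^^ n) unit_sequence i) * x ^ i))"
    and "(\<lambda>i. of_real ((partial_sum ^^ n) unit_sequence i) * x ^ i) sums inverse ((1 - x) ^ n)"
proof -
  have "\<forall>x. cmod x < 1 \<longrightarrow> summable (\<lambda>i. cmod (of_real ((partial_sum ^^ n) unit_sequence i) * x ^ i)) \<and>
    (\<lambda>i. of_real ((partial_sum ^^ n) unit_sequence i) * x ^ i) sums inverse ((1 - x) ^ n)"
  proof (induction n)
    case 0
    have "(\<lambda>i. of_real (unit_sequence i) * x ^ i) = (\<lambda>i. if i = 0 then 1 else 0)" for x :: complex
      by (auto simp: unit_sequence_def)
    moreover have "(\<lambda>i. cmod (of_real (unit_sequence i) * x ^ i)) = (\<lambda>i. if i = 0 then 1 else 0)"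
      for x :: complex by (auto simp: unit_sequence_def)
    ultimately show ?case using sums_single[of 0 "\<lambda>_. 1::complex"] sums_single[of 0 "\<lambda>_. 1::real"]
      by (auto simp: sums_iff)
  next
    case (Suc n)
    let ?c = "(partial_sum ^^ n) unit_sequence"
    have conv: "(\<lambda>i. of_real (partial_sum ?c i) * x ^ i) sums inverse ((1 - x) ^ Suc n)"
      if x: "cmod x < 1" for x :: complex
    proof -
      have g: "summable (\<lambda>i. norm (x ^ i))" using x by (simp add: norm_power)
      have "(\<lambda>k. \<Sum>i\<le>k. of_real (?c i) * x ^ i * x ^ (k - i))
          sums ((\<Sum>i. of_real (?c i) * x ^ i) * (\<Sum>i. x ^ i))"
        by (rule Cauchy_product_sums) (use Suc x g in auto)
      moreover have "(\<Sum>i\<le>k. of_real (?c i) * x ^ i * x ^ (k - i)) = of_real (partial_sum ?c k) * x ^ k"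
        for k
        unfolding partial_sum_def of_real_sum sum_distrib_right
        by (intro sum.cong refl) (simp add: mult.assoc flip: power_add)
      moreover have "(\<Sum>i. of_real (?c i) * x ^ i) = inverse ((1 - x) ^ n)"
        using Suc x sums_unique by metis
      moreover have "(\<Sum>i. x ^ i) = inverse (1 - x)"
        using suminf_geometric[OF x] by (simp add: divide_inverse)
      ultimately show ?thesis by (simp add: mult.commute)
    qed
    have "summable (\<lambda>i. cmod (of_real (partial_sum ?c i) * x ^ i))" if x: "cmod x < 1" for x :: complex
    proof (rule abs_summable_of_disc_summable[OF _ x])
      fix r :: real assume r: "0 \<le> r" "r < 1"
      have "summable (\<lambda>i. complex_of_real (partial_sum ?c i) * of_real r ^ i)"
        using conv[of "of_real r"] r sums_summable by auto
      then have "summable (\<lambda>i. complex_of_real (partial_sum ?c i * r ^ i))" by simp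
      then show "summable (\<lambda>i. partial_sum ?c i * r ^ i)" by (simp only: summable_of_real_iff)
    qed
    with conv show ?case by simp
  qed
  with assms show "summable (\<lambda>i. cmod (of_real ((partial_sum ^^ n) unit_sequence i) * x ^ i))"
    and "(\<lambda>i. of_real ((partial_sum ^^ n) unit_sequence i) * x ^ i) sums inverse ((1 - x) ^ n)"
    by auto
qed

locale nonneg_power_series =
  fixes c :: "nat \<Rightarrow> real"
  assumes nonneg: "\<And>i. c i \<ge> 0" and pos0: "c 0 > 0"
    and disc_summable: "\<And>r. 0 \<le> r \<Longrightarrow> r < 1 \<Longrightarrow> summable (\<lambda>i. c i * r ^ i)"
begin

definition real_series :: "real \<Rightarrow> real"
  where "real_series x = (\<Sum>i. c i * x ^ i)"

definition complex_series :: "complex \<Rightarrow> complex"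
  where "complex_series x = (\<Sum>i. of_real (c i) * x ^ i)"

lemma summable_real: "\<bar>x\<bar> < 1 \<Longrightarrow> summable (\<lambda>i. c i * x ^ i)"
  using summable_norm_cancel[OF abs_summable_of_disc_summable[OF disc_summable, of x]] by simp

lemma summable_complex: "cmod x < 1 \<Longrightarrow> summable (\<lambda>i. of_real (c i) * x ^ i)"
  using summable_norm_cancel[OF abs_summable_of_disc_summable[OF disc_summable]] by blast

lemma real_series_mono: "0 \<le> x \<Longrightarrow> x \<le> y \<Longrightarrow> y < 1 \<Longrightarrow> real_series x \<le> real_series y"
  unfolding real_series_def
  by (intro suminf_le summable_real) (auto intro!: mult_left_mono power_mono nonneg)

lemma real_series_0: "real_series 0 = c 0"
  unfolding real_series_def by (rule powser_zero)

lemma real_series_pos: "0 \<le> x \<Longrightarrow> x < 1 \<Longrightarrow> real_series x > 0"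
  using real_series_mono[of 0 x] real_series_0 pos0 by simp

lemma complex_series_of_real: "\<bar>x\<bar> < 1 \<Longrightarrow> complex_series (of_real x) = of_real (real_series x)"
  unfolding real_series_def complex_series_def by (subst suminf_of_real[OF summable_real]) simp_all

lemma complex_series_holomorphic: "complex_series holomorphic_on ball 0 1"
  unfolding holomorphic_on_open[OF open_ball]
proof (intro ballI exI)
  fix x :: complex assume "x \<in> ball 0 1"
  then show "(complex_series has_field_derivative (\<Sum>i. diffs (\<lambda>i. of_real (c i)) i * x ^ i)) (at x)"
    unfolding complex_series_def by (intro termdiffs_strong'[OF summable_complex]) auto
qed

lemma ln_real_series_twice_differentiable:
  "twice_differentiable_on (\<lambda>w::complex^'m. ln (real_series ((norm w)\<^sup>2))) (ball 0 1)"
proof -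
  define real_series' where "real_series' x = (\<Sum>i. diffs c i * x ^ i)" for x
  have dP: "(real_series has_real_derivative real_series' x) (at x)" if "\<bar>x\<bar> < 1" for x
    unfolding real_series_def real_series'_def
    by (rule termdiffs_strong'[of 1]) (use summable_real that in auto)
  have dP': "real_series' differentiable (at x)" if "\<bar>x\<bar> < 1" for x
  proof -
    have "(real_series' has_real_derivative (\<Sum>i. diffs (diffs c) i * x ^ i)) (at x)"
      unfolding real_series'_def
      by (rule termdiffs_strong'[of 1]) (use that in \<open>auto intro!: termdiff_converges[of _ 1] summable_real\<close>)
    then show ?thesis using real_differentiable_def by blast
  qed
  show ?thesis
  proof (rule twice_differentiable_radial[where I = "{0..<1}" and f' = "\<lambda>x. real_series' x / real_series x"
        and f = "\<lambda>x. ln (real_series x)"])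
    show "(norm w)\<^sup>2 \<in> {0..<1}" if "w \<in> ball 0 1" for w :: "complex^'m"
      using that by (simp add: abs_square_less_1)
    show "((\<lambda>x. ln (real_series x)) has_real_derivative real_series' x / real_series x) (at x)"
      if "x \<in> {0..<1}" for x
      using dP[of x] real_series_pos[of x] that by (auto intro!: derivative_eq_intros)
    show "(\<lambda>x. real_series' x / real_series x) differentiable (at x)" if x: "x \<in> {0..<1}" for x
      using dP[of x] dP'[of x] real_series_pos[of x] x
      by (intro differentiable_divide) (auto simp: real_differentiable_def)
  qed simp
qed

text \<open>Cauchy--Schwarz for the coefficient sequences \<open>(r\<^sup>i)\<close> and \<open>(s\<^sup>i)\<close> with weights \<open>c\<^sub>i\<close>. It will be
  applied to \<open>x = \<langle>z, w\<rangle>\<close>, \<open>r = \<parallel>z\<parallel>\<close> and \<open>s = \<parallel>w\<parallel>\<close>.\<close>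

lemma cauchy_schwarz_kernel:
  assumes x: "cmod x \<le> r * s" and r: "0 \<le> r" "r < 1" and s: "0 \<le> s" "s < 1"
  shows "(cmod (complex_series x))\<^sup>2 \<le> real_series (r\<^sup>2) * real_series (s\<^sup>2)"
proof -
  have rs: "r * s < 1" using r s mult_less_le_imp_less[of r 1 s 1] by (cases "s = 0") auto
  have r2: "r\<^sup>2 < 1" "s\<^sup>2 < 1" using r s by (simp_all add: abs_square_less_1)
  have "cmod (complex_series x) \<le> (\<Sum>i. cmod (of_real (c i) * x ^ i))"
    unfolding complex_series_def
    by (rule summable_norm) (use abs_summable_of_disc_summable[OF disc_summable, of x] x rs in auto)
  also have "\<dots> \<le> real_series (r * s)"
    unfolding real_series_def
  proof (rule suminf_le)
    show "cmod (of_real (c i) * x ^ i) \<le> c i * (r * s) ^ i" for i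
      using nonneg x by (auto simp: norm_mult norm_power intro!: mult_left_mono power_mono)
    show "summable (\<lambda>i. cmod (of_real (c i) * x ^ i))"
      using abs_summable_of_disc_summable[OF disc_summable, of x] x rs by auto
    show "summable (\<lambda>i. c i * (r * s) ^ i)" using r s rs by (intro summable_real) auto
  qed
  finally have 1: "cmod (complex_series x) \<le> real_series (r * s)" .
  have "(real_series (r * s))\<^sup>2 \<le> real_series (r\<^sup>2) * real_series (s\<^sup>2)"
  proof (rule tendsto_le[OF trivial_limit_sequentially])
    have lim: "(\<lambda>N. \<Sum>i<N. c i * t ^ i) \<longlonglongrightarrow> real_series t" if "\<bar>t\<bar> < 1" for t
      unfolding real_series_def by (rule summable_LIMSEQ[OF summable_real[OF that]])
    show "(\<lambda>N. (\<Sum>i<N. c i * (r\<^sup>2) ^ i) * (\<Sum>i<N. c i * (s\<^sup>2) ^ i)) \<longlonglongrightarrow> real_series (r\<^sup>2) * real_series (s\<^sup>2)"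
      by (intro tendsto_mult lim) (use r2 in auto)
    show "(\<lambda>N. (\<Sum>i<N. c i * (r * s) ^ i)\<^sup>2) \<longlonglongrightarrow> (real_series (r * s))\<^sup>2"
      by (intro tendsto_power lim) (use r s rs in auto)
    have "(\<Sum>i<N. c i * (r * s) ^ i)\<^sup>2 \<le> (\<Sum>i<N. c i * (r\<^sup>2) ^ i) * (\<Sum>i<N. c i * (s\<^sup>2) ^ i)" for N
    proof -
      have "(\<Sum>i<N. (sqrt (c i) * r ^ i) * (sqrt (c i) * s ^ i))\<^sup>2
          \<le> (\<Sum>i<N. (sqrt (c i) * r ^ i)\<^sup>2) * (\<Sum>i<N. (sqrt (c i) * s ^ i)\<^sup>2)"
        by (rule Cauchy_Schwarz_ineq_sum)
      moreover have "sqrt (c i) * r ^ i * (sqrt (c i) * s ^ i) = c i * (r * s) ^ i" for i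
        using real_sqrt_mult_self[of "c i"] nonneg[of i] by (simp add: power_mult_distrib mult_ac)
      moreover have "(sqrt (c i) * t ^ i)\<^sup>2 = c i * (t\<^sup>2) ^ i" for t i
        using nonneg[of i] by (simp add: power_mult_distrib mult.commute flip: power_mult)
      ultimately show ?thesis by simp
    qed
    then show "\<forall>\<^sub>F N in sequentially. (\<Sum>i<N. c i * (r * s) ^ i)\<^sup>2
        \<le> (\<Sum>i<N. c i * (r\<^sup>2) ^ i) * (\<Sum>i<N. c i * (s\<^sup>2) ^ i)"
      by simp
  qed
  with 1 show ?thesis by (meson norm_ge_zero order.trans power_mono)
qed

lemma bounded_imp_partial_sums_bounded:
  assumes "\<And>r. 0 \<le> r \<Longrightarrow> r < 1 \<Longrightarrow> real_series r \<le> L"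
  shows "partial_sum c k \<le> L"
proof (rule tendsto_upperbound[where F = "at_left (1::real)"])
  show "((\<lambda>r. \<Sum>i\<le>k. c i * r ^ i) \<longlongrightarrow> partial_sum c k) (at_left 1)"
    unfolding partial_sum_def by (auto intro!: tendsto_eq_intros)
  have "(\<Sum>i\<le>k. c i * r ^ i) \<le> L" if "0 < r" "r < 1" for r
  proof -
    have "(\<Sum>i\<le>k. c i * r ^ i) \<le> real_series r"
      unfolding real_series_def by (rule sum_le_suminf[OF summable_real]) (use that nonneg in auto)
    then show ?thesis using assms[of r] that by simp
  qed
  then show "\<forall>\<^sub>F r in at_left 1. (\<Sum>i\<le>k. c i * r ^ i) \<le> L"
    by (intro eventually_at_leftI[of 0]) auto
qed simp

end

section \<open>Plurisubharmonicity of the logarithm of a radial kernel\<close>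

lemma hprod_add_left: "hprod (x + y) z = hprod x z + hprod y z"
  by (simp add: hprod_def distrib_right sum.distrib)

lemma hprod_smult_left: "hprod (c *s x) z = c * hprod x z"
  by (simp add: hprod_def sum_distrib_left mult.assoc)

lemma hprod_smult_right: "hprod x (c *s z) = cnj c * hprod x z"
  by (simp add: hprod_def sum_distrib_left mult_ac)

lemma norm_sq_vec: "(norm (x::complex^'m))\<^sup>2 = (\<Sum>i\<in>UNIV. (cmod (x $ i))\<^sup>2)"
  by (simp add: norm_vec_def L2_set_def sum_nonneg)

lemma hprod_self: "hprod x x = of_real ((norm x)\<^sup>2)"
  by (simp only: norm_sq_vec hprod_def of_real_sum complex_norm_square)

lemma hprod_cauchy_schwarz: "cmod (hprod x y) \<le> norm x * norm y"
proof -
  have "cmod (hprod x y) \<le> (\<Sum>i\<in>UNIV. \<bar>cmod (x $ i)\<bar> * \<bar>cmod (y $ i)\<bar>)"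
    unfolding hprod_def by (rule order.trans[OF norm_sum]) (simp add: norm_mult)
  also have "\<dots> \<le> norm x * norm y"
    unfolding norm_vec_def by (rule L2_set_mult_ineq)
  finally show ?thesis .
qed

lemma hprod_in_disc:
  assumes "x \<in> ball 0 1" "y \<in> ball 0 1"
  shows "cmod (hprod x y) < 1"
proof -
  have "norm x * norm y < 1"
    using assms mult_less_le_imp_less[of "norm x" 1 "norm y" 1] by (cases "y = 0") auto
  then show ?thesis using hprod_cauchy_schwarz[of x y] by linarith
qed

lemma maximum_modulus_sphere:
  assumes hol: "f holomorphic_on cball 0 \<rho>" and \<rho>: "\<rho> > 0"
  obtains \<zeta> :: complex where "cmod \<zeta> = \<rho>" "cmod (f 0) \<le> cmod (f \<zeta>)"
proof -
  have cont: "continuous_on (cball 0 \<rho>) f" by (rule holomorphic_on_imp_continuous_on[OF hol])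
  have "continuous_on (sphere 0 \<rho>) (\<lambda>t. cmod (f t))"
    by (intro continuous_on_norm continuous_on_subset[OF cont]) auto
  then obtain \<zeta> where \<zeta>: "\<zeta> \<in> sphere 0 \<rho>" "\<And>t. t \<in> sphere 0 \<rho> \<Longrightarrow> cmod (f t) \<le> cmod (f \<zeta>)"
    using continuous_attains_sup[of "sphere (0::complex) \<rho>" "\<lambda>t. cmod (f t)"] \<rho> by auto
  have "cmod (f 0) \<le> cmod (f \<zeta>)"
    by (rule maximum_modulus_frontier[of f "cball 0 \<rho>"])
      (use cont \<zeta> \<rho> holomorphic_on_subset[OF hol ball_subset_cball] in auto)
  with \<zeta> show ?thesis by (intro that) auto
qed

text \<open>By periodicity the average over the \<open>N\<close> sample points does not change when they are all shifted
  by \<open>2 \<pi> / N\<close>, so \<open>\<theta>\<close> may be moved into \<open>[0, 2 \<pi> / N]\<close>. Then the average is a Riemann sum for the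
  partition into \<open>N\<close> equal cells, and uniform continuity compares it with the integral.\<close>

lemma integral_ge_of_sample_means:
  fixes f :: "real \<Rightarrow> real"
  assumes cont: "continuous_on UNIV f" and per: "\<And>t. f (t + 2 * pi) = f t"
    and samples: "\<And>N. N > 0 \<Longrightarrow> \<exists>\<theta>\<ge>0. real N * M \<le> (\<Sum>s<N. f (\<theta> + 2 * pi * real s / real N))"
  shows "2 * pi * M \<le> integral {0..2 * pi} f"
proof (rule field_le_epsilon)
  fix e :: real assume e: "e > 0"
  define \<epsilon> where "\<epsilon> = e / (2 * pi)"
  have \<epsilon>: "\<epsilon> > 0" using e by (simp add: \<epsilon>_def)
  have "uniformly_continuous_on {0..4 * pi} f"
    by (rule compact_uniformly_continuous[OF continuous_on_subset[OF cont]]) auto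
  then obtain \<delta> where \<delta>: "\<delta> > 0"
    "\<And>x y. x \<in> {0..4 * pi} \<Longrightarrow> y \<in> {0..4 * pi} \<Longrightarrow> dist y x < \<delta> \<Longrightarrow> dist (f y) (f x) < \<epsilon>"
    unfolding uniformly_continuous_on_def using \<epsilon> by metis
  obtain n where n: "1 / real (Suc n) < \<delta> / (2 * pi)"
    using nat_approx_posE[of "\<delta> / (2 * pi)"] \<delta> by auto
  define N where "N = Suc n"
  define h where "h = 2 * pi / real N"
  have N: "N > 0" by (simp add: N_def)
  have h: "0 < h" "h < \<delta>" "h \<le> 2 * pi" "real N * h = 2 * pi"
    using n by (auto simp: h_def N_def field_simps)
  define S where "S t = (\<Sum>s<N. f (t + h * real s))" for t
  have S_shift: "S (t + h) = S t" for t
  proof -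
    let ?g = "\<lambda>s. f (t + h * real s)"
    have "?g N = ?g 0" using per[of t] h by (simp add: mult.commute)
    moreover have "S (t + h) = (\<Sum>s<N. ?g (Suc s))" by (simp add: S_def algebra_simps)
    moreover have "(\<Sum>s<N. ?g (Suc s)) = (\<Sum>s<N. ?g s) + ?g N - ?g 0"
      using sum.lessThan_Suc_shift[of ?g N] sum.lessThan_Suc[of ?g N] by linarith
    ultimately show ?thesis by (simp add: S_def)
  qed
  have S_shifts: "S (t + real k * h) = S t" for t k
  proof (induction k)
    case (Suc k)
    then show ?case using S_shift[of "t + real k * h"] by (simp add: algebra_simps)
  qed simp
  obtain \<theta> where \<theta>: "\<theta> \<ge> 0" "real N * M \<le> S \<theta>"
    using samples[OF N] by (auto simp: S_def h_def)
  define k where "k = nat \<lfloor>\<theta> / h\<rfloor>"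
  define \<tau> where "\<tau> = \<theta> - real k * h"
  have k: "real k \<le> \<theta> / h" "\<theta> / h < real k + 1" using \<theta> h by (auto simp: k_def)
  have \<tau>: "0 \<le> \<tau>" "\<tau> \<le> h"
    using k h by (auto simp: \<tau>_def field_simps)
  have S\<tau>: "real N * M \<le> S \<tau>" using S_shifts[of \<tau> k] \<theta> by (simp add: \<tau>_def)
  have int: "f integrable_on {p..q}" for p q
    by (rule integrable_continuous_interval[OF continuous_on_subset[OF cont]]) auto
  have cell: "h * (f (\<tau> + h * real s) - \<epsilon>) \<le> integral {h * real s..h * real (Suc s)} f"
    if s: "s < N" for s
  proof -
    have "h * real (Suc s) \<le> h * real N" using s h by (intro mult_left_mono) auto
    then have le: "h * real (Suc s) \<le> 2 * pi" using h(4) by (simp only: mult.commute)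
    have hs: "0 \<le> h * real s" using h by simp
    have eqS: "h * real (Suc s) = h * real s + h" by (simp add: algebra_simps)
    have "f (\<tau> + h * real s) - \<epsilon> \<le> f t" if t: "t \<in> {h * real s..h * real (Suc s)}" for t
    proof -
      have t': "h * real s \<le> t" "t \<le> h * real s + h" using t eqS by auto
      have bnd: "0 \<le> \<tau> + h * real s" "\<tau> + h * real s \<le> 4 * pi" "0 \<le> t" "t \<le> 4 * pi"
        using t' \<tau> le[unfolded eqS] hs h(1) pi_gt_zero by linarith+
      have "dist t (\<tau> + h * real s) < \<delta>"
        using t \<tau> h eqS by (auto simp: dist_real_def abs_less_iff)
      then have "dist (f t) (f (\<tau> + h * real s)) < \<epsilon>"
        using bnd by (intro \<delta>(2)) auto
      then show ?thesis by (simp add: dist_real_def)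
    qed
    then have "integral {h * real s..h * real (Suc s)} (\<lambda>_. f (\<tau> + h * real s) - \<epsilon>)
        \<le> integral {h * real s..h * real (Suc s)} f"
      by (intro integral_le int) auto
    then show ?thesis using h by (simp add: eqS del: of_nat_Suc)
  qed
  have "(\<Sum>s<n. h * (f (\<tau> + h * real s) - \<epsilon>)) \<le> integral {0..h * real n} f" if "n \<le> N" for n
    using that
  proof (induction n)
    case (Suc n)
    have "integral {0..h * real n} f + integral {h * real n..h * real (Suc n)} f
        = integral {0..h * real (Suc n)} f"
      by (rule Henstock_Kurzweil_Integration.integral_combine[OF _ _ int])
        (use h in \<open>auto intro!: mult_left_mono\<close>)
    then show ?case using Suc cell[of n] by simp
  qed simp
  from this[of N] have "(\<Sum>s<N. h * (f (\<tau> + h * real s) - \<epsilon>)) \<le> integral {0..2 * pi} f"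
    using h(4) by (simp only: mult.commute[of h "real N"] order_refl)
  moreover have "(\<Sum>s<N. h * (f (\<tau> + h * real s) - \<epsilon>)) = h * S \<tau> - real N * h * \<epsilon>"
    by (simp add: S_def sum_distrib_left right_diff_distrib sum_subtractf mult_ac)
  ultimately have "h * S \<tau> - 2 * pi * \<epsilon> \<le> integral {0..2 * pi} f"
    by (simp only: h(4))
  moreover have "2 * pi * M \<le> h * S \<tau>"
  proof -
    have "real N * h * M \<le> h * S \<tau>"
      using mult_left_mono[OF S\<tau>, of h] h(1) by (simp add: mult_ac)
    then show ?thesis by (simp only: h(4))
  qed
  moreover have "2 * pi * \<epsilon> = e" by (simp add: \<epsilon>_def)
  ultimately show "2 * pi * M \<le> integral {0..2 * pi} f + e" by linarith
qed

context nonneg_power_series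
begin

text \<open>Write \<open>k(z, w)\<close> for the kernel \<open>\<Sum>\<^sub>i c\<^sub>i \<langle>z, w\<rangle>\<^sup>i\<close>. By Cauchy--Schwarz \<open>k(z, z)\<close> dominates
  \<open>\<bar>k(z, w)\<bar>\<^sup>2 / k(w, w)\<close>, with equality at \<open>z = w\<close>, and the product of the functions \<open>k(\<cdot>, w)\<close> over
  \<open>N\<close> points rotated by roots of unity is holomorphic in the common position on the disc, so it obeys
  the maximum principle. Taking logarithms only after this step keeps the zeros of \<open>k(\<cdot>, w)\<close>
  harmless.\<close>

lemma ln_real_series_sample_mean:
  fixes w v :: "complex^'m"
  assumes disc: "\<And>t. cmod t \<le> 1 \<Longrightarrow> w + t *s v \<in> ball 0 1" and N: "N > 0"
  shows "\<exists>\<theta>\<ge>0. real N * ln (real_series ((norm w)\<^sup>2))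
    \<le> (\<Sum>s<N. ln (real_series ((norm (w + cis (\<theta> + 2 * pi * real s / real N) *s v))\<^sup>2)))"
proof -
  define \<omega> where "\<omega> s = cis (2 * pi * real s / real N)" for s
  define g where "g t = complex_series (hprod (w + t *s v) w)" for t
  define G where "G t = (\<Prod>s<N. g (\<omega> s * t))" for t
  have w: "w \<in> ball 0 1" using disc[of 0] by simp
  have g: "g holomorphic_on cball 0 1"
  proof -
    have "(complex_series \<circ> (\<lambda>t. hprod w w + t * hprod v w)) holomorphic_on cball 0 1"
    proof (rule holomorphic_on_compose_gen[OF _ complex_series_holomorphic])
      show "(\<lambda>t. hprod w w + t * hprod v w) holomorphic_on cball 0 1" by (intro holomorphic_intros)
      show "(\<lambda>t. hprod w w + t * hprod v w) ` cball 0 1 \<subseteq> ball 0 1"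
        using hprod_in_disc[OF disc w] by (auto simp: hprod_add_left hprod_smult_left)
    qed
    then show ?thesis by (simp add: g_def[abs_def] o_def hprod_add_left hprod_smult_left)
  qed
  have "(\<lambda>t. g (\<omega> s * t)) holomorphic_on cball 0 1" for s
  proof -
    have "(g \<circ> (\<lambda>t. \<omega> s * t)) holomorphic_on cball 0 1"
      by (rule holomorphic_on_compose_gen[OF _ g])
        (auto intro!: holomorphic_intros simp: norm_mult \<omega>_def)
    then show ?thesis by (simp add: o_def)
  qed
  then have "G holomorphic_on cball 0 1" unfolding G_def by (intro holomorphic_intros)
  then obtain \<zeta> where \<zeta>: "cmod \<zeta> = 1" and max: "cmod (G 0) \<le> cmod (G \<zeta>)"
    using maximum_modulus_sphere[of G 1] by auto
  define p where "p = real_series ((norm w)\<^sup>2)"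
  define q where "q s = real_series ((norm (w + (\<omega> s * \<zeta>) *s v))\<^sup>2)" for s
  have sq: "0 \<le> (norm z)\<^sup>2 \<and> (norm z)\<^sup>2 < 1" if "z \<in> ball 0 1" for z :: "complex^'m"
    using that by (simp add: abs_square_less_1)
  have p: "p > 0" unfolding p_def using sq[OF w] by (simp add: real_series_pos)
  have mem: "w + (\<omega> s * \<zeta>) *s v \<in> ball 0 1" for s
    by (rule disc) (use \<zeta> in \<open>simp add: norm_mult \<omega>_def\<close>)
  have q: "q s > 0" for s unfolding q_def using sq[OF mem] by (simp add: real_series_pos)
  have "G 0 = of_real p ^ N"
    using sq[OF w] by (simp add: G_def g_def hprod_self complex_series_of_real p_def del: of_real_power)
  then have "p ^ N = cmod (G 0)" using p by (simp add: norm_power)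
  then have "(p ^ N)\<^sup>2 \<le> (cmod (G \<zeta>))\<^sup>2" using max p by (intro power_mono) auto
  also have "\<dots> = (\<Prod>s<N. (cmod (g (\<omega> s * \<zeta>)))\<^sup>2)"
    by (simp add: G_def prod_power_distrib flip: prod_norm)
  also have "\<dots> \<le> (\<Prod>s<N. q s * p)"
  proof (rule prod_mono)
    fix s
    have "(cmod (g (\<omega> s * \<zeta>)))\<^sup>2 \<le> q s * p"
      unfolding g_def q_def p_def
      by (rule cauchy_schwarz_kernel[OF hprod_cauchy_schwarz]) (use mem[of s] w in auto)
    then show "0 \<le> (cmod (g (\<omega> s * \<zeta>)))\<^sup>2 \<and> (cmod (g (\<omega> s * \<zeta>)))\<^sup>2 \<le> q s * p" by simp
  qed
  finally have "ln ((p ^ N)\<^sup>2) \<le> ln (\<Prod>s<N. q s * p)"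
    using p q by (intro ln_mono) (auto intro!: prod_pos)
  also have "\<dots> = (\<Sum>s<N. ln (q s)) + real N * ln p"
    using p q less_imp_neq[OF q, symmetric]
    by (subst ln_prod) (auto simp: ln_mult sum.distrib)
  finally have main: "real N * ln p \<le> (\<Sum>s<N. ln (q s))"
    using p by (simp add: ln_realpow)
  define \<theta> where "\<theta> = Arg2pi \<zeta>"
  have "\<zeta> = cis \<theta>" using Arg2pi_eq[of \<zeta>] \<zeta> by (simp add: \<theta>_def cis_conv_exp)
  then have "\<omega> s * \<zeta> = cis (\<theta> + 2 * pi * real s / real N)" for s
    by (simp add: \<omega>_def cis_mult add.commute)
  with main have "real N * ln (real_series ((norm w)\<^sup>2))
    \<le> (\<Sum>s<N. ln (real_series ((norm (w + cis (\<theta> + 2 * pi * real s / real N) *s v))\<^sup>2)))"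
    by (simp add: p_def q_def)
  moreover have "\<theta> \<ge> 0" by (simp add: \<theta>_def Arg2pi)
  ultimately show ?thesis by blast
qed

lemma ln_real_series_plurisubharmonic:
  "plurisubharmonic_on (\<lambda>w::complex^'m. ln (real_series ((norm w)\<^sup>2))) (ball 0 1)"
  unfolding plurisubharmonic_on_def
proof (intro conjI ballI allI impI)
  let ?\<psi> = "\<lambda>w::complex^'m. ln (real_series ((norm w)\<^sup>2))"
  have cont: "continuous_on (ball 0 1) ?\<psi>"
    using ln_real_series_twice_differentiable unfolding twice_differentiable_on_def
    by (blast intro: differentiable_imp_continuous_on)
  show "\<forall>\<^sub>F z in at w within ball 0 1. ?\<psi> z < ?\<psi> w + e" if "w \<in> ball 0 1" "e > 0" for w e
    using cont that unfolding continuous_on_def by (intro order_tendstoD(2)[of ?\<psi> "?\<psi> w"]) auto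
  fix w v :: "complex^'m"
  assume "\<forall>c. cmod c \<le> 1 \<longrightarrow> w + c *s v \<in> ball 0 1"
  then have disc: "\<And>t. cmod t \<le> 1 \<Longrightarrow> w + t *s v \<in> ball 0 1" by blast
  let ?f = "\<lambda>t. ?\<psi> (w + cis t *s v)"
  have circle: "continuous_on UNIV (\<lambda>t. w + cis t *s v)"
    by (intro continuous_intros bounded_linear.continuous_on[OF bounded_linear_smult_left])
  have fc: "continuous_on UNIV ?f"
    by (rule continuous_on_compose2[OF cont circle]) (use disc in auto)
  show "?f integrable_on {0..2 * pi}"
    by (rule integrable_continuous_interval[OF continuous_on_subset[OF fc]]) auto
  have "2 * pi * ?\<psi> w \<le> integral {0..2 * pi} ?f"
  proof (rule integral_ge_of_sample_means[OF fc])
    show "?f (t + 2 * pi) = ?f t" for t by (simp flip: cis_mult)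
  qed (rule ln_real_series_sample_mean[OF disc])
  then show "?\<psi> w \<le> integral {0..2 * pi} ?f / (2 * pi)"
    by (simp add: pos_le_divide_eq mult.commute)
qed

end

section \<open>Reproducing kernel spaces with a radial kernel\<close>

definition cnj_vec :: "complex^'m \<Rightarrow> complex^'m"
  where "cnj_vec w = (\<chi> i. cnj (w $ i))"

lemma cnj_vec_nth [simp]: "cnj_vec w $ i = cnj (w $ i)"
  by (simp add: cnj_vec_def)

lemma norm_cnj_vec [simp]: "norm (cnj_vec w) = norm w"
  by (simp add: norm_vec_def)

lemma cnj_vec_add: "cnj_vec (x + y) = cnj_vec x + cnj_vec y"
  by (simp add: vec_eq_iff)

lemma cnj_vec_smult: "cnj_vec (c *s x) = cnj c *s cnj_vec x"
  by (simp add: vec_eq_iff)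

lemma hprod_cnj_vec: "hprod (cnj_vec v) (cnj_vec w) = hprod w v"
  by (simp add: hprod_def mult.commute)

lemma dim_one_multiple:
  assumes dim: "complex_vector.dim (V :: 'a::complex_inner set) = 1"
    and v: "v \<in> V" "v \<noteq> 0" and x: "x \<in> V"
  shows "\<exists>c. x = scaleC c v"
proof -
  obtain B where B: "V \<subseteq> complex_vector.span B" "card B = 1"
    using complex_vector.basis_exists[of V] dim by metis
  then obtain b where "B = {b}" by (auto simp: card_1_singleton_iff)
  then have "v \<in> range (\<lambda>k. scaleC k b)" "x \<in> range (\<lambda>k. scaleC k b)"
    using B v x by (auto simp: complex_vector.span_singleton)
  then obtain s t where s: "v = scaleC s b" and t: "x = scaleC t b" by blast
  have "s \<noteq> 0" using v s by auto
  then have "x = scaleC (t / s) v" by (simp add: s t scaleC_scaleC)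
  then show ?thesis ..
qed

locale radial_kernel_space =
  fixes a :: "nat \<Rightarrow> real"
    and K :: "complex ^ 'm::finite \<Rightarrow> complex ^ 'm \<Rightarrow> complex"
    and ev :: "'h::complex_hilbert \<Rightarrow> complex ^ 'm \<Rightarrow> complex"
    and T :: "'m \<Rightarrow> 'h \<Rightarrow> 'h"
  assumes a_pos: "\<And>i. a i > 0"
    and K_sums: "\<And>z w. z \<in> ball 0 1 \<Longrightarrow> w \<in> ball 0 1 \<Longrightarrow>
      (\<lambda>i. complex_of_real (a i) * hprod z w ^ i) sums K z w"
    and rkhs: "holomorphic_rkhs (ball 0 1) ev K"
    and adjoint_tuple: "adjoint_multiplication_tuple (ball 0 1) ev T"
    and cowen_douglas: "cowen_douglas_1 (ball 0 1) T"
begin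

sublocale nonneg_power_series a
proof
  show "a i \<ge> 0" "a 0 > 0" for i using a_pos less_imp_le by auto
  fix r :: real assume r: "0 \<le> r" "r < 1"
  define w :: "complex^'m" where "w = of_real (sqrt r) *s axis undefined 1"
  have nw: "(norm w)\<^sup>2 = r" using r by (simp add: w_def norm_vector_smult norm_axis_1)
  have "norm w < 1" using r by (simp add: w_def norm_vector_smult norm_axis_1)
  then have "(\<lambda>i. complex_of_real (a i) * hprod w w ^ i) sums K w w" by (intro K_sums) auto
  moreover have "hprod w w = of_real r" by (simp only: hprod_self nw)
  ultimately have "summable (\<lambda>i. complex_of_real (a i * r ^ i))" by (simp add: sums_summable)
  then show "summable (\<lambda>i. a i * r ^ i)" by (simp only: summable_of_real_iff)
qed

definition kernel_element :: "complex^'m \<Rightarrow> 'h"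
  where "kernel_element w = (SOME k. (\<forall>z\<in>ball 0 1. ev k z = K z w) \<and> (\<forall>f. ev f w = cinner f k))"

lemma kernel_element:
  assumes "w \<in> ball 0 1"
  shows "z \<in> ball 0 1 \<Longrightarrow> ev (kernel_element w) z = K z w"
    and "ev f w = cinner f (kernel_element w)"
proof -
  have "\<exists>k. (\<forall>z\<in>ball 0 1. ev k z = K z w) \<and> (\<forall>f. ev f w = cinner f k)"
    using rkhs assms by (simp add: holomorphic_rkhs_def)
  from someI_ex[OF this] show "z \<in> ball 0 1 \<Longrightarrow> ev (kernel_element w) z = K z w"
    "ev f w = cinner f (kernel_element w)" unfolding kernel_element_def by blast+
qed

text \<open>The section \<open>w \<mapsto> K(\<cdot>, cnj w)\<close> of the eigenbundle.\<close>

definition eigensection :: "complex^'m \<Rightarrow> 'h"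
  where "eigensection w = kernel_element (cnj_vec w)"

lemma cnj_vec_in_ball: "w \<in> ball 0 1 \<Longrightarrow> cnj_vec w \<in> ball 0 1"
  by simp

lemma ev_eq_cinner: "w \<in> ball 0 1 \<Longrightarrow> ev f (cnj_vec w) = cinner f (eigensection w)"
  unfolding eigensection_def by (rule kernel_element(2)[OF cnj_vec_in_ball])

lemma cinner_eigensection_sums:
  assumes "w \<in> ball 0 1" "v \<in> ball 0 1"
  shows "(\<lambda>i. complex_of_real (a i) * hprod w v ^ i) sums cinner (eigensection w) (eigensection v)"
proof -
  have "cinner (eigensection w) (eigensection v) = K (cnj_vec v) (cnj_vec w)"
    using ev_eq_cinner[OF assms(2), of "eigensection w"]
      kernel_element(1)[OF cnj_vec_in_ball[OF assms(1)] cnj_vec_in_ball[OF assms(2)]]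
    by (simp add: eigensection_def)
  with K_sums[OF cnj_vec_in_ball[OF assms(2)] cnj_vec_in_ball[OF assms(1)]]
  show ?thesis by (simp add: hprod_cnj_vec)
qed

lemma cinner_eigensection:
  assumes "w \<in> ball 0 1" "v \<in> ball 0 1"
  shows "cinner (eigensection w) (eigensection v) = complex_series (hprod w v)"
  using cinner_eigensection_sums[OF assms] by (simp add: complex_series_def sums_iff)

lemma norm_eigensection:
  assumes "w \<in> ball 0 1"
  shows "(norm (eigensection w))\<^sup>2 = real_series ((norm w)\<^sup>2)"
proof -
  have "\<bar>(norm w)\<^sup>2\<bar> < 1" using assms by (simp add: abs_square_less_1)
  then show ?thesis
    by (simp add: norm_sq_cinner cinner_eigensection[OF assms assms] hprod_self complex_series_of_real
        del: of_real_power)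
qed

lemma cinner_eigensection_0:
  assumes "w \<in> ball 0 1"
  shows "cinner (eigensection w) (eigensection 0) = of_real (a 0)"
proof -
  have "hprod w 0 = of_real 0" by (simp add: hprod_def)
  then show ?thesis using cinner_eigensection[OF assms, of 0] complex_series_of_real[of 0] real_series_0
    by simp
qed

lemma real_series_norm_pos: "w \<in> ball 0 1 \<Longrightarrow> real_series ((norm w)\<^sup>2) > 0" for w :: "complex^'m"
  by (intro real_series_pos) (auto simp: abs_square_less_1)

lemma eigensection_nonzero: "w \<in> ball 0 1 \<Longrightarrow> eigensection w \<noteq> 0"
  using norm_eigensection[of w] real_series_norm_pos[of w] by auto

lemma bounded_clinear_T: "bounded_clinear (T i)"
  using cowen_douglas by (simp add: cowen_douglas_1_def commuting_tuple_def)

lemma T_eigensection: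
  assumes w: "w \<in> ball 0 1"
  shows "T i (eigensection w) = scaleC (w $ i) (eigensection w)"
proof (rule cinner_eq_imp_eq)
  fix f
  obtain M where M: "bounded_clinear (M i)" "\<And>f z. z \<in> ball 0 1 \<Longrightarrow> ev (M i f) z = z $ i * ev f z"
    "T i = cadjoint (M i)"
    using adjoint_tuple unfolding adjoint_multiplication_tuple_def by blast
  have "cinner f (T i (eigensection w)) = cinner (M i f) (eigensection w)"
    by (simp add: M(3) cadjoint_works[OF M(1)])
  also have "\<dots> = cnj (w $ i) * ev f (cnj_vec w)"
    using M(2)[OF cnj_vec_in_ball[OF w]] by (simp flip: ev_eq_cinner[OF w])
  also have "\<dots> = cinner f (scaleC (w $ i) (eigensection w))"
    by (simp add: cinner_scaleC_right ev_eq_cinner[OF w])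
  finally show "cinner f (T i (eigensection w)) = cinner f (scaleC (w $ i) (eigensection w))" .
qed

lemma eigensection_in_kernel: "w \<in> ball 0 1 \<Longrightarrow> eigensection w \<in> joint_kernel T w"
  by (simp add: joint_kernel_def T_eigensection)

lemma joint_kernel_multiple:
  assumes "w \<in> ball 0 1" "x \<in> joint_kernel T w"
  obtains c where "x = scaleC c (eigensection w)"
  using dim_one_multiple[OF _ eigensection_in_kernel[OF assms(1)] eigensection_nonzero[OF assms(1)] assms(2)]
    cowen_douglas assms(1) by (auto simp: cowen_douglas_1_def)

lemma eigensections_dense:
  assumes sub: "complex_vector.subspace V" and V: "\<And>w. w \<in> ball 0 1 \<Longrightarrow> eigensection w \<in> V"
  shows "closure V = UNIV"
proof -
  have "(\<Union>w\<in>ball 0 1. joint_kernel T w) \<subseteq> V"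
  proof clarify
    fix w x assume w: "w \<in> ball 0 1" and "x \<in> joint_kernel T w"
    then obtain c where "x = scaleC c (eigensection w)" by (rule joint_kernel_multiple)
    then show "x \<in> V" using complex_vector.subspace_scale[OF sub V[OF w]] by simp
  qed
  then have "complex_vector.span (\<Union>w\<in>ball 0 1. joint_kernel T w) \<subseteq> V"
    by (rule complex_vector.span_minimal[OF _ sub])
  then have "closure (complex_vector.span (\<Union>w\<in>ball 0 1. joint_kernel T w)) \<subseteq> closure V"
    by (rule closure_mono)
  then show ?thesis using cowen_douglas by (auto simp: cowen_douglas_1_def)
qed

text \<open>The section is weakly holomorphic, since \<open>\<langle>f, eigensection w\<rangle> = f (cnj w)\<close>. The Cauchy
  estimates for \<open>f\<close> are uniform over the unit ball of the space, so Riesz representation of the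
  functional \<open>f \<mapsto> f' (cnj w) (cnj h)\<close> gives the derivative in norm.\<close>

lemma eigensection_holomorphic: "holomorphic_vec_on eigensection (ball 0 1)"
  unfolding holomorphic_vec_on_def
proof
  fix w :: "complex^'m" assume w: "w \<in> ball 0 1"
  \<comment> \<open>the ball of radius \<open>r\<close> about \<open>cnj w\<close> stays in the closed ball of radius \<open>\<rho> < 1\<close>\<close>
  define r where "r = (1 - norm w) / 2"
  define \<rho> where "\<rho> = (1 + norm w) / 2"
  define N where "N = sqrt (real_series (\<rho>\<^sup>2))"
  have r: "r > 0" and \<rho>: "0 \<le> \<rho>" "\<rho> < 1" using w by (auto simp: r_def \<rho>_def add_nonneg_nonneg)
  let ?z = "cnj_vec w"
  have sub: "norm y \<le> \<rho>" if "dist ?z y < r" for y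
    using that norm_triangle_ineq2[of y ?z]
    by (simp add: dist_norm norm_minus_commute r_def \<rho>_def field_simps)
  have sub': "ball ?z r \<subseteq> ball 0 1"
  proof
    fix y assume "y \<in> ball ?z r"
    then show "y \<in> ball 0 1" using sub[of y] \<rho> by simp
  qed
  have N: "norm (kernel_element y) \<le> N" if "y \<in> ball ?z r" for y
  proof -
    have y: "norm y \<le> \<rho>" using that sub by simp
    have yb: "cnj_vec y \<in> ball 0 1" using y \<rho> by simp
    have "eigensection (cnj_vec y) = kernel_element y"
      by (simp add: eigensection_def cnj_vec_def)
    then have "(norm (kernel_element y))\<^sup>2 = real_series ((norm y)\<^sup>2)"
      using norm_eigensection[OF yb] by simp
    also have "\<dots> \<le> real_series (\<rho>\<^sup>2)"
      using y \<rho> by (intro real_series_mono power_mono) (auto simp: abs_square_less_1)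
    finally show ?thesis by (simp add: N_def real_le_rsqrt)
  qed
  let ?D = "\<lambda>f. frechet_derivative (ev f) (at ?z)"
  have hol: "holomorphic_vec_on (ev f) (ball 0 1)" for f
    using rkhs by (simp add: holomorphic_rkhs_def)
  have zb: "?z \<in> ball 0 1" using w by simp
  note D = holomorphic_vec_derivative[OF hol zb, unfolded scaleC_complex_def]
  have lin: "linear (?D f)" for f by (rule has_derivative_linear[OF D(1)])
  have bound: "cmod (ev f y) \<le> norm f * N" if y: "y \<in> ball ?z r" for f y
  proof -
    have "ev f y = cinner f (kernel_element y)" using y sub' by (intro kernel_element(2)) auto
    then show ?thesis
      using complex_cauchy_schwarz[of f "kernel_element y"] mult_left_mono[OF N[OF y], of "norm f"]
      by simp
  qed
  note est = holomorphic_vec_cauchy_estimate[OF holomorphic_vec_on_subset[OF hol sub'] r bound]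
  have "\<exists>y. \<forall>f. ?D f (cnj_vec h) = cinner f y" for h
  proof (rule riesz_representation)
    fix f g :: 'h and c
    have "?D (f + g) = (\<lambda>h. ?D f h + ?D g h)"
    proof -
      have "frechet_derivative (\<lambda>z. ev f z + ev g z) (at ?z) = ?D (f + g)"
        by (rule frechet_derivative_cong[OF open_ball zb])
          (use rkhs in \<open>simp add: holomorphic_rkhs_def\<close>)
      moreover have "((\<lambda>z. ev f z + ev g z) has_derivative (\<lambda>h. ?D f h + ?D g h)) (at ?z)"
        by (intro derivative_intros D(1))
      ultimately show ?thesis using frechet_derivative_at by metis
    qed
    then show "?D (f + g) (cnj_vec h) = ?D f (cnj_vec h) + ?D g (cnj_vec h)" by simp
    have "?D (scaleC c f) = (\<lambda>h. c * ?D f h)"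
    proof -
      have "frechet_derivative (\<lambda>z. c * ev f z) (at ?z) = ?D (scaleC c f)"
        by (rule frechet_derivative_cong[OF open_ball zb])
          (use rkhs in \<open>simp add: holomorphic_rkhs_def\<close>)
      moreover have "((\<lambda>z. c * ev f z) has_derivative (\<lambda>h. c * ?D f h)) (at ?z)"
        by (intro derivative_intros D(1))
      ultimately show ?thesis using frechet_derivative_at by metis
    qed
    then show "?D (scaleC c f) (cnj_vec h) = c * ?D f (cnj_vec h)" by simp
    show "cmod (?D f (cnj_vec h)) \<le> (2 * N / r * norm h) * norm f"
      using est(1)[of f "cnj_vec h"] by (simp add: mult_ac)
  qed
  then obtain E where E: "\<And>h f. ?D f (cnj_vec h) = cinner f (E h)" by metis
  have E_add: "E (h + k) = E h + E k" for h k
    by (rule cinner_eq_imp_eq)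
      (simp add: cinner_add_right cnj_vec_add linear_add[OF lin] flip: E)
  have E_scale: "E (c *s h) = scaleC c (E h)" for c h
    by (rule cinner_eq_imp_eq)
      (simp add: cinner_scaleC_right cnj_vec_smult D(2) flip: E)
  have "linear E"
    by (rule linearI) (simp_all add: E_add E_scale flip: smult_of_real scaleC_of_real)
  then have E_bl: "bounded_linear E" by (simp add: linear_conv_bounded_linear)
  have "(eigensection has_derivative E) (at w)"
  proof (rule has_derivative_of_quadratic_bound[OF E_bl])
    show "r / 2 > 0" using r by simp
    fix h :: "complex^'m" assume h: "norm h < r / 2"
    define x where "x = eigensection (w + h) - eigensection w - E h"
    have wh: "w + h \<in> ball 0 1"
    proof -
      have "r / 2 < 1 - norm w" using w by (simp add: r_def)
      then show ?thesis using h norm_triangle_ineq[of w h] by simp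
    qed
    have "(norm x)\<^sup>2 = cmod (cinner x x)" by (simp add: cinner_self norm_power)
    also have "cinner x x = ev x (cnj_vec (w + h)) - ev x ?z - ?D x (cnj_vec h)"
      unfolding ev_eq_cinner[OF wh] ev_eq_cinner[OF w] E
      by (simp add: x_def cinner_diff_right)
    also have "cmod \<dots> \<le> 8 * (norm x * N) / r\<^sup>2 * (norm h)\<^sup>2"
      using est(2)[of "cnj_vec h" x] h by (simp add: cnj_vec_add)
    finally have le: "norm x * norm x \<le> norm x * (8 * N / r\<^sup>2 * (norm h)\<^sup>2)"
      by (simp add: power2_eq_square mult_ac)
    show "norm (eigensection (w + h) - eigensection w - E h) \<le> 8 * N / r\<^sup>2 * (norm h)\<^sup>2"
    proof (cases "x = 0")
      case True
      have "N \<ge> 0" using \<rho> by (simp add: N_def real_series_pos abs_square_less_1 less_imp_le)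
      then show ?thesis using True by (simp add: x_def)
    next
      case False
      then have "norm x \<le> 8 * N / r\<^sup>2 * (norm h)\<^sup>2"
        using le mult_le_cancel_left_pos by (metis zero_less_norm_iff)
      then show ?thesis by (simp add: x_def)
    qed
  qed
  then show "\<exists>D. (eigensection has_derivative D) (at w) \<and> (\<forall>c v. D (c *s v) = scaleC c (D v))"
    using E_scale by blast
qed

text \<open>Any local section is a non-vanishing holomorphic multiple of \<open>eigensection\<close>, the factor being
  read off from the inner product with \<open>eigensection 0\<close>.\<close>

lemma curvature_eq:
  assumes w: "w \<in> ball 0 1"
  shows "curvature (ball 0 1) T w
    = form11 (\<lambda>i j. - mixed_d i j (\<lambda>w. ln (real_series ((norm w)\<^sup>2))) w)"
proof -
  define \<gamma> where
    "\<gamma> = (SOME \<gamma>. \<exists>U. open U \<and> w \<in> U \<and> U \<subseteq> ball 0 1 \<and> nonvanishing_section T U \<gamma>)"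
  have "nonvanishing_section T (ball 0 1) eigensection"
    using eigensection_holomorphic eigensection_in_kernel eigensection_nonzero
    by (simp add: nonvanishing_section_def)
  then have "\<exists>\<gamma>. \<exists>U. open U \<and> w \<in> U \<and> U \<subseteq> ball 0 1 \<and> nonvanishing_section T U \<gamma>"
    using w by (intro exI[of _ eigensection] exI[of _ "ball 0 1"]) simp
  then have "\<exists>U. open U \<and> w \<in> U \<and> U \<subseteq> ball 0 1 \<and> nonvanishing_section T U \<gamma>"
    unfolding \<gamma>_def by (rule someI_ex)
  then obtain U where U: "open U" "w \<in> U" "U \<subseteq> ball 0 1"
    and sec: "nonvanishing_section T U \<gamma>" by auto
  define \<phi> where "\<phi> z = cinner (\<gamma> z) (eigensection 0) / of_real (a 0)" for z
  have \<phi>: "\<gamma> z = scaleC (\<phi> z) (eigensection z)" if z: "z \<in> U" for z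
  proof -
    have zb: "z \<in> ball 0 1" using z U by blast
    obtain c where c: "\<gamma> z = scaleC c (eigensection z)"
      using joint_kernel_multiple[OF zb] sec z by (auto simp: nonvanishing_section_def)
    have "\<phi> z = c"
      using a_pos[of 0] by (simp add: \<phi>_def c cinner_scaleC_left cinner_eigensection_0[OF zb])
    with c show ?thesis by simp
  qed
  have nz: "\<phi> z \<noteq> 0" if "z \<in> U" for z
    using \<phi>[OF that] sec that by (auto simp: nonvanishing_section_def)
  have "bounded_linear (\<lambda>x. cinner x (eigensection 0) / of_real (a 0))"
    by (rule bounded_linear_compose[OF bounded_linear_divide bounded_linear_cinner_left])
  then have lin: "bounded_clinear (\<lambda>x. cinner x (eigensection 0) / of_real (a 0))"
    by (simp add: bounded_clinear_def cinner_scaleC_left scaleC_complex_def)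
  have "holomorphic_vec_on \<gamma> U" using sec by (simp add: nonvanishing_section_def)
  then have hol: "holomorphic_vec_on \<phi> U"
    unfolding \<phi>_def[abs_def] by (rule holomorphic_vec_on_clinear[OF _ lin])
  note \<phi>_ln = mixed_d_ln_cmod_holomorphic[OF hol U(1) nz]
  have series_tw: "twice_differentiable_on (\<lambda>w. ln (real_series ((norm w)\<^sup>2))) U"
    by (rule twice_differentiable_on_subset[OF ln_real_series_twice_differentiable U(3)])
  have "mixed_d i j (\<lambda>w. ln ((norm (\<gamma> w))\<^sup>2)) w = mixed_d i j (\<lambda>w. ln (real_series ((norm w)\<^sup>2))) w" for i j
  proof -
    have "mixed_d i j (\<lambda>w. ln ((norm (\<gamma> w))\<^sup>2)) w
        = mixed_d i j (\<lambda>z. 1 * ln ((cmod (\<phi> z))\<^sup>2) + 1 * ln (real_series ((norm z)\<^sup>2))) w"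
    proof (rule mixed_d_cong[OF U(1,2)])
      fix z assume z: "z \<in> U"
      then have zb: "z \<in> ball 0 1" using U by blast
      show "ln ((norm (\<gamma> z))\<^sup>2) = 1 * ln ((cmod (\<phi> z))\<^sup>2) + 1 * ln (real_series ((norm z)\<^sup>2))"
        using nz[OF z] real_series_norm_pos[OF zb] norm_eigensection[OF zb]
        by (simp add: \<phi>[OF z] norm_scaleC power_mult_distrib ln_mult)
    qed
    also have "\<dots> = of_real 1 * mixed_d i j (\<lambda>z. ln ((cmod (\<phi> z))\<^sup>2)) w
        + of_real 1 * mixed_d i j (\<lambda>w. ln (real_series ((norm w)\<^sup>2))) w"
      by (rule twice_differentiable_linear_combination(2)[OF \<phi>_ln(1) series_tw U(1,2)])
    also have "\<dots> = mixed_d i j (\<lambda>w. ln (real_series ((norm w)\<^sup>2))) w"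
      using \<phi>_ln(2)[OF _ U(2)] by simp
    finally show ?thesis .
  qed
  then show ?thesis by (simp add: curvature_def \<gamma>_def[symmetric] Let_def)
qed

end

section \<open>Hypercontractions and their coefficients\<close>

lemma cinner_cadjoint_left:
  assumes "bounded_clinear A"
  shows "cinner (cadjoint A x) y = cinner x (A y)"
  by (metis cadjoint_works[OF assms] cinner_commute)

lemma cadjoint_add:
  assumes "bounded_clinear A"
  shows "cadjoint A (x + y) = cadjoint A x + cadjoint A y"
  by (rule cinner_eq_imp_eq_left) (simp add: cinner_cadjoint_left[OF assms] cinner_add_left)

lemma cadjoint_scaleC:
  assumes "bounded_clinear A"
  shows "cadjoint A (scaleC c x) = scaleC c (cadjoint A x)"
  by (rule cinner_eq_imp_eq_left) (simp add: cinner_cadjoint_left[OF assms] cinner_scaleC_left)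

lemma sum_roots_of_unity_power:
  fixes N i l :: nat
  assumes i: "i < N" and l: "l < N" and ne: "i \<noteq> l"
  shows "(\<Sum>s<N. cis (2 * pi * real s / real N) ^ i * cnj (cis (2 * pi * real s / real N)) ^ l) = 0"
proof -
  define q where "q = cis (2 * pi * (real i - real l) / real N)"
  have N: "N > 0" using i by simp
  have geometric: "cis (2 * pi * real s / real N) ^ i * cnj (cis (2 * pi * real s / real N)) ^ l = q ^ s" for s
    unfolding q_def cis_cnj Complex.DeMoivre cis_mult
    by (intro arg_cong[where f = cis]) (use N in \<open>simp add: field_simps\<close>)
  have "q \<noteq> 1"
  proof
    assume "q = 1"
    then have "cos (2 * pi * (real i - real l) / real N) = 1" by (simp add: q_def complex_eq_iff)
    then obtain k :: int where k: "2 * pi * (real i - real l) / real N = of_int k * 2 * pi"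
      using cos_one_2pi_int by blast
    then have "(2 * pi) * (real i - real l) = (2 * pi) * (of_int k * real N)"
      using N by (simp add: divide_eq_eq mult_ac)
    then have "real i - real l = of_int k * real N" by (simp only: mult_cancel_left) simp
    then have eq: "int i - int l = k * int N"
      by (metis of_int_diff of_int_eq_iff of_int_mult of_int_of_nat_eq)
    then have "\<bar>k * int N\<bar> < int N" using i l by linarith
    then have "k = 0" using N by (simp add: abs_mult)
    with eq ne show False by simp
  qed
  moreover have "q ^ N = 1"
  proof -
    have "q ^ N = cis (2 * pi * of_int (int i - int l))"
      using N by (simp add: q_def Complex.DeMoivre)
    then show ?thesis by (simp only: cis_multiple_2pi Ints_of_int)
  qed
  ultimately have "(\<Sum>s<N. q ^ s) = 0" by (simp add: sum_gp_strict)
  then show ?thesis by (simp add: geometric)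
qed

context radial_kernel_space
begin

definition M_power :: "nat \<Rightarrow> 'h \<Rightarrow> 'h"
  where "M_power j = (M_map T ^^ j) id"

lemma M_power_0: "M_power 0 x = x"
  by (simp add: M_power_def)

lemma M_power_Suc: "M_power (Suc j) x = (\<Sum>i\<in>UNIV. cadjoint (T i) (M_power j (T i x)))"
  unfolding M_power_def funpow.simps o_apply M_map_def ..

lemma M_power_add: "M_power j (x + y) = M_power j x + M_power j y"
  by (induction j arbitrary: x y)
    (simp_all add: M_power_0 M_power_Suc bounded_clinear_add[OF bounded_clinear_T]
      cadjoint_add[OF bounded_clinear_T] sum.distrib)

lemma M_power_scaleC: "M_power j (scaleC c x) = scaleC c (M_power j x)"
  by (induction j arbitrary: x)
    (simp_all add: M_power_0 M_power_Suc bounded_clinear_scaleC[OF bounded_clinear_T]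
      cadjoint_scaleC[OF bounded_clinear_T] complex_vector.scale_sum_right)

lemma M_power_eigensection:
  assumes w: "w \<in> ball 0 1" and v: "v \<in> ball 0 1"
  shows "cinner (M_power j (eigensection w)) (eigensection v)
    = hprod w v ^ j * cinner (eigensection w) (eigensection v)"
proof (induction j)
  case (Suc j)
  have "cinner (M_power (Suc j) (eigensection w)) (eigensection v)
      = (\<Sum>i\<in>UNIV. cinner (M_power j (T i (eigensection w))) (T i (eigensection v)))"
    by (simp add: M_power_Suc cinner_sum_left cinner_cadjoint_left[OF bounded_clinear_T])
  also have "\<dots> = (\<Sum>i\<in>UNIV. w $ i * cnj (v $ i)) * cinner (M_power j (eigensection w)) (eigensection v)"
    by (simp add: T_eigensection[OF w] T_eigensection[OF v] M_power_scaleC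
        cinner_scaleC_left cinner_scaleC_right sum_distrib_right mult.assoc mult.left_commute)
  finally show ?case by (simp add: Suc.IH mult.assoc flip: hprod_def)
qed (simp add: M_power_0)

text \<open>The operator \<open>(I - M\<^sub>T)\<^sup>n (I)\<close> of the hypercontraction condition.\<close>

definition defect :: "nat \<Rightarrow> 'h \<Rightarrow> 'h"
  where "defect n x = (\<Sum>j\<le>n. ((-1) ^ j * real (n choose j)) *\<^sub>R M_power j x)"

lemma defect_sum:
  "defect n (\<Sum>s\<in>I. scaleC (\<alpha> s) (f s)) = (\<Sum>s\<in>I. scaleC (\<alpha> s) (defect n (f s)))"
proof -
  have add: "defect n (x + y) = defect n x + defect n y" for x y
    by (simp add: defect_def M_power_add M_power_scaleC scaleR_right_distrib sum.distrib)
  have scale: "defect n (scaleC c x) = scaleC c (defect n x)" for c x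
    by (simp add: defect_def M_power_add M_power_scaleC complex_vector.scale_sum_right scaleC_scaleC
        mult.commute flip: scaleC_of_real)
  have zero: "defect n 0 = 0" using scale[of 0 0] by simp
  show ?thesis
    by (induction I rule: infinite_finite_induct) (simp_all add: add scale zero)
qed

text \<open>On eigensections \<open>M\<^sub>T\<^sup>j (I)\<close> acts as multiplication of the kernel by \<open>\<langle>w, v\<rangle>\<^sup>j\<close>, so the defect
  operator multiplies it by \<open>(1 - \<langle>w, v\<rangle>)\<^sup>n\<close>.\<close>

lemma cinner_defect_sums:
  assumes w: "w \<in> ball 0 1" and v: "v \<in> ball 0 1"
  shows "(\<lambda>i. complex_of_real ((backward_difference ^^ n) a i) * hprod w v ^ i)
    sums cinner (defect n (eigensection w)) (eigensection v)"
proof -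
  have "cinner (defect n (eigensection w)) (eigensection v)
      = (\<Sum>j\<le>n. of_nat (n choose j) * (- hprod w v) ^ j * 1 ^ (n - j))
        * cinner (eigensection w) (eigensection v)"
    unfolding defect_def cinner_sum_left sum_distrib_right
  proof (intro sum.cong refl)
    fix j
    have "(- hprod w v) ^ j = (- 1) ^ j * hprod w v ^ j" by (rule power_minus)
    then show "cinner (((- 1) ^ j * real (n choose j)) *\<^sub>R M_power j (eigensection w)) (eigensection v)
        = of_nat (n choose j) * (- hprod w v) ^ j * 1 ^ (n - j) * cinner (eigensection w) (eigensection v)"
      by (simp add: cinner_scaleR_left M_power_eigensection[OF w v])
  qed
  also have "(\<Sum>j\<le>n. of_nat (n choose j) * (- hprod w v) ^ j * 1 ^ (n - j)) = (- hprod w v + 1) ^ n"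
    by (rule binomial_ring[symmetric])
  also have "- hprod w v + 1 = 1 - hprod w v" by simp
  finally show ?thesis
    using backward_difference_power_sums[OF cinner_eigensection_sums[OF w v]] by simp
qed

lemma backward_difference_disc_summable:
  assumes r: "0 \<le> r" "r < 1"
  shows "summable (\<lambda>i. (backward_difference ^^ n) a i * r ^ i)"
proof -
  have "(\<lambda>i. complex_of_real (a i) * of_real r ^ i) sums complex_series (of_real r)"
    unfolding complex_series_def by (rule summable_sums[OF summable_complex]) (use r in simp)
  from sums_summable[OF backward_difference_power_sums[OF this, of n]]
  have "summable (\<lambda>i. complex_of_real ((backward_difference ^^ n) a i * r ^ i))" by simp
  then show ?thesis by (simp only: summable_of_real_iff)
qed

text \<open>The form of the defect operator on eigensections is the power series with the coefficients
  \<open>\<Delta>\<^sup>n a\<close>, where \<open>\<Delta>\<close> is \<open>backward_difference\<close>. Testing its positivity on the discrete Fourier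
  coefficient \<open>\<Sum>\<^sub>s cnj \<omega>\<^sub>s\<^sup>l eigensection (\<omega>\<^sub>s u)\<close> over the \<open>N\<close>-th roots of unity \<open>\<omega>\<^sub>s\<close> isolates the
  \<open>l\<close>-th coefficient up to a tail that vanishes as \<open>N\<close> grows. The base point \<open>u\<close> of norm \<open>1/2\<close> only has to lie in the ball, off the origin.\<close>

lemma hypercontraction_coefficients:
  assumes n: "n \<ge> 1" and hyp: "hypercontraction n T"
  shows "(backward_difference ^^ n) a l \<ge> 0"
proof -
  define c where "c = (backward_difference ^^ n) a"
  define u :: "complex^'m" where "u = of_real (1 / 2) *s axis undefined 1"
  have nu: "norm u = 1 / 2" by (simp add: u_def norm_vector_smult norm_axis_1)
  have huu: "hprod u u = of_real (1 / 4)"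
    by (simp only: hprod_self nu) (simp add: power2_eq_square)
  define g where "g i = \<bar>c i\<bar> * (1 / 4) ^ i" for i
  have g: "summable g"
  proof -
    have "summable (\<lambda>i. norm (of_real (c i) * (1 / 4 :: real) ^ i))"
      by (rule abs_summable_of_disc_summable) (auto simp: c_def intro: backward_difference_disc_summable)
    then show ?thesis by (simp add: g_def[abs_def] abs_mult)
  qed
  have key: "0 \<le> c l * (1 / 4) ^ l + (\<Sum>i. g (i + N))" if N: "N > l" for N
  proof -
    define \<omega> where "\<omega> s = cis (2 * pi * real s / real N)" for s
    define x where "x = (\<Sum>s<N. scaleC (cnj (\<omega> s) ^ l) (eigensection (\<omega> s *s u)))"
    define \<sigma> where "\<sigma> i = (\<Sum>s<N. \<omega> s ^ i * cnj (\<omega> s) ^ l)" for i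
    define f where "f i = c i * (1 / 4) ^ i * (cmod (\<sigma> i))\<^sup>2" for i
    have \<omega>: "cmod (\<omega> s) = 1" for s by (simp add: \<omega>_def)
    have mem: "\<omega> s *s u \<in> ball 0 1" for s by (simp add: norm_vector_smult \<omega> nu)
    have dx: "defect n x = (\<Sum>s<N. scaleC (cnj (\<omega> s) ^ l) (defect n (eigensection (\<omega> s *s u))))"
      by (simp add: x_def defect_sum)
    have cx: "cinner y x = (\<Sum>t<N. \<omega> t ^ l * cinner y (eigensection (\<omega> t *s u)))" for y
      by (simp add: x_def cinner_sum_right cinner_scaleC_right)
    have "(\<lambda>i. \<Sum>s<N. cnj (\<omega> s) ^ l * (\<Sum>t<N. \<omega> t ^ l * (of_real (c i) * hprod (\<omega> s *s u) (\<omega> t *s u) ^ i)))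
        sums (\<Sum>s<N. cnj (\<omega> s) ^ l * (\<Sum>t<N. \<omega> t ^ l
          * cinner (defect n (eigensection (\<omega> s *s u))) (eigensection (\<omega> t *s u))))"
      unfolding c_def by (intro sums_sum sums_mult cinner_defect_sums mem)
    also have "(\<Sum>s<N. cnj (\<omega> s) ^ l * (\<Sum>t<N. \<omega> t ^ l
          * cinner (defect n (eigensection (\<omega> s *s u))) (eigensection (\<omega> t *s u))))
        = cinner (defect n x) x"
      unfolding dx unfolding cinner_sum_left cinner_scaleC_left unfolding cx ..
    also have "(\<lambda>i. \<Sum>s<N. cnj (\<omega> s) ^ l * (\<Sum>t<N. \<omega> t ^ l
          * (of_real (c i) * hprod (\<omega> s *s u) (\<omega> t *s u) ^ i))) = (\<lambda>i. of_real (f i))"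
    proof
      fix i
      have "(\<Sum>s<N. cnj (\<omega> s) ^ l * (\<Sum>t<N. \<omega> t ^ l
            * (of_real (c i) * hprod (\<omega> s *s u) (\<omega> t *s u) ^ i)))
          = of_real (c i * (1 / 4) ^ i) * (\<sigma> i * cnj (\<sigma> i))"
        unfolding \<sigma>_def cnj_sum sum_product unfolding sum_distrib_left
        by (intro sum.cong refl)
          (simp add: hprod_smult_left hprod_smult_right huu power_mult_distrib power_divide mult_ac)
      also have "\<dots> = of_real (f i)"
        by (simp only: f_def complex_norm_square of_real_mult)
      finally show "(\<Sum>s<N. cnj (\<omega> s) ^ l * (\<Sum>t<N. \<omega> t ^ l
            * (of_real (c i) * hprod (\<omega> s *s u) (\<omega> t *s u) ^ i))) = of_real (f i)" .
    qed
    finally have fs: "f sums Re (cinner (defect n x) x)"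
      using sums_Re by fastforce
    have pos: "0 \<le> Re (cinner (defect n x) x)"
      using hyp n by (auto simp: hypercontraction_def positive_op_def defect_def M_power_def)
    have \<sigma>l: "\<sigma> l = of_nat N"
    proof -
      have "\<omega> s ^ l * cnj (\<omega> s) ^ l = 1" for s
        by (simp add: \<omega> complex_norm_square[symmetric] flip: power_mult_distrib)
      then show ?thesis by (simp add: \<sigma>_def)
    qed
    have \<sigma>0: "\<sigma> i = 0" if "i < N" "i \<noteq> l" for i
      unfolding \<sigma>_def \<omega>_def using that N by (intro sum_roots_of_unity_power) auto
    have \<sigma>le: "cmod (\<sigma> i) \<le> real N" for i
    proof -
      have "cmod (\<sigma> i) \<le> (\<Sum>s<N. cmod (\<omega> s ^ i * cnj (\<omega> s) ^ l))" unfolding \<sigma>_def by (rule norm_sum)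
      then show ?thesis by (simp add: norm_mult norm_power \<omega>)
    qed
    have "(\<Sum>i<N. f i) = (\<Sum>i\<in>{l}. f i)"
      by (rule sum.mono_neutral_right) (use N \<sigma>0 in \<open>auto simp: f_def\<close>)
    then have head: "(\<Sum>i<N. f i) = c l * (1 / 4) ^ l * (real N)\<^sup>2" by (simp add: f_def \<sigma>l)
    have fle: "f i \<le> (real N)\<^sup>2 * g i" for i
    proof -
      have "f i \<le> \<bar>c i\<bar> * (1 / 4) ^ i * (cmod (\<sigma> i))\<^sup>2"
        unfolding f_def by (intro mult_right_mono) auto
      also have "\<dots> \<le> \<bar>c i\<bar> * (1 / 4) ^ i * (real N)\<^sup>2"
        by (intro mult_left_mono power_mono \<sigma>le) auto
      finally show ?thesis by (simp add: g_def mult_ac)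
    qed
    have gN: "summable (\<lambda>i. g (i + N))" using g by (subst summable_iff_shift)
    have fN: "summable (\<lambda>i. f (i + N))" using sums_summable[OF fs] by (subst summable_iff_shift)
    have "0 \<le> (\<Sum>i. f (i + N)) + (\<Sum>i<N. f i)"
      using pos sums_unique[OF fs] suminf_split_initial_segment[OF sums_summable[OF fs], of N] by simp
    also have "(\<Sum>i. f (i + N)) \<le> (\<Sum>i. (real N)\<^sup>2 * g (i + N))"
      by (rule suminf_le[OF fle fN summable_mult[OF gN]])
    also have "(\<Sum>i. (real N)\<^sup>2 * g (i + N)) = (real N)\<^sup>2 * (\<Sum>i. g (i + N))"
      by (rule suminf_mult[OF gN])
    finally have "0 \<le> (real N)\<^sup>2 * (c l * (1 / 4) ^ l + (\<Sum>i. g (i + N)))"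
      by (simp add: head algebra_simps)
    then show ?thesis using N by (simp add: zero_le_mult_iff)
  qed
  have "(\<lambda>N. suminf g - (\<Sum>i<N. g i)) \<longlonglongrightarrow> suminf g - suminf g"
    by (intro tendsto_diff tendsto_const summable_LIMSEQ[OF g])
  then have "(\<lambda>N. (\<Sum>i. g (i + N))) \<longlonglongrightarrow> 0"
    by (simp add: suminf_minus_initial_segment[OF g])
  from tendsto_add[OF tendsto_const[of "c l * (1 / 4) ^ l"] this]
  have "(\<lambda>N. c l * (1 / 4) ^ l + (\<Sum>i. g (i + N))) \<longlonglongrightarrow> c l * (1 / 4) ^ l" by simp
  then have "0 \<le> c l * (1 / 4) ^ l"
    by (rule tendsto_lowerbound)
      (use key in \<open>auto intro!: eventually_sequentiallyI[of "Suc l"]\<close>)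
  moreover have "(0::real) < (1 / 4) ^ l" by (rule zero_less_power) simp
  ultimately have "0 \<le> c l" by (metis mult_neg_pos not_le)
  then show ?thesis by (simp add: c_def)
qed

lemma quotient_power_series:
  assumes "n \<ge> 1" "hypercontraction n T"
  shows "nonneg_power_series ((backward_difference ^^ n) a)"
proof
  show "(backward_difference ^^ n) a i \<ge> 0" for i
    by (rule hypercontraction_coefficients[OF assms])
  have "(backward_difference ^^ k) a 0 = a 0" for k
    by (induction k) (auto simp: backward_difference_def)
  then show "(backward_difference ^^ n) a 0 > 0" using a_pos by simp
qed (rule backward_difference_disc_summable)

end

section \<open>Similarity from comparable kernels\<close>

text \<open>This turns a relation between the two spaces into an operator without a formula for it: the norm
  estimate, applied to a difference, makes the relation single-valued.\<close>

lemma graph_operator: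
  fixes G :: "('a::complex_inner \<times> 'b::complex_inner) set"
  assumes add: "\<And>x y x' y'. (x, y) \<in> G \<Longrightarrow> (x', y') \<in> G \<Longrightarrow> (x + x', y + y') \<in> G"
    and scale: "\<And>x y c. (x, y) \<in> G \<Longrightarrow> (scaleC c x, scaleC c y) \<in> G"
    and est: "\<And>x y. (x, y) \<in> G \<Longrightarrow> norm y \<le> C * norm x"
    and total: "\<And>x. \<exists>y. (x, y) \<in> G"
  shows "\<exists>X. bounded_clinear X \<and> (\<forall>x y. (x, y) \<in> G \<longleftrightarrow> y = X x)"
proof -
  obtain X where X: "\<And>x. (x, X x) \<in> G" using total by metis
  have graph: "(x, y) \<in> G \<longleftrightarrow> y = X x" for x y
  proof
    assume xy: "(x, y) \<in> G"
    have "(x + scaleC (-1) x, y + scaleC (-1) (X x)) \<in> G" by (intro add scale xy X)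
    moreover have "scaleC (-1) z = - z" for z :: "'c::complex_inner"
      using complex_vector.scale_minus_left[of 1 z] by simp
    ultimately have "norm (y - X x) \<le> 0" using est by fastforce
    then show "y = X x" by simp
  qed (simp add: X)
  have X_add: "X (x + x') = X x + X x'" for x x'
    using add[OF X X] graph by metis
  have X_scale: "X (scaleC c x) = scaleC c (X x)" for c x
    using scale[OF X] graph by metis
  have "bounded_linear X"
    by (rule bounded_linear_intro[of _ C])
      (use X_scale[of "of_real _"] est[OF X] in \<open>simp_all add: X_add scaleC_of_real mult.commute\<close>)
  then show ?thesis using X_scale graph unfolding bounded_clinear_def by blast
qed

text \<open>The sequential closure of a relation, as a relation; unlike the closure in the product space
  it is literally symmetric under exchanging the two sides.\<close>

definition limit_relation :: "('a::topological_space \<times> 'b::topological_space) set \<Rightarrow> ('a \<times> 'b) set"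
  where "limit_relation R =
    {(x, y). \<exists>u v. (\<forall>n. (u n, v n) \<in> R) \<and> (u \<longlonglongrightarrow> x) \<and> (v \<longlonglongrightarrow> y)}"

lemma limit_relationI:
  "(\<And>n. (u n, v n) \<in> R) \<Longrightarrow> u \<longlonglongrightarrow> x \<Longrightarrow> v \<longlonglongrightarrow> y \<Longrightarrow> (x, y) \<in> limit_relation R"
  by (auto simp: limit_relation_def)

lemma limit_relation_converse: "(x, y) \<in> limit_relation (R\<inverse>) \<longleftrightarrow> (y, x) \<in> limit_relation R"
  by (auto simp: limit_relation_def)

lemma limit_relation_total:
  fixes R :: "('a::complex_inner \<times> 'b::complex_hilbert) set"
  assumes add: "\<And>x y x' y'. (x, y) \<in> R \<Longrightarrow> (x', y') \<in> R \<Longrightarrow> (x + x', y + y') \<in> R"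
    and scale: "\<And>x y c. (x, y) \<in> R \<Longrightarrow> (scaleC c x, scaleC c y) \<in> R"
    and est: "\<And>x y. (x, y) \<in> R \<Longrightarrow> norm y \<le> C * norm x"
    and dense: "closure (fst ` R) = UNIV"
  shows "\<exists>y. (x, y) \<in> limit_relation R"
proof -
  have "x \<in> closure (fst ` R)" using dense by simp
  then obtain u where u: "\<And>n. u n \<in> fst ` R" "u \<longlonglongrightarrow> x" unfolding closure_sequential by blast
  have "\<exists>y. (u n, y) \<in> R" for n using u(1)[of n] by force
  then obtain v where v: "\<And>n. (u n, v n) \<in> R" by metis
  have minus: "scaleC (-1) z = - z" for z :: "'c::complex_inner"
    using complex_vector.scale_minus_left[of 1 z] by simp
  have diff: "norm (v p - v q) \<le> C * norm (u p - u q)" for p q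
    using est[OF add[OF v[of p] scale[OF v[of q], of "-1"]]] by (simp add: minus)
  have "Cauchy v"
  proof (rule metric_CauchyI)
    fix e :: real assume e: "e > 0"
    have C: "\<bar>C\<bar> + 1 > 0" by linarith
    have "Cauchy u" using u(2) by (rule LIMSEQ_imp_Cauchy)
    then obtain M where M: "\<And>p q. p \<ge> M \<Longrightarrow> q \<ge> M \<Longrightarrow> dist (u p) (u q) < e / (\<bar>C\<bar> + 1)"
      using metric_CauchyD[of u "e / (\<bar>C\<bar> + 1)"] e C by auto
    have "dist (v p) (v q) < e" if "p \<ge> M" "q \<ge> M" for p q
    proof -
      have "norm (v p - v q) \<le> (\<bar>C\<bar> + 1) * norm (u p - u q)"
        by (rule order.trans[OF diff]) (intro mult_right_mono, auto)
      also have "\<dots> < (\<bar>C\<bar> + 1) * (e / (\<bar>C\<bar> + 1))"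
        using M[OF that] C by (intro mult_strict_left_mono) (auto simp: dist_norm)
      finally show ?thesis using C by (simp add: dist_norm)
    qed
    then show "\<exists>M. \<forall>m\<ge>M. \<forall>n\<ge>M. dist (v m) (v n) < e" by blast
  qed
  then obtain y where "v \<longlonglongrightarrow> y" using Cauchy_convergent convergent_def by blast
  then show ?thesis using u v by (auto simp: limit_relation_def)
qed

lemma limit_relation_closed:
  fixes R :: "('a::complex_inner \<times> 'b::complex_inner) set"
  shows "(\<And>x y x' y'. (x, y) \<in> R \<Longrightarrow> (x', y') \<in> R \<Longrightarrow> (x + x', y + y') \<in> R) \<Longrightarrow>
      (x, y) \<in> limit_relation R \<Longrightarrow> (x', y') \<in> limit_relation R \<Longrightarrow>
      (x + x', y + y') \<in> limit_relation R"
    and "(\<And>x y. (x, y) \<in> R \<Longrightarrow> norm y \<le> C * norm x) \<Longrightarrow> (x, y) \<in> limit_relation R \<Longrightarrow>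
      norm y \<le> C * norm x"
    and "bounded_linear A \<Longrightarrow> bounded_linear B \<Longrightarrow> (\<And>x y. (x, y) \<in> R \<Longrightarrow> (A x, B y) \<in> R) \<Longrightarrow>
      (x, y) \<in> limit_relation R \<Longrightarrow> (A x, B y) \<in> limit_relation R"
proof -
  assume add: "\<And>x y x' y'. (x, y) \<in> R \<Longrightarrow> (x', y') \<in> R \<Longrightarrow> (x + x', y + y') \<in> R"
    and "(x, y) \<in> limit_relation R" "(x', y') \<in> limit_relation R"
  then obtain u v u' v' where "\<And>n. (u n, v n) \<in> R" "u \<longlonglongrightarrow> x" "v \<longlonglongrightarrow> y"
    "\<And>n. (u' n, v' n) \<in> R" "u' \<longlonglongrightarrow> x'" "v' \<longlonglongrightarrow> y'"
    unfolding limit_relation_def by blast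
  then show "(x + x', y + y') \<in> limit_relation R"
    by (intro limit_relationI[of "\<lambda>n. u n + u' n" "\<lambda>n. v n + v' n"] add tendsto_add)
next
  assume est: "\<And>x y. (x, y) \<in> R \<Longrightarrow> norm y \<le> C * norm x" and "(x, y) \<in> limit_relation R"
  then obtain u v where uv: "\<And>n. (u n, v n) \<in> R" "u \<longlonglongrightarrow> x" "v \<longlonglongrightarrow> y"
    unfolding limit_relation_def by blast
  show "norm y \<le> C * norm x"
    by (rule LIMSEQ_le[OF tendsto_norm[OF uv(3)] tendsto_mult_left[OF tendsto_norm[OF uv(2)]]])
      (use est[OF uv(1)] in auto)
next
  assume A: "bounded_linear A" and B: "bounded_linear B"
    and inv: "\<And>x y. (x, y) \<in> R \<Longrightarrow> (A x, B y) \<in> R" and "(x, y) \<in> limit_relation R"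
  then obtain u v where uv: "\<And>n. (u n, v n) \<in> R" "u \<longlonglongrightarrow> x" "v \<longlonglongrightarrow> y"
    unfolding limit_relation_def by blast
  then show "(A x, B y) \<in> limit_relation R"
    by (intro limit_relationI[of "\<lambda>n. A (u n)" "\<lambda>n. B (v n)"] inv
        bounded_linear.tendsto[OF A] bounded_linear.tendsto[OF B])
qed

lemma bounded_linear_scaleC: "bounded_linear (scaleC c :: 'a::complex_inner \<Rightarrow> 'a)"
proof (rule bounded_linear_intro[of _ "cmod c"])
  show "scaleC c (r *\<^sub>R x) = r *\<^sub>R scaleC c x" for r and x :: 'a
    by (simp add: scaleC_scaleC mult.commute flip: scaleC_of_real)
qed (auto simp: scaleC_add_right norm_scaleC mult.commute)

text \<open>The limit relation inherits linearity, both estimates and the invariance. Density makes it total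
  in both directions, so it is the graph of an operator with bounded inverse, and invariance is the
  intertwining relation.\<close>

lemma similar_tuples_of_relation:
  fixes R :: "('a::complex_hilbert \<times> 'b::complex_hilbert) set"
    and T :: "'m::finite \<Rightarrow> 'a \<Rightarrow> 'a" and S :: "'m \<Rightarrow> 'b \<Rightarrow> 'b"
  assumes add: "\<And>x y x' y'. (x, y) \<in> R \<Longrightarrow> (x', y') \<in> R \<Longrightarrow> (x + x', y + y') \<in> R"
    and scale: "\<And>x y c. (x, y) \<in> R \<Longrightarrow> (scaleC c x, scaleC c y) \<in> R"
    and upper: "\<And>x y. (x, y) \<in> R \<Longrightarrow> norm y \<le> C * norm x"
    and lower: "\<And>x y. (x, y) \<in> R \<Longrightarrow> norm x \<le> C' * norm y"
    and dense: "closure (fst ` R) = UNIV" "closure (snd ` R) = UNIV"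
    and T: "\<And>i. bounded_clinear (T i)" and S: "\<And>i. bounded_clinear (S i)"
    and inv: "\<And>i x y. (x, y) \<in> R \<Longrightarrow> (T i x, S i y) \<in> R"
  shows "similar_tuples T S"
proof -
  let ?G = "limit_relation R" and ?H = "limit_relation (R\<inverse>)"
  have dense': "closure (fst ` (R\<inverse>)) = UNIV"
    using dense(2) by (simp add: image_iff fst_eq_Domain snd_eq_Range)
  note cl = limit_relation_closed
  have "\<exists>X. bounded_clinear X \<and> (\<forall>x y. (x, y) \<in> ?G \<longleftrightarrow> y = X x)"
  proof (rule graph_operator)
    show "\<exists>y. (x, y) \<in> ?G" for x by (rule limit_relation_total[OF add scale upper dense(1)])
    show "(x + x', y + y') \<in> ?G" if "(x, y) \<in> ?G" "(x', y') \<in> ?G" for x y x' y'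
      by (rule cl(1)[OF add that])
    show "(scaleC c x, scaleC c y) \<in> ?G" if "(x, y) \<in> ?G" for x y c
      by (rule cl(3)[OF bounded_linear_scaleC bounded_linear_scaleC scale that])
    show "norm y \<le> C * norm x" if "(x, y) \<in> ?G" for x y
      by (rule cl(2)[OF upper that])
  qed
  then obtain X where X: "bounded_clinear X" "\<And>x y. (x, y) \<in> ?G \<longleftrightarrow> y = X x" by auto
  have "\<exists>Y. bounded_clinear Y \<and> (\<forall>y x. (y, x) \<in> ?H \<longleftrightarrow> x = Y y)"
  proof (rule graph_operator)
    have add': "\<And>x y x' y'. (x, y) \<in> R\<inverse> \<Longrightarrow> (x', y') \<in> R\<inverse> \<Longrightarrow> (x + x', y + y') \<in> R\<inverse>"
      and scale': "\<And>x y c. (x, y) \<in> R\<inverse> \<Longrightarrow> (scaleC c x, scaleC c y) \<in> R\<inverse>"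
      and lower': "\<And>x y. (x, y) \<in> R\<inverse> \<Longrightarrow> norm y \<le> C' * norm x"
      using add scale lower by auto
    show "\<exists>y. (x, y) \<in> ?H" for x by (rule limit_relation_total[OF add' scale' lower' dense'])
    show "(x + x', y + y') \<in> ?H" if "(x, y) \<in> ?H" "(x', y') \<in> ?H" for x y x' y'
      by (rule cl(1)[OF add' that])
    show "(scaleC c x, scaleC c y) \<in> ?H" if "(x, y) \<in> ?H" for x y c
      by (rule cl(3)[OF bounded_linear_scaleC bounded_linear_scaleC scale' that])
    show "norm y \<le> C' * norm x" if "(x, y) \<in> ?H" for x y
      by (rule cl(2)[OF lower' that])
  qed
  then obtain Y where Y: "bounded_clinear Y" "\<And>y x. (y, x) \<in> ?H \<longleftrightarrow> x = Y y" by auto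
  have YX: "x = Y (X x)" for x using X(2) Y(2) limit_relation_converse[of "X x" x R] by simp
  have XY: "y = X (Y y)" for y using X(2) Y(2) limit_relation_converse[of y "Y y" R] by simp
  have bij: "bij X" by (rule bijI') (metis YX XY)+
  have "inv X = Y" by (rule inv_equality) (simp_all flip: YX XY)
  moreover have "X \<circ> T i = S i \<circ> X" for i
  proof
    fix x
    have "(T i x, S i (X x)) \<in> ?G"
      using X(2) bounded_clinear_bounded[OF T] bounded_clinear_bounded[OF S]
      by (intro cl(3)[OF _ _ inv]) auto
    then show "(X \<circ> T i) x = (S i \<circ> X) x" using X(2) by simp
  qed
  ultimately show ?thesis unfolding similar_tuples_def using X(1) Y(1) bij by blast
qed

text \<open>Positive definiteness of the kernel \<open>\<langle>w, v\<rangle>\<^sup>i\<close>, by induction on \<open>i\<close>: another factor \<open>\<langle>w, v\<rangle>\<close> replaces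
  the weights \<open>\<alpha> w\<close> by the weights \<open>\<alpha> w w\<^sub>k\<close> and sums over \<open>k\<close>.\<close>

lemma hprod_power_positive_definite:
  fixes F :: "(complex^'m) set"
  shows "\<exists>r\<ge>0. (\<Sum>w\<in>F. \<Sum>v\<in>F. \<alpha> w * cnj (\<alpha> v) * hprod w v ^ i) = complex_of_real r"
proof (induction i arbitrary: \<alpha>)
  case 0
  have "(\<Sum>w\<in>F. \<Sum>v\<in>F. \<alpha> w * cnj (\<alpha> v) * hprod w v ^ 0) = (\<Sum>w\<in>F. \<alpha> w) * cnj (\<Sum>w\<in>F. \<alpha> w)"
    by (simp add: sum_product)
  then show ?case
    by (intro exI[of _ "(cmod (\<Sum>w\<in>F. \<alpha> w))\<^sup>2"]) (simp add: complex_norm_square del: of_real_power)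
next
  case (Suc i)
  have "\<forall>k. \<exists>r\<ge>0. (\<Sum>w\<in>F. \<Sum>v\<in>F. (\<alpha> w * w $ k) * cnj (\<alpha> v * v $ k) * hprod w v ^ i) = complex_of_real r"
    using Suc.IH[of "\<lambda>w. \<alpha> w * w $ _"] by blast
  then obtain r where r: "\<And>k. r k \<ge> 0" "\<And>k. (\<Sum>w\<in>F. \<Sum>v\<in>F. (\<alpha> w * w $ k) * cnj (\<alpha> v * v $ k)
      * hprod w v ^ i) = complex_of_real (r k)" by metis
  have expand: "hprod w v ^ Suc i = (\<Sum>k\<in>UNIV. w $ k * cnj (v $ k)) * hprod w v ^ i" for w v :: "complex^'m"
    by (simp flip: hprod_def)
  have "(\<Sum>w\<in>F. \<Sum>v\<in>F. \<alpha> w * cnj (\<alpha> v) * hprod w v ^ Suc i)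
      = (\<Sum>w\<in>F. \<Sum>v\<in>F. \<Sum>k\<in>UNIV. (\<alpha> w * w $ k) * cnj (\<alpha> v * v $ k) * hprod w v ^ i)"
    unfolding expand by (simp add: sum_distrib_left sum_distrib_right mult_ac)
  also have "\<dots> = (\<Sum>k\<in>UNIV. \<Sum>w\<in>F. \<Sum>v\<in>F. (\<alpha> w * w $ k) * cnj (\<alpha> v * v $ k) * hprod w v ^ i)"
    by (subst sum.swap[of _ F UNIV], intro sum.cong refl) (rule sum.swap)
  also have "\<dots> = complex_of_real (\<Sum>k\<in>UNIV. r k)" by (simp only: r(2) of_real_sum)
  finally show ?case using r(1) by (intro exI[of _ "\<Sum>k\<in>UNIV. r k"]) (simp add: sum_nonneg)
qed

context radial_kernel_space
begin

lemma norm_eigensection_combination_sums: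
  assumes F: "F \<subseteq> ball 0 1"
  shows "(\<lambda>i. a i * Re (\<Sum>w\<in>F. \<Sum>v\<in>F. \<alpha> w * cnj (\<alpha> v) * hprod w v ^ i))
    sums (norm (\<Sum>w\<in>F. scaleC (\<alpha> w) (eigensection w)))\<^sup>2"
proof -
  let ?x = "\<Sum>w\<in>F. scaleC (\<alpha> w) (eigensection w)"
  have "(\<lambda>i. \<Sum>w\<in>F. \<Sum>v\<in>F. \<alpha> w * cnj (\<alpha> v) * (of_real (a i) * hprod w v ^ i))
      sums (\<Sum>w\<in>F. \<Sum>v\<in>F. \<alpha> w * cnj (\<alpha> v) * cinner (eigensection w) (eigensection v))"
    using F by (intro sums_sum sums_mult cinner_eigensection_sums) auto
  also have "(\<Sum>w\<in>F. \<Sum>v\<in>F. \<alpha> w * cnj (\<alpha> v) * cinner (eigensection w) (eigensection v)) = cinner ?x ?x"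
    unfolding cinner_sum_left cinner_scaleC_left unfolding cinner_sum_right cinner_scaleC_right
    by (simp add: sum_distrib_left mult.assoc)
  finally have "(\<lambda>i. Re (\<Sum>w\<in>F. \<Sum>v\<in>F. \<alpha> w * cnj (\<alpha> v) * (of_real (a i) * hprod w v ^ i)))
      sums (norm ?x)\<^sup>2"
    unfolding norm_sq_cinner by (rule sums_Re)
  moreover have "Re (\<Sum>w\<in>F. \<Sum>v\<in>F. \<alpha> w * cnj (\<alpha> v) * (of_real (a i) * hprod w v ^ i))
      = a i * Re (\<Sum>w\<in>F. \<Sum>v\<in>F. \<alpha> w * cnj (\<alpha> v) * hprod w v ^ i)" for i
  proof -
    have "(\<Sum>w\<in>F. \<Sum>v\<in>F. \<alpha> w * cnj (\<alpha> v) * (of_real (a i) * hprod w v ^ i))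
        = of_real (a i) * (\<Sum>w\<in>F. \<Sum>v\<in>F. \<alpha> w * cnj (\<alpha> v) * hprod w v ^ i)"
      by (simp add: sum_distrib_left mult_ac)
    then show ?thesis by simp
  qed
  ultimately show ?thesis by simp
qed

end

text \<open>Both squared norms are sums of the same nonnegative quantities, weighted by the coefficients of the
  two kernels.\<close>

lemma norm_combination_le:
  assumes A: "radial_kernel_space a K ev T" and B: "radial_kernel_space b K' ev' T'"
    and le: "\<And>i. a i \<le> L * b i" and F: "F \<subseteq> ball 0 1" and L: "L \<ge> 0"
  shows "norm (\<Sum>w\<in>F. scaleC (\<alpha> w) (radial_kernel_space.eigensection K ev w))
    \<le> sqrt L * norm (\<Sum>w\<in>F. scaleC (\<alpha> w) (radial_kernel_space.eigensection K' ev' w))"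
    (is "norm ?x \<le> sqrt L * norm ?y")
proof -
  let ?p = "\<lambda>i. Re (\<Sum>w\<in>F. \<Sum>v\<in>F. \<alpha> w * cnj (\<alpha> v) * hprod w v ^ i)"
  have "a i * ?p i \<le> L * (b i * ?p i)" for i
  proof -
    obtain r where "r \<ge> 0" "(\<Sum>w\<in>F. \<Sum>v\<in>F. \<alpha> w * cnj (\<alpha> v) * hprod w v ^ i) = complex_of_real r"
      using hprod_power_positive_definite[where F = F and \<alpha> = \<alpha> and i = i] by blast
    then have "?p i \<ge> 0" by (simp only: Re_complex_of_real)
    from mult_right_mono[OF le this] show ?thesis by (simp add: mult.assoc)
  qed
  then have "(norm ?x)\<^sup>2 \<le> L * (norm ?y)\<^sup>2"
    using radial_kernel_space.norm_eigensection_combination_sums[OF A F, of \<alpha>]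
      sums_mult[OF radial_kernel_space.norm_eigensection_combination_sums[OF B F, of \<alpha>], of L]
    by (rule sums_le)
  then have "sqrt ((norm ?x)\<^sup>2) \<le> sqrt (L * (norm ?y)\<^sup>2)" by (rule real_sqrt_le_mono)
  then show ?thesis by (simp add: real_sqrt_mult)
qed

lemma sum_scaleC_union:
  fixes f :: "'i \<Rightarrow> 'a::complex_inner"
  assumes "finite F" "finite F'"
  shows "(\<Sum>w\<in>F \<union> F'. scaleC ((if w \<in> F then \<alpha> w else 0) + (if w \<in> F' then \<beta> w else 0)) (f w))
    = (\<Sum>w\<in>F. scaleC (\<alpha> w) (f w)) + (\<Sum>w\<in>F'. scaleC (\<beta> w) (f w))"
proof -
  have "(\<Sum>w\<in>F \<union> F'. scaleC (if w \<in> F then \<alpha> w else 0) (f w)) = (\<Sum>w\<in>F. scaleC (\<alpha> w) (f w))"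
    using assms by (intro sum.mono_neutral_cong_right) auto
  moreover have "(\<Sum>w\<in>F \<union> F'. scaleC (if w \<in> F' then \<beta> w else 0) (f w)) = (\<Sum>w\<in>F'. scaleC (\<beta> w) (f w))"
    using assms by (intro sum.mono_neutral_cong_right) auto
  ultimately show ?thesis by (simp add: scaleC_add_left sum.distrib)
qed

text \<open>The span of the pairs of eigensections at the same point is a relation between the two spaces that
  is invariant under both tuples and, by comparison of the coefficients, bounded in both directions.\<close>

lemma similar_of_comparable_coefficients:
  fixes T :: "'m::finite \<Rightarrow> 'h::complex_hilbert \<Rightarrow> 'h" and S :: "'m \<Rightarrow> 'k::complex_hilbert \<Rightarrow> 'k"
  assumes TT: "radial_kernel_space b K' ev' T" and SS: "radial_kernel_space a K ev S"
    and upper: "\<And>i. a i \<le> L * b i" and lower: "\<And>i. l * b i \<le> a i" and l: "l > 0"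
  shows "similar_tuples T S"
proof -
  interpret T: radial_kernel_space b K' ev' T by (rule TT)
  interpret S: radial_kernel_space a K ev S by (rule SS)
  define R where "R = {((\<Sum>w\<in>F. scaleC (\<alpha> w) (T.eigensection w)), (\<Sum>w\<in>F. scaleC (\<alpha> w) (S.eigensection w)))
    |F \<alpha>. finite F \<and> F \<subseteq> ball 0 1}"
  have "0 < L * b 0" using upper[of 0] S.a_pos[of 0] by linarith
  then have L: "L > 0" using T.a_pos[of 0] by (simp add: zero_less_mult_iff)
  have add: "(x + x', y + y') \<in> R" if xy: "(x, y) \<in> R" and xy': "(x', y') \<in> R" for x y x' y'
  proof -
    obtain F \<alpha> where F: "finite F" "F \<subseteq> ball 0 1" "x = (\<Sum>w\<in>F. scaleC (\<alpha> w) (T.eigensection w))"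
      "y = (\<Sum>w\<in>F. scaleC (\<alpha> w) (S.eigensection w))" using xy by (auto simp: R_def)
    obtain F' \<beta> where F': "finite F'" "F' \<subseteq> ball 0 1" "x' = (\<Sum>w\<in>F'. scaleC (\<beta> w) (T.eigensection w))"
      "y' = (\<Sum>w\<in>F'. scaleC (\<beta> w) (S.eigensection w))" using xy' by (auto simp: R_def)
    define \<delta> where "\<delta> w = (if w \<in> F then \<alpha> w else 0) + (if w \<in> F' then \<beta> w else 0)" for w
    have "(\<Sum>w\<in>F \<union> F'. scaleC (\<delta> w) (T.eigensection w)) = x + x'"
      "(\<Sum>w\<in>F \<union> F'. scaleC (\<delta> w) (S.eigensection w)) = y + y'"
      unfolding \<delta>_def F(3,4) F'(3,4) by (rule sum_scaleC_union[OF F(1) F'(1)])+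
    then show ?thesis
      unfolding R_def mem_Collect_eq using F F' by (intro exI[of _ "F \<union> F'"] exI[of _ \<delta>]) auto
  qed
  have scale: "(scaleC c x, scaleC c y) \<in> R" if xy: "(x, y) \<in> R" for x y c
  proof -
    obtain F \<alpha> where F: "finite F" "F \<subseteq> ball 0 1" "x = (\<Sum>w\<in>F. scaleC (\<alpha> w) (T.eigensection w))"
      "y = (\<Sum>w\<in>F. scaleC (\<alpha> w) (S.eigensection w))" using xy by (auto simp: R_def)
    then show ?thesis
      unfolding R_def mem_Collect_eq
      by (intro exI[of _ F] exI[of _ "\<lambda>w. c * \<alpha> w"])
        (simp add: complex_vector.scale_sum_right scaleC_scaleC)
  qed
  have inv: "(T i x, S i y) \<in> R" if xy: "(x, y) \<in> R" for x y i
  proof -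
    obtain F \<alpha> where F: "finite F" "F \<subseteq> ball 0 1" "x = (\<Sum>w\<in>F. scaleC (\<alpha> w) (T.eigensection w))"
      "y = (\<Sum>w\<in>F. scaleC (\<alpha> w) (S.eigensection w))" using xy by (auto simp: R_def)
    have "T i x = (\<Sum>w\<in>F. scaleC (\<alpha> w * w $ i) (T.eigensection w))"
      unfolding F(3) bounded_clinear_sum[OF T.bounded_clinear_T]
      using F(2) by (intro sum.cong refl)
        (auto simp: bounded_clinear_scaleC[OF T.bounded_clinear_T] T.T_eigensection scaleC_scaleC)
    moreover have "S i y = (\<Sum>w\<in>F. scaleC (\<alpha> w * w $ i) (S.eigensection w))"
      unfolding F(4) bounded_clinear_sum[OF S.bounded_clinear_T]
      using F(2) by (intro sum.cong refl)
        (auto simp: bounded_clinear_scaleC[OF S.bounded_clinear_T] S.T_eigensection scaleC_scaleC)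
    ultimately show ?thesis
      unfolding R_def mem_Collect_eq using F(1,2)
      by (intro exI[of _ F] exI[of _ "\<lambda>w. \<alpha> w * w $ i"]) simp
  qed
  have eig: "(T.eigensection w, S.eigensection w) \<in> R" if "w \<in> ball 0 1" for w
    unfolding R_def mem_Collect_eq
    by (intro exI[of _ "{w}"] exI[of _ "\<lambda>_. 1"]) (use that in simp)
  have zero: "(0, 0) \<in> R"
    unfolding R_def mem_Collect_eq by (intro exI[of _ "{}"] exI[of _ "\<lambda>_. 1"]) simp
  have dense: "closure (fst ` R) = UNIV"
  proof (rule T.eigensections_dense)
    show "complex_vector.subspace (fst ` R)"
      unfolding complex_vector.subspace_def
      by (intro conjI ballI allI; (clarify, simp)?) (use zero add scale in \<open>force+\<close>)
    show "T.eigensection w \<in> fst ` R" if "w \<in> ball 0 1" for w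
      using eig[OF that] by force
  qed
  have dense': "closure (snd ` R) = UNIV"
  proof (rule S.eigensections_dense)
    show "complex_vector.subspace (snd ` R)"
      unfolding complex_vector.subspace_def
      by (intro conjI ballI allI; (clarify, simp)?) (use zero add scale in \<open>force+\<close>)
    show "S.eigensection w \<in> snd ` R" if "w \<in> ball 0 1" for w
      using eig[OF that] by force
  qed
  have up: "norm y \<le> sqrt L * norm x" if "(x, y) \<in> R" for x y
    using that norm_combination_le[OF SS TT upper] L by (auto simp: R_def)
  have "b i \<le> (1 / l) * a i" for i using lower[of i] l by (simp add: field_simps)
  then have low: "norm x \<le> sqrt (1 / l) * norm y" if "(x, y) \<in> R" for x y
    using that norm_combination_le[OF TT SS, of "1 / l"] l by (auto simp: R_def)
  show ?thesis
    by (rule similar_tuples_of_relation[OF add scale up low dense dense' T.bounded_clinear_T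
          S.bounded_clinear_T inv])
qed

section \<open>Curvature and similarity\<close>

text \<open>Two spaces whose kernels have a quotient with nonnegative coefficients; here \<open>c\<close> are the
  coefficients of the quotient of the kernel of \<open>S\<close> by the kernel of \<open>T\<close>.\<close>

locale kernel_quotient =
  T: radial_kernel_space b K' ev' T + S: radial_kernel_space a K ev S + C: nonneg_power_series c
  for b :: "nat \<Rightarrow> real" and K' :: "complex ^ 'm::finite \<Rightarrow> complex ^ 'm \<Rightarrow> complex"
    and ev' :: "'h::complex_hilbert \<Rightarrow> complex ^ 'm \<Rightarrow> complex" and T :: "'m \<Rightarrow> 'h \<Rightarrow> 'h"
    and a :: "nat \<Rightarrow> real" and K :: "complex ^ 'm \<Rightarrow> complex ^ 'm \<Rightarrow> complex"
    and ev :: "'k::complex_hilbert \<Rightarrow> complex ^ 'm \<Rightarrow> complex" and S :: "'m \<Rightarrow> 'k \<Rightarrow> 'k"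
    and c :: "nat \<Rightarrow> real" +
  assumes factor: "\<And>x. 0 \<le> x \<Longrightarrow> x < 1 \<Longrightarrow> S.real_series x = C.real_series x * T.real_series x"
begin

abbreviation potential :: "complex^'m \<Rightarrow> real"
  where "potential w \<equiv> ln (C.real_series ((norm w)\<^sup>2))"

lemma bounded_of_positive_radii:
  assumes "\<And>x. 0 < x \<Longrightarrow> x < 1 \<Longrightarrow> C.real_series x \<le> L"
  shows "0 \<le> x \<Longrightarrow> x < 1 \<Longrightarrow> C.real_series x \<le> L"
  using assms[of x] assms[of "1 / 2"] C.real_series_mono[of 0 "1 / 2"] by (cases "x = 0") auto

lemma sqrt_disc:
  assumes "0 < x" "x < 1"
  shows "cball 0 (sqrt x) \<subseteq> ball (0::complex) 1"
proof
  fix t :: complex assume "t \<in> cball 0 (sqrt x)"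
  then have "cmod t \<le> sqrt x" by simp
  also have "\<dots> < 1" using assms by simp
  finally show "t \<in> ball 0 1" by simp
qed

lemma slice_norm: "norm (t *s (axis k 1 :: complex^'m)) = cmod t"
  by (simp add: norm_vector_smult norm_axis_1)

text \<open>A similarity maps eigensections to eigensections up to a holomorphic factor \<open>\<phi>\<close>, and its
  boundedness says that \<open>\<bar>\<phi>\<bar>\<^sup>2\<close> times the quotient of the kernels is bounded. By the maximum
  principle \<open>\<bar>\<phi>\<bar>\<close> is at least \<open>\<bar>\<phi> 0\<bar>\<close> somewhere on every sphere, and the quotient is radial.\<close>

lemma similar_imp_quotient_bounded:
  assumes "similar_tuples T S"
  shows "\<exists>L. \<forall>x. 0 \<le> x \<longrightarrow> x < 1 \<longrightarrow> C.real_series x \<le> L"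
proof -
  obtain X where X: "bounded_clinear X" "bij X" "\<And>i. X \<circ> T i = S i \<circ> X"
    using assms unfolding similar_tuples_def by blast
  define \<phi> where "\<phi> w = cinner (X (T.eigensection w)) (S.eigensection 0) / of_real (a 0)" for w
  have \<phi>: "X (T.eigensection w) = scaleC (\<phi> w) (S.eigensection w)" if w: "w \<in> ball 0 1" for w
  proof -
    have "S i (X (T.eigensection w)) = scaleC (w $ i) (X (T.eigensection w))" for i
      using fun_cong[OF X(3)[of i], of "T.eigensection w"]
      by (simp add: T.T_eigensection[OF w] bounded_clinear_scaleC[OF X(1)])
    then have "X (T.eigensection w) \<in> joint_kernel S w" by (simp add: joint_kernel_def)
    then obtain d where d: "X (T.eigensection w) = scaleC d (S.eigensection w)"
      by (rule S.joint_kernel_multiple[OF w])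
    have "\<phi> w = d"
      using S.a_pos[of 0] by (simp add: \<phi>_def d cinner_scaleC_left S.cinner_eigensection_0[OF w])
    with d show ?thesis by simp
  qed
  have "bounded_linear (\<lambda>x. cinner (X x) (S.eigensection 0) / of_real (a 0))"
    by (rule bounded_linear_compose[OF bounded_linear_divide
          bounded_linear_compose[OF bounded_linear_cinner_left bounded_clinear_bounded[OF X(1)]]])
  then have "bounded_clinear (\<lambda>x. cinner (X x) (S.eigensection 0) / of_real (a 0))"
    by (simp add: bounded_clinear_def bounded_clinear_scaleC[OF X(1)] cinner_scaleC_left scaleC_complex_def)
  then have hol: "holomorphic_vec_on \<phi> (ball 0 1)"
    unfolding \<phi>_def[abs_def] by (rule holomorphic_vec_on_clinear[OF T.eigensection_holomorphic])
  have "X 0 = 0" using X(1) bounded_clinear_bounded linear_simps(3) by blast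
  then have "X (T.eigensection 0) \<noteq> 0"
    using T.eigensection_nonzero[of 0] X(2) by (metis bij_is_inj centre_in_ball injD zero_less_one)
  then have \<phi>0: "\<phi> 0 \<noteq> 0" using \<phi>[of 0] by auto
  obtain k where k: "\<And>x. norm (X x) \<le> norm x * k"
    using bounded_linear.bounded[OF bounded_clinear_bounded[OF X(1)]] by blast
  have "C.real_series x \<le> k\<^sup>2 / (cmod (\<phi> 0))\<^sup>2" if x: "0 < x" "x < 1" for x
  proof -
    \<comment> \<open>any coordinate axis serves\<close>
    define e :: "complex^'m" where "e = axis undefined 1"
    define f where "f t = \<phi> (0 + t *s e)" for t
    have "f holomorphic_on cball 0 (sqrt x)"
      unfolding f_def
    proof (rule holomorphic_vec_slice_on[OF hol])
      show "0 + t *s e \<in> ball 0 1" if "t \<in> cball 0 (sqrt x)" for t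
        using subsetD[OF sqrt_disc[OF x] that] by (simp add: e_def slice_norm)
    qed
    then obtain \<zeta> where \<zeta>: "cmod \<zeta> = sqrt x" "cmod (f 0) \<le> cmod (f \<zeta>)"
      using maximum_modulus_sphere[of f "sqrt x"] x by auto
    define w where "w = \<zeta> *s e"
    have nw: "(norm w)\<^sup>2 = x" using \<zeta> x by (simp add: w_def e_def slice_norm)
    have w: "w \<in> ball 0 1" using \<zeta> x by (simp add: w_def e_def slice_norm)
    have \<phi>w: "cmod (\<phi> 0) \<le> cmod (\<phi> w)" using \<zeta>(2) by (simp add: f_def w_def)
    have Tx: "T.real_series x > 0" and Sx: "S.real_series x > 0"
      using T.real_series_pos[of x] S.real_series_pos[of x] x by auto
    have "(cmod (\<phi> 0))\<^sup>2 * S.real_series x \<le> (cmod (\<phi> w))\<^sup>2 * S.real_series x"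
      using \<phi>w Sx by (intro mult_right_mono power_mono) auto
    also have "\<dots> = (norm (X (T.eigensection w)))\<^sup>2"
      using S.norm_eigensection[OF w] by (simp add: \<phi>[OF w] norm_scaleC power_mult_distrib nw)
    also have "\<dots> \<le> (norm (T.eigensection w) * k)\<^sup>2" by (intro power_mono k) simp
    also have "\<dots> = T.real_series x * k\<^sup>2"
      using T.norm_eigensection[OF w] by (simp add: power_mult_distrib nw)
    finally have "((cmod (\<phi> 0))\<^sup>2 * C.real_series x) * T.real_series x \<le> k\<^sup>2 * T.real_series x"
      using factor[of x] x by (simp add: mult_ac)
    then have "(cmod (\<phi> 0))\<^sup>2 * C.real_series x \<le> k\<^sup>2" using Tx by simp
    then show ?thesis using \<phi>0 by (simp add: field_simps)
  qed
  from bounded_of_positive_radii[OF this] show ?thesis by blast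
qed

lemma curvature_difference:
  assumes w: "w \<in> ball 0 1"
  shows "curvature (ball 0 1) T w u v - curvature (ball 0 1) S w u v
    = form11 (\<lambda>i j. mixed_d i j potential w) u v"
proof -
  have "mixed_d i j (\<lambda>w. ln (S.real_series ((norm w)\<^sup>2))) w
      = mixed_d i j potential w + mixed_d i j (\<lambda>w. ln (T.real_series ((norm w)\<^sup>2))) w" for i j
  proof -
    have "mixed_d i j (\<lambda>w. ln (S.real_series ((norm w)\<^sup>2))) w
        = mixed_d i j (\<lambda>w. 1 * potential w + 1 * ln (T.real_series ((norm w)\<^sup>2))) w"
    proof (rule mixed_d_cong[OF open_ball w])
      fix z :: "complex^'m" assume "z \<in> ball 0 1"
      then have z: "0 \<le> (norm z)\<^sup>2" "(norm z)\<^sup>2 < 1" by (auto simp: abs_square_less_1)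
      then show "ln (S.real_series ((norm z)\<^sup>2)) = 1 * potential z + 1 * ln (T.real_series ((norm z)\<^sup>2))"
        using C.real_series_pos[OF z] T.real_series_pos[OF z] by (simp add: factor[OF z] ln_mult)
    qed
    also have "\<dots> = of_real 1 * mixed_d i j potential w
        + of_real 1 * mixed_d i j (\<lambda>w. ln (T.real_series ((norm w)\<^sup>2))) w"
      by (rule twice_differentiable_linear_combination(2)[OF C.ln_real_series_twice_differentiable
            T.ln_real_series_twice_differentiable open_ball w])
    finally show ?thesis by simp
  qed
  then show ?thesis
    by (simp add: T.curvature_eq[OF w] S.curvature_eq[OF w] form11_diff)
qed

lemma bounded_imp_potential:
  assumes L: "\<And>x. 0 \<le> x \<Longrightarrow> x < 1 \<Longrightarrow> C.real_series x \<le> L"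
  shows "bounded (potential ` ball 0 1)"
  unfolding bounded_iff
proof (intro exI ballI)
  fix y assume "y \<in> potential ` ball 0 1"
  then obtain w where w: "w \<in> ball 0 1" and y: "y = potential w" by blast
  have x: "0 \<le> (norm w)\<^sup>2" "(norm w)\<^sup>2 < 1" using w by (auto simp: abs_square_less_1)
  have "ln (C.real_series 0) \<le> y" "y \<le> ln L"
    using C.real_series_mono[of 0 "(norm w)\<^sup>2"] C.real_series_pos[of 0] C.real_series_pos[OF x] L[OF x] x
    by (auto simp: y intro!: ln_mono)
  then show "norm y \<le> \<bar>ln (C.real_series 0)\<bar> + \<bar>ln L\<bar>"
    unfolding real_norm_def by linarith
qed

text \<open>Conversely, a bounded \<open>\<psi>\<close> with the same Levi form as the potential differs from it, on the
  slice through a coordinate axis, by the real part of a holomorphic function. The maximum principle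
  for that function bounds the potential, which is radial, on every circle.\<close>

lemma potential_imp_quotient_bounded:
  assumes bdd: "bounded (\<psi> ` ball 0 1)" and tw: "twice_differentiable_on \<psi> (ball 0 1)"
    and curv: "\<And>w u v. w \<in> ball 0 1 \<Longrightarrow>
      curvature (ball 0 1) T w u v - curvature (ball 0 1) S w u v
        = form11 (\<lambda>i j. mixed_d i j \<psi> w) u v"
  shows "\<exists>L. \<forall>x. 0 \<le> x \<longrightarrow> x < 1 \<longrightarrow> C.real_series x \<le> L"
proof -
  \<comment> \<open>any coordinate axis serves\<close>
  define k :: 'm where "k = undefined"
  define h where "h w = 1 * \<psi> w + (-1) * potential w" for w
  have h: "twice_differentiable_on h (ball 0 1)"
    unfolding h_def[abs_def]
    by (rule twice_differentiable_linear_combination(1)[OF tw C.ln_real_series_twice_differentiable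
          open_ball])
  have "mixed_d k k h w = 0" if w: "w \<in> ball 0 1" for w
  proof -
    have "mixed_d k k \<psi> w = mixed_d k k potential w"
      by (rule form11_diagonal[of "\<lambda>i j. mixed_d i j \<psi> w" "\<lambda>i j. mixed_d i j potential w"])
        (simp flip: curv[OF w] curvature_difference[OF w])
    moreover have "mixed_d k k h w = of_real 1 * mixed_d k k \<psi> w + of_real (-1) * mixed_d k k potential w"
      unfolding h_def[abs_def]
      by (rule twice_differentiable_linear_combination(2)[OF tw C.ln_real_series_twice_differentiable
          open_ball w])
    ultimately show ?thesis by simp
  qed
  then obtain G where G: "G holomorphic_on ball 0 1"
    and hG: "\<And>t. t \<in> ball 0 1 \<Longrightarrow> h (t *s axis k 1) = Re (G t)"
    using slice_harmonic_is_real_part[OF h] by metis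
  obtain M where "\<forall>y\<in>\<psi> ` ball 0 1. norm y \<le> M" using bdd unfolding bounded_iff by blast
  then have M: "\<And>w. w \<in> ball 0 1 \<Longrightarrow> \<bar>\<psi> w\<bar> \<le> M" by simp
  have "C.real_series x \<le> exp (M - Re (G 0))" if x: "0 < x" "x < 1" for x
  proof -
    have "(\<lambda>t. exp (G t)) holomorphic_on cball 0 (sqrt x)"
      by (intro holomorphic_intros holomorphic_on_subset[OF G] sqrt_disc x)
    then obtain \<zeta> where \<zeta>: "cmod \<zeta> = sqrt x" "cmod (exp (G 0)) \<le> cmod (exp (G \<zeta>))"
      using maximum_modulus_sphere[of "\<lambda>t. exp (G t)" "sqrt x"] x by auto
    have \<zeta>b: "\<zeta> \<in> ball 0 1" using \<zeta> x by simp
    then have mem: "\<zeta> *s axis k 1 \<in> ball 0 1" by (simp add: slice_norm)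
    have "Re (G 0) \<le> h (\<zeta> *s axis k 1)" using \<zeta>(2) hG[OF \<zeta>b] by simp
    also have "\<dots> \<le> M - ln (C.real_series x)"
      using M[OF mem] \<zeta>(1) x by (simp add: h_def slice_norm abs_le_iff)
    finally have "ln (C.real_series x) \<le> M - Re (G 0)" by simp
    then show ?thesis using C.real_series_pos[of x] x by (metis exp_le_cancel_iff exp_ln less_imp_le)
  qed
  from bounded_of_positive_radii[OF this] show ?thesis by blast
qed

end

theorem theorem1p3:
  fixes n :: nat
    and a :: "nat \<Rightarrow> real"
    and K :: "complex ^ 'm::finite \<Rightarrow> complex ^ 'm \<Rightarrow> complex"
    and ev\<^sub>T :: "'h::complex_hilbert \<Rightarrow> complex ^ 'm \<Rightarrow> complex"
    and ev\<^sub>S :: "'k::complex_hilbert \<Rightarrow> complex ^ 'm \<Rightarrow> complex"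
    and T :: "'m \<Rightarrow> 'h \<Rightarrow> 'h"
    and S :: "'m \<Rightarrow> 'k \<Rightarrow> 'k"
  assumes "n \<ge> 1"
    and "\<And>i. a i > 0"
    and "\<And>z w. z \<in> ball 0 1 \<Longrightarrow> w \<in> ball 0 1 \<Longrightarrow>
           (\<lambda>i. complex_of_real (a i) * hprod z w ^ i) sums K z w"
    and "holomorphic_rkhs (ball 0 1) ev\<^sub>T (\<lambda>z w. (1 - hprod z w) powi (- int n))"
    and "holomorphic_rkhs (ball 0 1) ev\<^sub>S K"
    and "adjoint_multiplication_tuple (ball 0 1) ev\<^sub>T T"
    and "adjoint_multiplication_tuple (ball 0 1) ev\<^sub>S S"
    and "cowen_douglas_1 (ball 0 1) T"
    and "cowen_douglas_1 (ball 0 1) S"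
    and "hypercontraction n S"
  shows "similar_tuples T S \<longleftrightarrow>
    (\<exists>\<psi> :: complex ^ 'm \<Rightarrow> real.
       bounded (\<psi> ` ball 0 1) \<and> plurisubharmonic_on \<psi> (ball 0 1) \<and>
       twice_differentiable_on \<psi> (ball 0 1) \<and>
       (\<forall>w\<in>ball 0 1. \<forall>u v.
          curvature (ball 0 1) T w u v - curvature (ball 0 1) S w u v =
          form11 (\<lambda>i j. mixed_d i j \<psi> w) u v))"
proof -
  define b where "b = (partial_sum ^^ n) unit_sequence"
  define c where "c = (backward_difference ^^ n) a"
  have TT: "radial_kernel_space b (\<lambda>z w. (1 - hprod z w) powi (- int n)) ev\<^sub>T T"
  proof
    show "b i > 0" for i unfolding b_def by (rule partial_sum_power_unit_pos[OF assms(1)])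
    show "(\<lambda>i. complex_of_real (b i) * hprod z w ^ i) sums ((1 - hprod z w) powi (- int n))"
      if "z \<in> ball 0 1" "w \<in> ball 0 1" for z w :: "complex^'m"
      using partial_sum_power_unit_sums(2)[OF hprod_in_disc[OF that], of n]
      by (simp add: b_def power_int_minus)
  qed (use assms in auto)
  have SS: "radial_kernel_space a K ev\<^sub>S S"
    by standard (use assms in auto)
  interpret T: radial_kernel_space b "\<lambda>z w. (1 - hprod z w) powi (- int n)" ev\<^sub>T T by (rule TT)
  interpret S: radial_kernel_space a K ev\<^sub>S S by (rule SS)
  interpret C: nonneg_power_series c
    unfolding c_def by (rule S.quotient_power_series[OF assms(1,10)])
  interpret Q: kernel_quotient b "\<lambda>z w. (1 - hprod z w) powi (- int n)" ev\<^sub>T T a K ev\<^sub>S S c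
  proof
    fix x :: real assume x: "0 \<le> x" "x < 1"
    have "(\<lambda>i. complex_of_real (b i) * of_real x ^ i) sums inverse ((1 - of_real x) ^ n)"
      unfolding b_def by (rule partial_sum_power_unit_sums(2)) (use x in simp)
    then have "T.complex_series (of_real x) = inverse ((1 - of_real x) ^ n)"
      by (simp add: T.complex_series_def sums_iff)
    then have "complex_of_real (T.real_series x) = of_real (inverse ((1 - x) ^ n))"
      using T.complex_series_of_real[of x] x by simp
    then have "T.real_series x = inverse ((1 - x) ^ n)" by (simp only: of_real_eq_iff)
    moreover have "complex_of_real (C.real_series x) = (1 - of_real x) ^ n * of_real (S.real_series x)"
    proof -
      have "(\<lambda>i. complex_of_real (a i) * of_real x ^ i) sums of_real (S.real_series x)"
        using S.complex_series_of_real[of x] S.summable_complex[of "of_real x"] x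
        by (simp add: S.complex_series_def sums_iff)
      from backward_difference_power_sums[OF this, of n, folded c_def] show ?thesis
        using C.complex_series_of_real[of x] x by (simp add: C.complex_series_def sums_iff)
    qed
    then have "complex_of_real (C.real_series x) = of_real ((1 - x) ^ n * S.real_series x)" by simp
    then have "C.real_series x = (1 - x) ^ n * S.real_series x" by (simp only: of_real_eq_iff)
    ultimately show "S.real_series x = C.real_series x * T.real_series x" using x by simp
  qed
  show ?thesis
  proof
    assume "similar_tuples T S"
    then obtain L where "\<And>x. 0 \<le> x \<Longrightarrow> x < 1 \<Longrightarrow> C.real_series x \<le> L"
      using Q.similar_imp_quotient_bounded by blast
    then have bdd: "bounded (Q.potential ` ball 0 1)" by (rule Q.bounded_imp_potential)
    show "\<exists>\<psi> :: complex ^ 'm \<Rightarrow> real.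
       bounded (\<psi> ` ball 0 1) \<and> plurisubharmonic_on \<psi> (ball 0 1) \<and>
       twice_differentiable_on \<psi> (ball 0 1) \<and>
       (\<forall>w\<in>ball 0 1. \<forall>u v.
          curvature (ball 0 1) T w u v - curvature (ball 0 1) S w u v =
          form11 (\<lambda>i j. mixed_d i j \<psi> w) u v)"
      by (intro exI[of _ Q.potential] conjI ballI allI bdd C.ln_real_series_plurisubharmonic
          C.ln_real_series_twice_differentiable Q.curvature_difference)
  next
    assume "\<exists>\<psi> :: complex ^ 'm \<Rightarrow> real.
       bounded (\<psi> ` ball 0 1) \<and> plurisubharmonic_on \<psi> (ball 0 1) \<and>
       twice_differentiable_on \<psi> (ball 0 1) \<and>
       (\<forall>w\<in>ball 0 1. \<forall>u v.
          curvature (ball 0 1) T w u v - curvature (ball 0 1) S w u v =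
          form11 (\<lambda>i j. mixed_d i j \<psi> w) u v)"
    then obtain \<psi> :: "complex ^ 'm \<Rightarrow> real" where \<psi>: "bounded (\<psi> ` ball 0 1)"
      "twice_differentiable_on \<psi> (ball 0 1)"
      "\<And>w u v. w \<in> ball 0 1 \<Longrightarrow> curvature (ball 0 1) T w u v - curvature (ball 0 1) S w u v
        = form11 (\<lambda>i j. mixed_d i j \<psi> w) u v" by auto
    obtain L where "\<And>x. 0 \<le> x \<Longrightarrow> x < 1 \<Longrightarrow> C.real_series x \<le> L"
      using Q.potential_imp_quotient_bounded[OF \<psi>] by blast
    then have L: "partial_sum c i \<le> L" for i by (rule C.bounded_imp_partial_sums_bounded)
    show "similar_tuples T S"
    proof (rule similar_of_comparable_coefficients[OF TT SS])
      show "a i \<le> L * b i" "c 0 * b i \<le> a i" for i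
        using coefficient_comparison[OF assms(1) c_def C.nonneg L] by (simp_all add: b_def)
      show "c 0 > 0" by (rule C.pos0)
    qed
  qed
qed

end
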